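(* Let $\delta>0$ and let $(a_n)_{n\in\mathbb Z}$, $(b_n)_{n\in\mathbb Z}$ be bounded real sequences with $a_n\ge\delta$ for all $n$. Then for every $\epsilon>0$ there exist real sequences $(\tilde a_n)$, $(\tilde b_n)$ with $\|\tilde a-a\|_\infty<\epsilon$ and $\|\tilde b-b\|_\infty<\epsilon$ such that the Jacobi operator $\widetilde J=J(\tilde a,\tilde b)$ on $\ell^2(\mathbb Z)$ has purely pure point spectrum, with an orthonormal basis of eigenfunctions each of which decays exponentially (i.e. for each eigenfunction $u$ there are $C_u,\eta_u>0$ with $|u(m)|\le C_u e^{-\eta_u|m|}$ for all $m$).
   Context: For bounded real sequences $a,b$ on $\mathbb Z$, the Jacobi operator $J(a,b)$ on $\ell^2(\mathbb Z)$ is $(J(a,b)\phi)(n)=a_n\phi(n+1)+a_{n-1}\phi(n-1)+b_n\phi(n)$. *)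

theory Defs
  imports "HOL-Analysis.Analysis"
begin

definition in_l2 :: "(int \<Rightarrow> complex) \<Rightarrow> bool" where
  "in_l2 u \<longleftrightarrow> (\<lambda>n. (norm (u n))\<^sup>2) summable_on UNIV"

definition l2_inner :: "(int \<Rightarrow> complex) \<Rightarrow> (int \<Rightarrow> complex) \<Rightarrow> complex" where
  "l2_inner u v = (\<Sum>\<^sub>\<infinity>n. cnj (u n) * v n)"

definition jacobi :: "(int \<Rightarrow> real) \<Rightarrow> (int \<Rightarrow> real) \<Rightarrow> (int \<Rightarrow> complex) \<Rightarrow> (int \<Rightarrow> complex)" where
  "jacobi a b \<phi> n = of_real (a n) * \<phi> (n + 1) + of_real (a (n - 1)) * \<phi> (n - 1) + of_real (b n) * \<phi> n"

definition bounded_seq :: "(int \<Rightarrow> real) \<Rightarrow> bool" where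
  "bounded_seq a \<longleftrightarrow> (\<exists>M. \<forall>n. \<bar>a n\<bar> \<le> M)"

definition is_eigenfunction :: "(int \<Rightarrow> real) \<Rightarrow> (int \<Rightarrow> real) \<Rightarrow> (int \<Rightarrow> complex) \<Rightarrow> bool" where
  "is_eigenfunction a b u \<longleftrightarrow> in_l2 u \<and> u \<noteq> (\<lambda>_. 0) \<and> (\<exists>E::complex. jacobi a b u = (\<lambda>n. E * u n))"

definition l2_onb :: "(int \<Rightarrow> complex) set \<Rightarrow> bool" where
  "l2_onb B \<longleftrightarrow>
     (\<forall>u\<in>B. in_l2 u \<and> l2_inner u u = 1) \<and>
     (\<forall>u\<in>B. \<forall>v\<in>B. u \<noteq> v \<longrightarrow> l2_inner u v = 0) \<and>
     (\<forall>v. in_l2 v \<and> (\<forall>u\<in>B. l2_inner u v = 0) \<longrightarrow> v = (\<lambda>_. 0))"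

definition exp_decaying :: "(int \<Rightarrow> complex) \<Rightarrow> bool" where
  "exp_decaying u \<longleftrightarrow> (\<exists>C>0. \<exists>\<eta>>0. \<forall>m. norm (u m) \<le> C * exp (- \<eta> * of_int \<bar>m\<bar>))"

end

theory Submission
  imports Defs "HOL-Probability.Probability"
begin

text \<open>
  Only the diagonal is perturbed, by independent random variables uniform on a small interval.

  For a fixed energy, the ratios of a solution of the eigenvalue equation on a half line form a Markov chain, and the
  expectation of the inverse growth of the solution is governed by products of operators on \<open>L\<^sup>2\<close> of the form
  ``average over translations, then invert''. Inversion is unitary and averaging is a contraction, and two successive
  steps contract strictly: a function almost invariant under a translation has its mass near infinity, inversion
  moves the mass near zero, and such a function is not almost invariant. The gap depends only on the size of the
  perturbation and on an upper bound for \<open>a\<close>. Hence, with probability close to one, the solution that vanishes beyond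
  the end of a finite box decays exponentially from a given site towards that end, uniformly in box and energy.

  This event does not involve the potential at the given site \<open>m\<close>, so spectral averaging over that potential turns
  the estimate at fixed energy into one for eigenvalues: in the box, the eigenvectors that do not decay from \<open>m\<close> carry
  little of the spectral measure of \<open>\<delta>\<^sub>m\<close>. Decaying eigenvectors have a weight at \<open>m\<close> that is bounded below, so there are
  boundedly many of them and they converge along subsequences of boxes to exponentially decaying eigenfunctions on
  the whole line. Consequently a vector orthogonal to all such eigenfunctions vanishes at every site.
\<close>

section \<open>A spectral gap for averaging and inversion\<close>

text \<open>The coefficients are arbitrary bounded sequences, so the chain of ratios is not
  stationary and no ergodic theorem or Lyapunov exponent is available: every pair of steps must
  contract by the same factor. A uniform law on \<open>[0, 2t]\<close> is the convolution of the
  uniform law on \<open>[0, t]\<close> with the fair law on \<open>{0, t}\<close>. The two-point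
  average loses exactly a quarter of the squared L2 norm of \<open>f (x + t) - f x\<close>, and this
  makes the gap explicit. If two steps contract squared norms by \<open>\<rho> ^ 8\<close>, expected
  ratios decay like \<open>\<rho> ^ 2\<close> per site. One factor \<open>\<rho>\<close> per site is
  kept as the rate of decay; the other makes the union over sites summable, uniformly in the box.
  Eigenvalues depend on the potential and energies are uncountably many, so no union over energies
  is possible. Instead a smeared spectral measure is integrated over all energies by Fubini. Fatou
  then controls infinitely many boxes only, which is enough for a compactness argument.\<close>

abbreviation sqint :: "(real \<Rightarrow> real) \<Rightarrow> ennreal" where
  "sqint f \<equiv> \<integral>\<^sup>+x. ennreal ((f x)\<^sup>2) \<partial>lborel"

abbreviation L2sq :: "(real \<Rightarrow> ennreal) \<Rightarrow> ennreal" where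
  "L2sq h \<equiv> \<integral>\<^sup>+x. (h x)\<^sup>2 \<partial>lborel"

abbreviation shift_sqint :: "real \<Rightarrow> (real \<Rightarrow> real) \<Rightarrow> ennreal" where
  "shift_sqint t f \<equiv> \<integral>\<^sup>+x. ennreal ((f (x + t) - f x)\<^sup>2) \<partial>lborel"

text \<open>The map \<open>x \<mapsto> - c / x\<close> carries the positive half line increasingly
  onto the negative one, with derivative \<open>c / x\<^sup>2\<close>. Substitution on the compact
  intervals \<open>J k\<close> is followed by monotone convergence.\<close>

lemma nn_integral_inversion_halfline:
  fixes f :: "real \<Rightarrow> ennreal"
  assumes f[measurable]: "f \<in> borel_measurable borel" and c: "c > 0"
  shows "(\<integral>\<^sup>+x. f (- c / x) * ennreal (c / x\<^sup>2) * indicator {0<..} x \<partial>lborel) =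
    (\<integral>\<^sup>+x. f x * indicator {..<0} x \<partial>lborel)"
proof -
  \<comment> \<open>The offset 2 keeps the interval nondegenerate at \<open>k = 0\<close>.\<close>
  define J where "J k = {1 / real (k + 2) .. real (k + 2)}" for k :: nat
  define J' where "J' k = {- c * real (k + 2) .. - c / real (k + 2)}" for k :: nat
  have ex_large: "\<exists>k. 1 / real (k + 2) \<le> x \<and> x \<le> real (k + 2)" if "x > 0" for x :: real
  proof -
    obtain k where k: "real k \<ge> max x (1 / x)" using real_arch_simple by blast
    hence "1 / x \<le> real (k + 2)" by auto
    hence "1 / real (k + 2) \<le> x" using that by (simp add: field_simps)
    thus ?thesis using k by (intro exI[of _ k]) auto
  qed
  have incJ: "incseq J"
    unfolding J_def mono_def by (auto simp: field_simps intro: order_trans[rotated])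
  have incJ': "incseq J'"
  proof (rule incseq_SucI)
    fix k
    have "c * real (k + 2) \<le> c * real (Suc k + 2)" using c by (intro mult_left_mono) auto
    moreover have "c / real (Suc k + 2) \<le> c / real (k + 2)" using c by (intro divide_left_mono) auto
    ultimately show "J' k \<subseteq> J' (Suc k)" unfolding J'_def by auto
  qed
  have supJ: "(SUP k. indicator (J k) x) = (indicator {0<..} x :: ennreal)" for x
  proof (cases "x > 0")
    case True
    then obtain k where "x \<in> J k" using ex_large[OF True] unfolding J_def by auto
    hence "(SUP k. indicator (J k) x) = (1::ennreal)"
      by (intro antisym SUP_least SUP_upper2[of k]) (auto simp: indicator_def)
    thus ?thesis using True by simp
  next
    case False
    have "1 / real (k + 2) > 0" for k by simp
    hence "x \<notin> J k" for k using False less_le_trans[of 0 "1 / real (k + 2)" x] unfolding J_def atLeastAtMost_iff by blast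
    thus ?thesis using False by simp
  qed
  have supJ': "(SUP k. indicator (J' k) x) = (indicator {..<0} x :: ennreal)" for x
  proof (cases "x < 0")
    case True
    hence "- x / c > 0" using c by (simp add: divide_neg_pos)
    then obtain k where k: "1 / real (k + 2) \<le> - x / c" "- x / c \<le> real (k + 2)"
      using ex_large[of "- x / c"] by blast
    hence "x \<in> J' k" using c unfolding J'_def by (auto simp: field_simps)
    hence "(SUP k. indicator (J' k) x) = (1::ennreal)"
      by (intro antisym SUP_least SUP_upper2[of k]) (auto simp: indicator_def)
    thus ?thesis using True by simp
  next
    case False
    have "c / real (k + 2) > 0" for k using c by simp
    hence "- c / real (k + 2) < 0" for k by simp
    hence "x \<notin> J' k" for k using False le_less_trans[of x "- c / real (k + 2)" 0]
      unfolding J'_def atLeastAtMost_iff by blast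
    thus ?thesis using False by simp
  qed
  have eq: "(\<integral>\<^sup>+x. f x * indicator (J' k) x \<partial>lborel) =
      (\<integral>\<^sup>+x. f (- c / x) * ennreal (c / x\<^sup>2) * indicator (J k) x \<partial>lborel)" for k
  proof -
    have "1 / real (k + 2) < 1" "1 < real (k + 2)" by auto
    hence less: "1 / real (k + 2) < real (k + 2)" by linarith
    have pos: "x > 0" if "x \<in> {1 / real (k + 2) .. real (k + 2)}" for x
      using that less_le_trans[of 0 "1 / real (k + 2)" x] by simp
    have "(\<integral>\<^sup>+x. f x * indicator {- c / (1 / real (k + 2)) .. - c / real (k + 2)} x \<partial>lborel) =
      (\<integral>\<^sup>+x. f (- c / x) * ennreal (c / x\<^sup>2) * indicator {1 / real (k + 2) .. real (k + 2)} x \<partial>lborel)"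
    proof (rule nn_integral_substitution_aux[where g = "\<lambda>x. - c / x"])
      show "((\<lambda>x. - c / x) has_real_derivative c / x\<^sup>2) (at x)" if "x \<in> {1 / real (k + 2) .. real (k + 2)}" for x
        using pos[OF that] by (auto intro!: derivative_eq_intros simp: power2_eq_square)
      show "continuous_on {1 / real (k + 2)..real (k + 2)} (\<lambda>x. c / x\<^sup>2)"
        using pos by (intro continuous_intros) fastforce
    qed (use c less in auto)
    thus ?thesis unfolding J_def J'_def by simp
  qed
  have "(\<integral>\<^sup>+x. f (- c / x) * ennreal (c / x\<^sup>2) * indicator {0<..} x \<partial>lborel) =
     (\<integral>\<^sup>+x. (SUP k. f (- c / x) * ennreal (c / x\<^sup>2) * indicator (J k) x) \<partial>lborel)"
    by (simp add: SUP_mult_left_ennreal[symmetric] supJ)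
  also have "\<dots> = (SUP k. \<integral>\<^sup>+x. f (- c / x) * ennreal (c / x\<^sup>2) * indicator (J k) x \<partial>lborel)"
  proof (rule nn_integral_monotone_convergence_SUP)
    show "incseq (\<lambda>k x. f (- c / x) * ennreal (c / x\<^sup>2) * indicator (J k) x)"
      using incJ by (intro monoI le_funI mult_left_mono) (auto simp: mono_def indicator_def)
  qed (auto simp: J_def)
  also have "\<dots> = (SUP k. \<integral>\<^sup>+x. f x * indicator (J' k) x \<partial>lborel)" by (simp add: eq)
  also have "\<dots> = (\<integral>\<^sup>+x. (SUP k. f x * indicator (J' k) x) \<partial>lborel)"
  proof (rule nn_integral_monotone_convergence_SUP[symmetric])
    show "incseq (\<lambda>k x. f x * indicator (J' k) x)"
      using incJ' by (intro monoI le_funI mult_left_mono) (auto simp: mono_def indicator_def)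
  qed (auto simp: J'_def)
  also have "\<dots> = (\<integral>\<^sup>+x. f x * indicator {..<0} x \<partial>lborel)"
    by (simp add: SUP_mult_left_ennreal[symmetric] supJ')
  finally show ?thesis .
qed

lemma nn_integral_reflect_real:
  fixes f :: "real \<Rightarrow> ennreal"
  assumes "f \<in> borel_measurable borel"
  shows "(\<integral>\<^sup>+x. f (- x) \<partial>lborel) = (\<integral>\<^sup>+x. f x \<partial>lborel)"
  using nn_integral_real_affine[of f "-1" 0] assms by simp

lemma nn_integral_shift_real:
  fixes f :: "real \<Rightarrow> ennreal"
  assumes "f \<in> borel_measurable borel"
  shows "(\<integral>\<^sup>+x. f (x + s) \<partial>lborel) = (\<integral>\<^sup>+x. f x \<partial>lborel)"
  using nn_integral_real_affine[of f 1 s] assms by (simp add: add.commute)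

text \<open>With \<open>c = a\<^sup>2\<close> this says that
  \<open>f \<mapsto> a / \<bar>y\<bar> * f (- a\<^sup>2 / y)\<close> preserves the L2 norm. The two
  half lines are exchanged and the null set \<open>{0}\<close> is dropped.\<close>

lemma nn_integral_inversion:
  fixes f :: "real \<Rightarrow> ennreal"
  assumes f[measurable]: "f \<in> borel_measurable borel" and c: "c > 0"
  shows "(\<integral>\<^sup>+x. f (- c / x) * ennreal (c / x\<^sup>2) \<partial>lborel) = (\<integral>\<^sup>+x. f x \<partial>lborel)"
proof -
  have split: "(\<integral>\<^sup>+x. h x \<partial>lborel) =
      (\<integral>\<^sup>+x. h x * indicator {0<..} x \<partial>lborel) + (\<integral>\<^sup>+x. h x * indicator {..<0} x \<partial>lborel)"
    if [measurable]: "h \<in> borel_measurable borel" for h :: "real \<Rightarrow> ennreal"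
  proof -
    have "(\<integral>\<^sup>+x. h x \<partial>lborel) = (\<integral>\<^sup>+x. h x * indicator {0<..} x + h x * indicator {..<0} x \<partial>lborel)"
      by (rule nn_integral_cong_AE, use AE_lborel_singleton[of 0] in eventually_elim) (auto simp: indicator_def)
    thus ?thesis by (simp add: nn_integral_add)
  qed
  have neg: "(\<integral>\<^sup>+x. f (- c / x) * ennreal (c / x\<^sup>2) * indicator {..<0} x \<partial>lborel) =
     (\<integral>\<^sup>+x. f x * indicator {0<..} x \<partial>lborel)"
  proof -
    have "(\<integral>\<^sup>+x. f (- c / x) * ennreal (c / x\<^sup>2) * indicator {..<0} x \<partial>lborel) =
      (\<integral>\<^sup>+x. f (- c / (- x)) * ennreal (c / (- x)\<^sup>2) * indicator {..<0} (- x) \<partial>lborel)"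
      by (rule nn_integral_reflect_real[symmetric]) measurable
    also have "\<dots> = (\<integral>\<^sup>+x. (\<lambda>z. f (- z)) (- c / x) * ennreal (c / x\<^sup>2) * indicator {0<..} x \<partial>lborel)"
      by (intro nn_integral_cong) (auto simp: indicator_def)
    also have "\<dots> = (\<integral>\<^sup>+x. f (- x) * indicator {..<0} x \<partial>lborel)"
      using c by (intro nn_integral_inversion_halfline) auto
    also have "\<dots> = (\<integral>\<^sup>+x. f (- (- x)) * indicator {..<0} (- x) \<partial>lborel)"
      by (rule nn_integral_reflect_real[symmetric]) measurable
    also have "\<dots> = (\<integral>\<^sup>+x. f x * indicator {0<..} x \<partial>lborel)"
      by (intro nn_integral_cong) (auto simp: indicator_def)
    finally show ?thesis .
  qed
  have "(\<integral>\<^sup>+x. f (- c / x) * ennreal (c / x\<^sup>2) \<partial>lborel) =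
     (\<integral>\<^sup>+x. f (- c / x) * ennreal (c / x\<^sup>2) * indicator {0<..} x \<partial>lborel) +
     (\<integral>\<^sup>+x. f (- c / x) * ennreal (c / x\<^sup>2) * indicator {..<0} x \<partial>lborel)"
    by (rule split) measurable
  also have "\<dots> = (\<integral>\<^sup>+x. f x * indicator {..<0} x \<partial>lborel) + (\<integral>\<^sup>+x. f x * indicator {0<..} x \<partial>lborel)"
    by (simp only: neg nn_integral_inversion_halfline[OF f c])
  also have "\<dots> = (\<integral>\<^sup>+x. f x \<partial>lborel)"
    by (subst split[OF f]) (rule add.commute)
  finally show ?thesis .
qed

lemma power2_telescope_le:
  fixes g :: "nat \<Rightarrow> real"
  shows "(g n - g 0)\<^sup>2 \<le> real n * (\<Sum>i<n. (g (Suc i) - g i)\<^sup>2)"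
proof -
  have "(g n - g 0)\<^sup>2 = (\<Sum>i<n. g (Suc i) - g i)\<^sup>2" by (simp add: sum_lessThan_telescope)
  also have "\<dots> \<le> real n * (\<Sum>i<n. (g (Suc i) - g i)\<^sup>2)"
    using Cauchy_Schwarz_ineq_sum[of "\<lambda>_. 1" "\<lambda>i. g (Suc i) - g i" "{..<n}"] by simp
  finally show ?thesis .
qed

text \<open>A translation by \<open>n * t\<close> is a chain of \<open>n\<close> translations by
  \<open>t\<close>; Cauchy--Schwarz turns this into the factor \<open>n\<^sup>2\<close> for squared
  norms.\<close>

lemma nn_integral_translate_power2_le:
  fixes g :: "real \<Rightarrow> real"
  assumes g[measurable]: "g \<in> borel_measurable borel"
  shows "(\<integral>\<^sup>+x. ennreal ((g (x + real n * t) - g x)\<^sup>2) \<partial>lborel) \<le>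
    ennreal ((real n)\<^sup>2) * shift_sqint t g"
proof -
  have "(\<integral>\<^sup>+x. ennreal ((g (x + real n * t) - g x)\<^sup>2) \<partial>lborel) \<le>
     (\<integral>\<^sup>+x. ennreal (real n) * (\<Sum>i<n. ennreal ((g ((x + real i * t) + t) - g (x + real i * t))\<^sup>2)) \<partial>lborel)"
  proof (intro nn_integral_mono)
    fix x
    have "(g (x + real n * t) - g x)\<^sup>2 \<le> real n * (\<Sum>i<n. (g ((x + real i * t) + t) - g (x + real i * t))\<^sup>2)"
      using power2_telescope_le[of "\<lambda>i. g (x + real i * t)" n] by (simp add: algebra_simps)
    thus "ennreal ((g (x + real n * t) - g x)\<^sup>2) \<le>
        ennreal (real n) * (\<Sum>i<n. ennreal ((g ((x + real i * t) + t) - g (x + real i * t))\<^sup>2))"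
      by (simp add: sum_ennreal ennreal_mult'[symmetric] sum_nonneg)
  qed
  also have "\<dots> = ennreal (real n) * (\<Sum>i<n. \<integral>\<^sup>+x. ennreal ((g ((x + real i * t) + t) - g (x + real i * t))\<^sup>2) \<partial>lborel)"
    by (subst nn_integral_cmult, measurable) (subst nn_integral_sum, auto)
  also have "\<dots> = ennreal (real n) * (\<Sum>i<n. \<integral>\<^sup>+x. ennreal ((g (x + t) - g x)\<^sup>2) \<partial>lborel)"
    by (intro arg_cong2[where f = "(*)"] refl sum.cong
       nn_integral_shift_real[where f = "\<lambda>x. ennreal ((g (x + t) - g x)\<^sup>2)"]) measurable
  also have "\<dots> = ennreal ((real n)\<^sup>2) * shift_sqint t g"
    by (simp add: power2_eq_square ennreal_mult mult.assoc ennreal_of_nat_eq_real_of_nat)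
  finally show ?thesis .
qed

text \<open>A function that is almost invariant under one translation carries little mass on a bounded
  interval: eight disjoint translates of the interval carry almost the same mass.\<close>

lemma nn_integral_interval_mass_le:
  fixes g :: "real \<Rightarrow> real" and r :: nat
  assumes g[measurable]: "g \<in> borel_measurable borel" and t: "t > 0"
  defines "D \<equiv> \<integral>\<^sup>+x. ennreal ((g (x + t) - g x)\<^sup>2) \<partial>lborel"
  shows "(\<integral>\<^sup>+x. ennreal ((g x)\<^sup>2) * indicator {c..<c + real r * t} x \<partial>lborel) \<le>
    ennreal (1/4) * sqint g + ennreal (128 * (real r)\<^sup>2) * D"
proof -
  define I where "I k = {c + real (k * r) * t ..< c + real (k * r) * t + real r * t}" for k :: nat
  let ?m = "\<lambda>k. \<integral>\<^sup>+x. ennreal ((g x)\<^sup>2) * indicator (I k) x \<partial>lborel"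
  have I0: "I 0 = {c..<c + real r * t}" by (simp add: I_def)
  \<comment> \<open>The error \<open>128 * r\<^sup>2\<close> is \<open>2 * (8 * r)\<^sup>2\<close>:
    the translates are fewer than \<open>8 * r\<close> steps away, and the 2 is that of
    \<open>u\<^sup>2 \<le> 2 * v\<^sup>2 + 2 * (v - u)\<^sup>2\<close>.\<close>
  have step: "?m 0 \<le> 2 * ?m k + ennreal (128 * (real r)\<^sup>2) * D" if k: "k < 8" for k
  proof -
    have "?m 0 \<le> (\<integral>\<^sup>+x. 2 * (ennreal ((g (x + real (k * r) * t))\<^sup>2) * indicator (I k) (x + real (k * r) * t)) +
        2 * ennreal ((g (x + real (k * r) * t) - g x)\<^sup>2) \<partial>lborel)"
    proof (intro nn_integral_mono)
      fix x
      let ?y = "g (x + real (k * r) * t)"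
      have "0 \<le> (2 * ?y - g x)\<^sup>2" by simp
      hence "(g x)\<^sup>2 \<le> 2 * ?y\<^sup>2 + 2 * (?y - g x)\<^sup>2" by (simp add: power2_eq_square algebra_simps)
      hence "ennreal ((g x)\<^sup>2) \<le> ennreal (2 * ?y\<^sup>2 + 2 * (?y - g x)\<^sup>2)" by (rule ennreal_leI)
      also have "\<dots> = 2 * ennreal (?y\<^sup>2) + 2 * ennreal ((?y - g x)\<^sup>2)"
        by (simp add: ennreal_plus ennreal_mult')
      finally have "ennreal ((g x)\<^sup>2) \<le> 2 * ennreal (?y\<^sup>2) + 2 * ennreal ((?y - g x)\<^sup>2)" .
      moreover have "indicator (I k) (x + real (k * r) * t) = (indicator (I 0) x :: ennreal)"
        by (auto simp: I_def indicator_def)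
      ultimately show "ennreal ((g x)\<^sup>2) * indicator (I 0) x \<le>
         2 * (ennreal (?y\<^sup>2) * indicator (I k) (x + real (k * r) * t)) + 2 * ennreal ((?y - g x)\<^sup>2)"
        by (cases "x \<in> I 0") auto
    qed
    also have "\<dots> = 2 * (\<integral>\<^sup>+x. ennreal ((g (x + real (k * r) * t))\<^sup>2) * indicator (I k) (x + real (k * r) * t) \<partial>lborel) +
       2 * (\<integral>\<^sup>+x. ennreal ((g (x + real (k * r) * t) - g x)\<^sup>2) \<partial>lborel)"
      by (simp add: nn_integral_add nn_integral_cmult I_def)
    also have "(\<integral>\<^sup>+x. ennreal ((g (x + real (k * r) * t))\<^sup>2) * indicator (I k) (x + real (k * r) * t) \<partial>lborel) = ?m k"
      by (rule nn_integral_shift_real[where f = "\<lambda>x. ennreal ((g x)\<^sup>2) * indicator (I k) x"]) (simp add: I_def)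
    also have "2 * (\<integral>\<^sup>+x. ennreal ((g (x + real (k * r) * t) - g x)\<^sup>2) \<partial>lborel) \<le> 2 * (ennreal ((real (k * r))\<^sup>2) * D)"
      unfolding D_def by (intro mult_left_mono nn_integral_translate_power2_le) auto
    also have "\<dots> = ennreal (2 * (real (k * r))\<^sup>2) * D"
      by (simp add: ennreal_mult' mult.assoc)
    also have "\<dots> \<le> ennreal (128 * (real r)\<^sup>2) * D"
    proof (intro mult_right_mono ennreal_leI)
      have "(real k)\<^sup>2 \<le> 8\<^sup>2" using k by (intro power_mono) auto
      hence "(real k)\<^sup>2 * (real r)\<^sup>2 \<le> 64 * (real r)\<^sup>2" by (intro mult_right_mono) auto
      thus "2 * (real (k * r))\<^sup>2 \<le> 128 * (real r)\<^sup>2" by (simp add: power_mult_distrib)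
    qed auto
    finally show ?thesis by (simp add: add_left_mono)
  qed
  have disj: "(\<Sum>k<8. indicator (I k) x) \<le> (1::ennreal)" for x
  proof -
    have disjoint: "I p \<inter> I q = {}" if "p < q" for p q
    proof -
      have "real (p * r) * t + real r * t = real (Suc p * r) * t" by (simp add: algebra_simps)
      also have "\<dots> \<le> real (q * r) * t" using that t
        by (intro mult_right_mono of_nat_mono mult_le_mono1) auto
      finally show ?thesis unfolding I_def by auto
    qed
    have "disjoint_family_on I {..<8}"
      unfolding disjoint_family_on_def
    proof (intro ballI impI)
      fix i j :: nat assume "i \<noteq> j"
      thus "I i \<inter> I j = {}" using disjoint[of i j] disjoint[of j i] by (cases "i < j") auto
    qed
    hence "(\<Sum>k<8. indicator (I k) x) = (indicator (\<Union>k<8. I k) x :: ennreal)"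
      by (intro indicator_UN_disjoint[symmetric]) auto
    thus ?thesis by (simp add: indicator_def)
  qed
  \<comment> \<open>Over eight translates the factor 2 becomes 2/8 = 1/4, so that two such
    estimates, one near 0 and one near infinity, can be absorbed into the total mass with half of it
    to spare.\<close>
  have "8 * ?m 0 = (\<Sum>k<(8::nat). ?m 0)" by simp
  also have "\<dots> \<le> (\<Sum>k<8. 2 * ?m k + ennreal (128 * (real r)\<^sup>2) * D)"
    by (intro sum_mono step) auto
  also have "\<dots> = 2 * (\<Sum>k<8. ?m k) + 8 * (ennreal (128 * (real r)\<^sup>2) * D)"
    by (simp add: sum.distrib sum_distrib_left)
  also have "(\<Sum>k<8. ?m k) = (\<integral>\<^sup>+x. ennreal ((g x)\<^sup>2) * (\<Sum>k<8. indicator (I k) x) \<partial>lborel)"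
    by (subst nn_integral_sum[symmetric]) (auto simp: I_def sum_distrib_left)
  also have "\<dots> \<le> (\<integral>\<^sup>+x. ennreal ((g x)\<^sup>2) * 1 \<partial>lborel)"
    by (intro nn_integral_mono mult_left_mono disj) auto
  finally have "8 * ?m 0 \<le> 2 * sqint g + 8 * (ennreal (128 * (real r)\<^sup>2) * D)"
    by (simp add: add_right_mono mult_left_mono)
  hence "ennreal (1/8) * (8 * ?m 0) \<le> ennreal (1/8) * (2 * sqint g + 8 * (ennreal (128 * (real r)\<^sup>2) * D))"
    by (rule mult_left_mono) auto
  also have "\<dots> = (ennreal (1/8) * ennreal 2) * sqint g + (ennreal (1/8) * ennreal 8) * (ennreal (128 * (real r)\<^sup>2) * D)"
    by (simp add: algebra_simps)
  also have "ennreal (1/8) * (8 * ?m 0) = (ennreal (1/8) * ennreal 8) * ?m 0"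
    by (simp add: algebra_simps)
  also have "ennreal (1/8) * ennreal 8 = 1" by (subst ennreal_mult[symmetric]) auto
  also have "ennreal (1/8) * ennreal 2 = ennreal (1/4)" by (subst ennreal_mult[symmetric]) auto
  finally show ?thesis by (simp add: I0)
qed

text \<open>The parallelogram law, integrated over the line.\<close>

lemma averaging_energy_identity:
  fixes f :: "real \<Rightarrow> real"
  assumes f[measurable]: "f \<in> borel_measurable borel"
  shows "(\<integral>\<^sup>+x. ennreal (((f x + f (x + t)) / 2)\<^sup>2) \<partial>lborel) +
      ennreal (1/4) * shift_sqint t f = sqint f"
proof -
  have "(\<integral>\<^sup>+x. ennreal (((f x + f (x + t)) / 2)\<^sup>2) \<partial>lborel) +
      ennreal (1/4) * shift_sqint t f =
     (\<integral>\<^sup>+x. ennreal (((f x + f (x + t)) / 2)\<^sup>2) + ennreal (1/4) * ennreal ((f (x + t) - f x)\<^sup>2) \<partial>lborel)"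
    by (simp add: nn_integral_add nn_integral_cmult)
  also have "\<dots> = (\<integral>\<^sup>+x. ennreal (1/2) * ennreal ((f x)\<^sup>2) + ennreal (1/2) * ennreal ((f (x + t))\<^sup>2) \<partial>lborel)"
  proof (intro nn_integral_cong)
    fix x
    have *: "ennreal u + ennreal (1/4) * ennreal v = ennreal (1/2) * ennreal p + ennreal (1/2) * ennreal q"
      if "u + 1/4 * v = 1/2 * p + 1/2 * q" "u \<ge> 0" "v \<ge> 0" "p \<ge> 0" "q \<ge> 0" for u v p q
      using that by (simp only: ennreal_mult'[symmetric] ennreal_plus[symmetric] mult_nonneg_nonneg
        zero_le_divide_1_iff zero_le_numeral)
    show "ennreal (((f x + f (x + t)) / 2)\<^sup>2) + ennreal (1/4) * ennreal ((f (x + t) - f x)\<^sup>2) =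
        ennreal (1/2) * ennreal ((f x)\<^sup>2) + ennreal (1/2) * ennreal ((f (x + t))\<^sup>2)"
      by (rule *) (simp add: power2_eq_square field_simps, simp_all)
  qed
  also have "\<dots> = ennreal (1/2) * sqint f +
      ennreal (1/2) * (\<integral>\<^sup>+x. ennreal ((f (x + t))\<^sup>2) \<partial>lborel)"
    by (simp add: nn_integral_add nn_integral_cmult)
  also have "(\<integral>\<^sup>+x. ennreal ((f (x + t))\<^sup>2) \<partial>lborel) = sqint f"
    by (rule nn_integral_shift_real[where f = "\<lambda>x. ennreal ((f x)\<^sup>2)"]) measurable
  also have "ennreal (1/2) * sqint f + ennreal (1/2) * sqint f
      = (ennreal (1/2) + ennreal (1/2)) * sqint f"
    by (simp only: distrib_right)
  also have "ennreal (1/2) + ennreal (1/2) = 1" by (subst ennreal_plus[symmetric]) auto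
  finally show ?thesis by simp
qed

text \<open>Averaging commutes with translation and contracts, so it cannot increase the failure of
  invariance.\<close>

lemma averaging_translate_diff_le:
  fixes f :: "real \<Rightarrow> real"
  assumes f[measurable]: "f \<in> borel_measurable borel"
  shows "(\<integral>\<^sup>+x. ennreal (((f (x + t) + f (x + t + t)) / 2 - (f x + f (x + t)) / 2)\<^sup>2) \<partial>lborel) \<le>
      shift_sqint t f"
proof -
  define d where "d x = f (x + t) - f x" for x
  have [measurable]: "d \<in> borel_measurable borel" unfolding d_def by measurable
  have "(\<integral>\<^sup>+x. ennreal (((f (x + t) + f (x + t + t)) / 2 - (f x + f (x + t)) / 2)\<^sup>2) \<partial>lborel) =
     (\<integral>\<^sup>+x. ennreal (((d x + d (x + t)) / 2)\<^sup>2) \<partial>lborel)"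
    by (intro nn_integral_cong arg_cong[where f = "\<lambda>x. ennreal (x\<^sup>2)"]) (simp add: d_def field_simps)
  also have "\<dots> \<le> sqint d"
    by (subst averaging_energy_identity[of d t, symmetric]) (auto intro: le_iff_add[THEN iffD2])
  finally show ?thesis by (simp add: d_def)
qed

text \<open>The value comes from absorbing the mass estimates: they give
  \<open>X \<le> 1024 * r\<^sup>2 * (F - X)\<close> for the squared norms \<open>F\<close> before
  and \<open>X\<close> after the two averages, where 1024 = 4 * 2 * 128.\<close>

abbreviation gap :: "nat \<Rightarrow> real" where
  "gap r \<equiv> 1 / (1 + 1 / (1024 * (real r)\<^sup>2))"

text \<open>If \<open>f\<close> is almost invariant under the translation then its average \<open>g\<close> has most of its mass near infinity, so
  the inverted function \<open>h\<close> has most of its mass in a bounded interval and is not almost invariant.\<close>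

lemma averaging_inversion_gap_real:
  fixes f :: "real \<Rightarrow> real" and r :: nat
  assumes f[measurable]: "f \<in> borel_measurable borel" and t: "t > 0" and a: "a > 0" "2 * a \<le> real r * t"
    and fin: "sqint f < \<infinity>"
  defines "g \<equiv> \<lambda>x. (f x + f (x + t)) / 2"
  defines "h \<equiv> \<lambda>y. a / \<bar>y\<bar> * g (- a\<^sup>2 / y)"
  shows "(\<integral>\<^sup>+y. ennreal (((h y + h (y + t)) / 2)\<^sup>2) \<partial>lborel) \<le>
    ennreal (gap r) * sqint f"
proof -
  have [measurable]: "g \<in> borel_measurable borel" "h \<in> borel_measurable borel"
    unfolding g_def h_def by measurable
  define F G X Df Dg Dh where
    "F = sqint f" and
    "G = sqint g" and
    "X = (\<integral>\<^sup>+y. ennreal (((h y + h (y + t)) / 2)\<^sup>2) \<partial>lborel)" and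
    "Df = shift_sqint t f" and
    "Dg = shift_sqint t g" and
    "Dh = shift_sqint t h"
  \<comment> \<open>\<open>I\<close> below has width \<open>r * t\<close>, the form that the mass
    estimate needs, and half width \<open>M \<ge> a\<close>; since inversion turns modulus
    \<open>m\<close> into \<open>a\<^sup>2 / m\<close>, it sends the complement of \<open>I\<close>
    into \<open>I\<close>.\<close>
  define M where "M = real r * t / 2"
  have M: "a \<le> M" "M > 0" using a by (auto simp: M_def)
  define I where "I = {- M ..< M}"
  have [measurable]: "I \<in> sets borel" unfolding I_def by simp
  have I_alt: "I = {- M ..< - M + real r * t}" unfolding I_def M_def by (simp add: field_simps)
  have h_sq: "ennreal ((h y)\<^sup>2) = ennreal ((g (- a\<^sup>2 / y))\<^sup>2) * ennreal (a\<^sup>2 / y\<^sup>2)" for y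
    by (simp add: h_def power_mult_distrib power_divide ennreal_mult'[symmetric] mult.commute)
  have h_norm: "sqint h = G"
    unfolding h_sq G_def by (rule nn_integral_inversion[where f = "\<lambda>x. ennreal ((g x)\<^sup>2)"]) (use a in auto)
  have FG: "G + ennreal (1/4) * Df = F"
    unfolding G_def g_def Df_def F_def by (rule averaging_energy_identity) measurable
  have GX: "X + ennreal (1/4) * Dh = G"
    unfolding X_def Dh_def h_norm[symmetric] by (rule averaging_energy_identity) measurable
  have Dg_le: "Dg \<le> Df"
    unfolding Dg_def Df_def g_def by (rule averaging_translate_diff_le) measurable
  have outside: "(\<integral>\<^sup>+x. ennreal ((g x)\<^sup>2) * indicator (- I) x \<partial>lborel) \<le> (\<integral>\<^sup>+y. ennreal ((h y)\<^sup>2) * indicator I y \<partial>lborel)"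
  proof -
    have "(\<integral>\<^sup>+x. ennreal ((g x)\<^sup>2) * indicator (- I) x \<partial>lborel) =
      (\<integral>\<^sup>+y. (ennreal ((g (- a\<^sup>2 / y))\<^sup>2) * indicator (- I) (- a\<^sup>2 / y)) * ennreal (a\<^sup>2 / y\<^sup>2) \<partial>lborel)"
      by (rule nn_integral_inversion[symmetric]) (use a in auto)
    also have "\<dots> \<le> (\<integral>\<^sup>+y. ennreal ((h y)\<^sup>2) * indicator I y \<partial>lborel)"
    proof (intro nn_integral_mono)
      fix y
      have "y \<in> I" if "- a\<^sup>2 / y \<notin> I" "y \<noteq> 0"
      proof (rule ccontr)
        assume "y \<notin> I"
        have aM: "a\<^sup>2 \<le> M\<^sup>2" using M a by (intro power_mono) auto
        have "y < - M \<or> y \<ge> M" using \<open>y \<notin> I\<close> by (auto simp: I_def)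
        thus False
        proof
          assume y: "y < - M"
          hence "0 < - a\<^sup>2 / y" using M(2) a(1) by (intro divide_neg_neg) auto
          moreover have "a\<^sup>2 < M * (- y)"
            using aM y M by (smt (verit) mult_less_cancel_left_pos power2_eq_square)
          hence "- a\<^sup>2 / y < M" using y M by (simp add: field_simps)
          ultimately show False using that M by (auto simp: I_def)
        next
          assume y: "y \<ge> M"
          hence "- a\<^sup>2 / y < 0" using M(2) a(1) by (intro divide_neg_pos) auto
          moreover have "a\<^sup>2 \<le> M * y"
            using aM y M by (smt (verit) mult_le_cancel_left_pos power2_eq_square)
          hence "- M \<le> - a\<^sup>2 / y" using y M by (simp add: field_simps)
          ultimately show False using that M by (auto simp: I_def)
        qed
      qed
      thus "ennreal ((g (- a\<^sup>2 / y))\<^sup>2) * indicator (- I) (- a\<^sup>2 / y) * ennreal (a\<^sup>2 / y\<^sup>2) \<le> ennreal ((h y)\<^sup>2) * indicator I y"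
        unfolding h_sq by (cases "y = 0") (auto simp: indicator_def)
    qed
    finally show ?thesis .
  qed
  \<comment> \<open>Near 0 the mass of \<open>g\<close> is controlled by its own failure of
    invariance \<open>Dg\<close>, away from 0 by that of the inverted function,
    \<open>Dh\<close>.\<close>
  have "G = (\<integral>\<^sup>+x. ennreal ((g x)\<^sup>2) * indicator I x + ennreal ((g x)\<^sup>2) * indicator (- I) x \<partial>lborel)"
    unfolding G_def by (intro nn_integral_cong) (auto simp: indicator_def)
  also have "\<dots> = (\<integral>\<^sup>+x. ennreal ((g x)\<^sup>2) * indicator I x \<partial>lborel) + (\<integral>\<^sup>+x. ennreal ((g x)\<^sup>2) * indicator (- I) x \<partial>lborel)"
    by (simp add: nn_integral_add)
  also have "\<dots> \<le> (ennreal (1/4) * G + ennreal (128 * (real r)\<^sup>2) * Dg) + (ennreal (1/4) * G + ennreal (128 * (real r)\<^sup>2) * Dh)"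
  proof (rule add_mono)
    show "(\<integral>\<^sup>+x. ennreal ((g x)\<^sup>2) * indicator I x \<partial>lborel) \<le> ennreal (1/4) * G + ennreal (128 * (real r)\<^sup>2) * Dg"
      unfolding I_alt G_def Dg_def by (rule nn_integral_interval_mass_le) (use t in auto)
    show "(\<integral>\<^sup>+x. ennreal ((g x)\<^sup>2) * indicator (- I) x \<partial>lborel) \<le> ennreal (1/4) * G + ennreal (128 * (real r)\<^sup>2) * Dh"
      by (rule order_trans[OF outside]) (unfold I_alt h_norm[symmetric] Dh_def, rule nn_integral_interval_mass_le, use t in auto)
  qed
  finally have G_le: "G \<le> (ennreal (1/4) * G + ennreal (128 * (real r)\<^sup>2) * Dg) + (ennreal (1/4) * G + ennreal (128 * (real r)\<^sup>2) * Dh)" .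
  have finF: "F < \<infinity>" using fin by (simp add: F_def)
  have finG: "G < \<infinity>" using FG finF by (metis add_top infinity_ennreal_def le_iff_add le_less_trans)
  have finX: "X < \<infinity>" using GX finG by (metis infinity_ennreal_def le_iff_add le_less_trans)
  have "ennreal (1/4) * Df < \<infinity>" using FG finF by (metis add.commute infinity_ennreal_def le_iff_add le_less_trans)
  hence finDf: "Df < \<infinity>" by (auto simp: ennreal_mult_less_top)
  have "ennreal (1/4) * Dh < \<infinity>" using GX finG by (metis add.commute infinity_ennreal_def le_iff_add le_less_trans)
  hence finDh: "Dh < \<infinity>" by (auto simp: ennreal_mult_less_top)
  have finDg: "Dg < \<infinity>" using Dg_le finDf by (rule le_less_trans)
  obtain F' where F': "F = ennreal F'" "F' \<ge> 0" using finF by (cases F) auto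
  obtain G' where G': "G = ennreal G'" "G' \<ge> 0" using finG by (cases G) auto
  obtain X' where X': "X = ennreal X'" "X' \<ge> 0" using finX by (cases X) auto
  obtain Df' where Df': "Df = ennreal Df'" "Df' \<ge> 0" using finDf by (cases Df) auto
  obtain Dg' where Dg': "Dg = ennreal Dg'" "Dg' \<ge> 0" using finDg by (cases Dg) auto
  obtain Dh' where Dh': "Dh = ennreal Dh'" "Dh' \<ge> 0" using finDh by (cases Dh) auto
  note vals = F' G' X' Df' Dg' Dh'
  have "G' + 1/4 * Df' = F'" using FG vals by (simp add: ennreal_mult'[symmetric] ennreal_plus[symmetric] del: ennreal_plus)
  moreover have "X' + 1/4 * Dh' = G'" using GX vals by (simp add: ennreal_mult'[symmetric] ennreal_plus[symmetric] del: ennreal_plus)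
  moreover have "Dg' \<le> Df'" using Dg_le vals by simp
  moreover have "G' \<le> (1/4 * G' + 128 * (real r)\<^sup>2 * Dg') + (1/4 * G' + 128 * (real r)\<^sup>2 * Dh')"
    using G_le vals by (simp add: ennreal_mult'[symmetric] ennreal_plus[symmetric] del: ennreal_plus)
  \<comment> \<open>The two quarters of \<open>G'\<close> are absorbed on the left; the losses
    \<open>Df' / 4\<close> and \<open>Dh' / 4\<close> add up to \<open>F' - X'\<close>.\<close>
  ultimately have "G' \<le> 256 * (real r)\<^sup>2 * (Df' + Dh')" "F' = X' + (Df' + Dh') / 4" "X' \<le> G'"
    using vals mult_left_mono[of Dg' Df' "128 * (real r)\<^sup>2"] by (auto simp: algebra_simps)
  moreover have r: "real r > 0" using M t unfolding M_def by (auto simp: zero_less_mult_iff)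
  ultimately have "X' \<le> 1024 * (real r)\<^sup>2 * (F' - X')" by (simp add: algebra_simps)
  hence "X' / (1024 * (real r)\<^sup>2) \<le> F' - X'" using r by (simp add: divide_le_eq mult.commute)
  hence "X' * (1 + 1 / (1024 * (real r)\<^sup>2)) \<le> F'" by (simp add: algebra_simps)
  moreover have "1 + 1 / (1024 * (real r)\<^sup>2) > 0" by (simp add: add_pos_nonneg)
  ultimately have "X' \<le> gap r * F'" by (simp add: field_simps)
  hence "X \<le> ennreal (gap r) * F"
    unfolding vals by (subst ennreal_mult'[symmetric]) (auto simp: F'(2) intro!: ennreal_leI)
  thus ?thesis unfolding X_def F_def .
qed

section \<open>Averaging over a uniform law, and the transfer operators\<close>

abbreviation unif :: "real \<Rightarrow> real measure" where
  "unif t \<equiv> uniform_measure lborel {0..t}"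

lemma prob_space_unif: "t > 0 \<Longrightarrow> prob_space (unif t)"
  by (rule prob_space_uniform_measure) auto

lemma sets_unif[simp, measurable_cong]: "sets (unif t) = sets borel"
  by simp

lemma nn_integral_unif:
  assumes "t > 0" and [measurable]: "f \<in> borel_measurable borel"
  shows "(\<integral>\<^sup>+s. f s \<partial>unif t) = ennreal (1 / t) * (\<integral>\<^sup>+s. f s * indicator {0..t} s \<partial>lborel)"
  using assms by (simp add: nn_integral_uniform_measure divide_ennreal_def inverse_ennreal mult.commute divide_inverse)

lemma nn_integral_square_le_prob:
  fixes f :: "'a \<Rightarrow> ennreal"
  assumes "prob_space M" and [measurable]: "f \<in> borel_measurable M"
  shows "(\<integral>\<^sup>+s. f s \<partial>M)\<^sup>2 \<le> (\<integral>\<^sup>+s. (f s)\<^sup>2 \<partial>M)"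
  using Cauchy_Schwarz_nn_integral[of f M "\<lambda>_. 1"] prob_space.emeasure_space_1[OF assms(1)] by simp

text \<open>The law has density at most \<open>1 / t\<close>, so averaging takes L2 into bounded
  functions; this is the source of pointwise finiteness below.\<close>

lemma unif_average_bound:
  fixes f :: "real \<Rightarrow> ennreal"
  assumes t: "t > 0" and [measurable]: "f \<in> borel_measurable borel"
  shows "(\<integral>\<^sup>+s. f (c + s) \<partial>unif t)\<^sup>2 \<le> ennreal (1 / t) * L2sq f"
proof -
  have "(\<integral>\<^sup>+s. f (c + s) \<partial>unif t)\<^sup>2 \<le> (\<integral>\<^sup>+s. (f (c + s))\<^sup>2 \<partial>unif t)"
    by (rule nn_integral_square_le_prob[OF prob_space_unif[OF t]]) measurable
  also have "\<dots> = ennreal (1 / t) * (\<integral>\<^sup>+s. (f (c + s))\<^sup>2 * indicator {0..t} s \<partial>lborel)"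
    by (rule nn_integral_unif[OF t]) measurable
  also have "\<dots> \<le> ennreal (1 / t) * (\<integral>\<^sup>+s. (f (c + s))\<^sup>2 \<partial>lborel)"
    by (intro mult_left_mono nn_integral_mono) (auto simp: indicator_def)
  also have "(\<integral>\<^sup>+s. (f (c + s))\<^sup>2 \<partial>lborel) = L2sq f"
    using nn_integral_shift_real[of "\<lambda>x. (f x)\<^sup>2" c] by (simp add: add.commute)
  finally show ?thesis .
qed

text \<open>Jensen, Fubini and translation invariance of Lebesgue measure.\<close>

lemma unif_average_contraction:
  fixes f :: "real \<Rightarrow> ennreal"
  assumes t: "t > 0" and [measurable]: "f \<in> borel_measurable borel"
  shows "(\<integral>\<^sup>+x. (\<integral>\<^sup>+s. f (x + c + s) \<partial>unif t)\<^sup>2 \<partial>lborel) \<le> L2sq f"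
proof -
  interpret U: prob_space "unif t" by (rule prob_space_unif[OF t])
  interpret P: pair_sigma_finite "unif t" lborel
    by standard
  have "(\<integral>\<^sup>+x. (\<integral>\<^sup>+s. f (x + c + s) \<partial>unif t)\<^sup>2 \<partial>lborel) \<le> (\<integral>\<^sup>+x. (\<integral>\<^sup>+s. (f (x + c + s))\<^sup>2 \<partial>unif t) \<partial>lborel)"
    by (intro nn_integral_mono nn_integral_square_le_prob[OF U.prob_space_axioms]) measurable
  also have "\<dots> = (\<integral>\<^sup>+s. (\<integral>\<^sup>+x. (f (x + c + s))\<^sup>2 \<partial>lborel) \<partial>unif t)"
    by (rule P.Fubini') measurable
  also have "\<dots> = (\<integral>\<^sup>+s. L2sq f \<partial>unif t)"
  proof (rule nn_integral_cong)
    fix s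
    show "(\<integral>\<^sup>+x. (f (x + c + s))\<^sup>2 \<partial>lborel) = L2sq f"
      using nn_integral_shift_real[of "\<lambda>x. (f x)\<^sup>2" "c + s"] by (simp add: add.assoc)
  qed
  also have "\<dots> = L2sq f"
    using U.emeasure_space_1 by simp
  finally show ?thesis .
qed

lemma unif_reflect:
  fixes f :: "real \<Rightarrow> ennreal"
  assumes t: "t > 0" and [measurable]: "f \<in> borel_measurable borel"
  shows "(\<integral>\<^sup>+s. f (c - s) \<partial>unif t) = (\<integral>\<^sup>+s. f (c - t + s) \<partial>unif t)"
proof -
  have "(\<integral>\<^sup>+s. f (c - s) * indicator {0..t} s \<partial>lborel) =
      (\<integral>\<^sup>+s. f (c - (- s)) * indicator {0..t} (- s) \<partial>lborel)"
    by (rule nn_integral_reflect_real[symmetric]) measurable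
  also have "\<dots> = (\<integral>\<^sup>+s. f (c + (s + - t)) * indicator {0..t} (- (s + - t)) \<partial>lborel)"
    using nn_integral_shift_real[of "\<lambda>s. f (c + s) * indicator {0..t} (- s)" "- t"] by simp
  also have "\<dots> = (\<integral>\<^sup>+s. f (c - t + s) * indicator {0..t} s \<partial>lborel)"
    by (intro nn_integral_cong) (auto simp: indicator_def algebra_simps)
  finally show ?thesis using t by (simp add: nn_integral_unif)
qed

text \<open>The uniform law on \<open>[0, 2t]\<close> is that of \<open>s + s'\<close> with
  independent \<open>s\<close>, uniform on \<open>[0, t]\<close>, and \<open>s'\<close>, equal to 0
  or \<open>t\<close> with probability 1/2. This extracts the two-point average, whose loss is known
  exactly.\<close>

lemma unif_halve:
  fixes f :: "real \<Rightarrow> ennreal"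
  assumes t: "t > 0" and [measurable]: "f \<in> borel_measurable borel"
  shows "(\<integral>\<^sup>+s. f (c - s) \<partial>unif (2 * t)) =
    ennreal (1/2) * ((\<integral>\<^sup>+s. f (c - 2 * t + s) \<partial>unif t) + (\<integral>\<^sup>+s. f (c - 2 * t + t + s) \<partial>unif t))"
proof -
  let ?g = "\<lambda>s. f (c - 2 * t + s)"
  have "(\<integral>\<^sup>+s. ?g s * indicator {0..2 * t} s \<partial>lborel) =
      (\<integral>\<^sup>+s. ?g s * indicator {0..t} s + ?g s * indicator {t..2 * t} s \<partial>lborel)"
    by (rule nn_integral_cong_AE, use AE_lborel_singleton[of t] in eventually_elim)
      (use t in \<open>auto simp: indicator_def\<close>)
  also have "\<dots> = (\<integral>\<^sup>+s. ?g s * indicator {0..t} s \<partial>lborel) + (\<integral>\<^sup>+s. ?g s * indicator {t..2 * t} s \<partial>lborel)"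
    by (simp add: nn_integral_add)
  also have "(\<integral>\<^sup>+s. ?g s * indicator {t..2 * t} s \<partial>lborel) = (\<integral>\<^sup>+s. ?g (s + t) * indicator {t..2 * t} (s + t) \<partial>lborel)"
    by (rule nn_integral_shift_real[symmetric]) measurable
  also have "\<dots> = (\<integral>\<^sup>+s. f (c - 2 * t + t + s) * indicator {0..t} s \<partial>lborel)"
    by (intro nn_integral_cong) (auto simp: indicator_def algebra_simps)
  finally have eq: "(\<integral>\<^sup>+s. ?g s * indicator {0..2 * t} s \<partial>lborel) =
     (\<integral>\<^sup>+s. ?g s * indicator {0..t} s \<partial>lborel) + (\<integral>\<^sup>+s. f (c - 2 * t + t + s) * indicator {0..t} s \<partial>lborel)" .
  have half: "ennreal (1 / (2 * t)) = ennreal (1/2) * ennreal (1 / t)"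
    using t by (subst ennreal_mult[symmetric]) auto
  have "(\<integral>\<^sup>+s. f (c - s) \<partial>unif (2 * t)) = ennreal (1 / (2 * t)) * (\<integral>\<^sup>+s. ?g s * indicator {0..2 * t} s \<partial>lborel)"
    using t by (subst unif_reflect) (auto intro!: nn_integral_unif)
  also have "\<dots> = ennreal (1/2) * (ennreal (1 / t) * (\<integral>\<^sup>+s. ?g s * indicator {0..t} s \<partial>lborel) +
      ennreal (1 / t) * (\<integral>\<^sup>+s. f (c - 2 * t + t + s) * indicator {0..t} s \<partial>lborel))"
    unfolding eq half by (simp only: mult.assoc distrib_left)
  also have "ennreal (1 / t) * (\<integral>\<^sup>+s. ?g s * indicator {0..t} s \<partial>lborel) = (\<integral>\<^sup>+s. ?g s \<partial>unif t)"
    by (rule nn_integral_unif[OF t, symmetric]) measurable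
  also have "ennreal (1 / t) * (\<integral>\<^sup>+s. f (c - 2 * t + t + s) * indicator {0..t} s \<partial>lborel) =
      (\<integral>\<^sup>+s. f (c - 2 * t + t + s) \<partial>unif t)"
    by (rule nn_integral_unif[OF t, symmetric]) measurable
  finally show ?thesis .
qed

text \<open>In the chain of ratios \<open>e - a\<^sup>2 / y - s\<close> is the successor of
  \<open>y\<close> when the potential is \<open>s\<close>, and \<open>a / \<bar>y\<bar>\<close> is
  the quotient of neighbouring solution values. The square of this weight is the Jacobian of
  \<open>y \<mapsto> - a\<^sup>2 / y\<close>, so on L2 the operator is averaging followed by a
  norm-preserving map.\<close>

definition transfer_op :: "real \<Rightarrow> real \<Rightarrow> real \<Rightarrow> (real \<Rightarrow> ennreal) \<Rightarrow> real \<Rightarrow> ennreal" where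
  "transfer_op t a e h y = ennreal (a / \<bar>y\<bar>) * (\<integral>\<^sup>+s. h (e - a\<^sup>2 / y - s) \<partial>unif (2 * t))"

lemma measurable_transfer_op[measurable]:
  assumes t: "t > 0" and [measurable]: "h \<in> borel_measurable borel"
  shows "transfer_op t a e h \<in> borel_measurable borel"
proof -
  interpret U: prob_space "unif (2 * t)" using t by (intro prob_space_unif) auto
  show ?thesis unfolding transfer_op_def by measurable
qed

lemma transfer_op_norm_eq:
  assumes t: "t > 0" and a: "a > 0" and [measurable]: "h \<in> borel_measurable borel"
  shows "(\<integral>\<^sup>+y. (transfer_op t a e h y)\<^sup>2 \<partial>lborel) = (\<integral>\<^sup>+z. (\<integral>\<^sup>+s. h (e + z - s) \<partial>unif (2 * t))\<^sup>2 \<partial>lborel)"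
proof -
  interpret U: prob_space "unif (2 * t)" using t by (intro prob_space_unif) auto
  have "(\<integral>\<^sup>+y. (transfer_op t a e h y)\<^sup>2 \<partial>lborel) =
    (\<integral>\<^sup>+y. (\<integral>\<^sup>+s. h (e + (- a\<^sup>2 / y) - s) \<partial>unif (2 * t))\<^sup>2 * ennreal (a\<^sup>2 / y\<^sup>2) \<partial>lborel)"
    using a by (intro nn_integral_cong)
      (simp add: transfer_op_def power_mult_distrib ennreal_power power_divide mult.commute)
  also have "\<dots> = (\<integral>\<^sup>+z. (\<integral>\<^sup>+s. h (e + z - s) \<partial>unif (2 * t))\<^sup>2 \<partial>lborel)"
    using a by (intro nn_integral_inversion[where f = "\<lambda>z. (\<integral>\<^sup>+s. h (e + z - s) \<partial>unif (2 * t))\<^sup>2"]) auto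
  finally show ?thesis .
qed

lemma transfer_op_norm_le:
  assumes t: "t > 0" and a: "a > 0" and [measurable]: "h \<in> borel_measurable borel"
  shows "(\<integral>\<^sup>+y. (transfer_op t a e h y)\<^sup>2 \<partial>lborel) \<le> L2sq h"
proof -
  have "(\<integral>\<^sup>+z. (\<integral>\<^sup>+s. h (e + z - s) \<partial>unif (2 * t))\<^sup>2 \<partial>lborel) =
     (\<integral>\<^sup>+z. (\<integral>\<^sup>+s. h (z + (e - 2 * t) + s) \<partial>unif (2 * t))\<^sup>2 \<partial>lborel)"
  proof (rule nn_integral_cong, rule arg_cong[where f = "\<lambda>x. x\<^sup>2"])
    fix z
    have eq: "z + (e - 2 * t) = e + z - 2 * t" by simp
    show "(\<integral>\<^sup>+s. h (e + z - s) \<partial>unif (2 * t)) = (\<integral>\<^sup>+s. h (z + (e - 2 * t) + s) \<partial>unif (2 * t))"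
      unfolding eq by (rule unif_reflect) (use t in auto)
  qed
  also have "\<dots> \<le> L2sq h"
    using t by (intro unif_average_contraction) auto
  finally show ?thesis using t a by (simp add: transfer_op_norm_eq)
qed

text \<open>Each uniform law is split by \<open>unif_halve\<close>; its part on
  \<open>[0, t]\<close> is given away by contraction. Between the two remaining two-point averages
  stands the inversion of the inner operator, so the size condition concerns \<open>a\<close>. The
  inversion by \<open>a'\<close> comes last and preserves the norm.\<close>

lemma transfer_op_gap:
  fixes r :: nat
  assumes t: "t > 0" and a: "a > 0" "2 * a \<le> real r * t" and a': "a' > 0"
    and [measurable]: "h \<in> borel_measurable borel"
  shows "(\<integral>\<^sup>+y. (transfer_op t a' e' (transfer_op t a e h) y)\<^sup>2 \<partial>lborel) \<le>
     ennreal (gap r) * L2sq h"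
proof (cases "L2sq h = \<infinity>")
  case True
  have "0 < gap r" by (simp add: add_pos_nonneg)
  thus ?thesis using True by (auto simp: ennreal_mult_top)
next
  case False
  interpret U: prob_space "unif t" using t by (intro prob_space_unif) auto
  define k where "k z = (\<integral>\<^sup>+s. h (z + (e - 2 * t) + s) \<partial>unif t)" for z
  have k_meas[measurable]: "k \<in> borel_measurable borel" unfolding k_def by measurable
  \<comment> \<open>Finiteness at every point permits passing to the real function \<open>f\<close>,
    for which differences make sense.\<close>
  have k_fin: "k z < \<infinity>" for z
  proof -
    have "(k z)\<^sup>2 \<le> ennreal (1 / t) * L2sq h"
      unfolding k_def by (rule unif_average_bound[OF t]) measurable
    also have "\<dots> < \<infinity>" using False by (simp add: ennreal_mult_less_top top.not_eq_extremum)
    finally show ?thesis by (cases "k z") (auto simp: power2_eq_square)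
  qed
  define f where "f z = enn2real (k z)" for z
  have kf: "k z = ennreal (f z)" for z using k_fin[of z] by (simp add: f_def)
  have f_nonneg: "f z \<ge> 0" for z by (simp add: f_def)
  have [measurable]: "f \<in> borel_measurable borel" unfolding f_def by measurable
  define g where "g x = (f x + f (x + t)) / 2" for x
  define h1 where "h1 y = a / \<bar>y\<bar> * g (- a\<^sup>2 / y)" for y
  have g_nonneg: "g x \<ge> 0" for x using f_nonneg[of x] f_nonneg[of "x + t"] by (simp add: g_def)
  have h1_nonneg: "h1 y \<ge> 0" for y using g_nonneg a by (simp add: h1_def)
  have [measurable]: "h1 \<in> borel_measurable borel" unfolding h1_def g_def by measurable
  have half: "ennreal (1/2) * (ennreal x + ennreal y) = ennreal ((x + y) / 2)" if "x \<ge> 0" "y \<ge> 0" for x y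
  proof -
    have "ennreal (1/2) * (ennreal x + ennreal y) = ennreal (1/2) * ennreal (x + y)"
      using that by (simp only: ennreal_plus)
    also have "\<dots> = ennreal (1/2 * (x + y))" using that by (intro ennreal_mult[symmetric]) auto
    finally show ?thesis by (simp only: times_divide_eq_left mult_1_left)
  qed
  have op1: "transfer_op t a e h y = ennreal (h1 y)" for y
  proof -
    have "(\<integral>\<^sup>+s. h (e - a\<^sup>2 / y - s) \<partial>unif (2 * t)) = ennreal (1/2) * (k (- a\<^sup>2 / y) + k (- a\<^sup>2 / y + t))"
      unfolding k_def using t by (subst unif_halve) (auto simp: algebra_simps)
    also have "\<dots> = ennreal (g (- a\<^sup>2 / y))" unfolding kf g_def using f_nonneg by (intro half)
    finally show ?thesis unfolding transfer_op_def h1_def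
      using a g_nonneg by (subst ennreal_mult) auto
  qed
  define m where "m y = ennreal ((h1 y + h1 (y + t)) / 2)" for y
  have [measurable]: "m \<in> borel_measurable borel" unfolding m_def by measurable
  have op2: "(\<integral>\<^sup>+s. ennreal (h1 (e' + z - s)) \<partial>unif (2 * t)) = (\<integral>\<^sup>+s. m (z + (e' - 2 * t) + s) \<partial>unif t)" for z
  proof -
    have "(\<integral>\<^sup>+s. ennreal (h1 (e' + z - s)) \<partial>unif (2 * t)) = ennreal (1/2) *
       ((\<integral>\<^sup>+s. ennreal (h1 (e' + z - 2 * t + s)) \<partial>unif t) + (\<integral>\<^sup>+s. ennreal (h1 (e' + z - 2 * t + t + s)) \<partial>unif t))"
      using t by (intro unif_halve[where f = "\<lambda>x. ennreal (h1 x)"]) auto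
    also have "\<dots> = (\<integral>\<^sup>+s. ennreal (1/2) * (ennreal (h1 (e' + z - 2 * t + s)) + ennreal (h1 (e' + z - 2 * t + t + s))) \<partial>unif t)"
      by (subst nn_integral_cmult, measurable) (subst nn_integral_add, auto)
    also have "\<dots> = (\<integral>\<^sup>+s. m (z + (e' - 2 * t) + s) \<partial>unif t)"
      by (intro nn_integral_cong) (subst half, auto simp: h1_nonneg m_def algebra_simps)
    finally show ?thesis .
  qed
  have "(\<integral>\<^sup>+y. (transfer_op t a' e' (transfer_op t a e h) y)\<^sup>2 \<partial>lborel) =
     (\<integral>\<^sup>+z. (\<integral>\<^sup>+s. m (z + (e' - 2 * t) + s) \<partial>unif t)\<^sup>2 \<partial>lborel)"
    using t a' by (subst transfer_op_norm_eq) (auto simp: op1 op2)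
  also have "\<dots> \<le> L2sq m" by (rule unif_average_contraction[OF t]) measurable
  also have "\<dots> = (\<integral>\<^sup>+y. ennreal (((h1 y + h1 (y + t)) / 2)\<^sup>2) \<partial>lborel)"
    by (intro nn_integral_cong) (simp add: m_def ennreal_power h1_nonneg)
  also have "\<dots> \<le> ennreal (gap r) * sqint f"
    unfolding h1_def g_def
  proof (rule averaging_inversion_gap_real)
    have "sqint f = L2sq k"
      by (intro nn_integral_cong) (simp add: kf ennreal_power f_nonneg)
    also have "\<dots> \<le> L2sq h" unfolding k_def by (rule unif_average_contraction[OF t]) measurable
    finally show "sqint f < \<infinity>" using False by (simp add: top.not_eq_extremum le_less_trans)
  qed (use t a in auto)
  also have "sqint f = L2sq k"
    by (intro nn_integral_cong) (simp add: kf ennreal_power f_nonneg)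
  also have "\<dots> \<le> L2sq h"
    unfolding k_def by (rule unif_average_contraction[OF t]) measurable
  finally show ?thesis by (simp add: mult_left_mono)
qed

section \<open>Random potentials and the Kunz--Souillard estimate\<close>

text \<open>Replacing one coordinate by an independent copy leaves the product measure unchanged, as
  is checked on cylinder sets. Averages over a single potential thus become inner integrals without
  splitting the index set.\<close>

lemma (in product_prob_space) nn_integral_PiM_resample:
  assumes k: "k \<in> I" and F[measurable]: "F \<in> borel_measurable (PiM I M)"
  shows "(\<integral>\<^sup>+w. F w \<partial>PiM I M) = (\<integral>\<^sup>+w. (\<integral>\<^sup>+s. F (w(k := s)) \<partial>M k) \<partial>PiM I M)"
proof -
  have upd[measurable]: "(\<lambda>x. (fst x)(k := snd x)) \<in> measurable (PiM I M \<Otimes>\<^sub>M M k) (PiM I M)"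
    by (rule measurable_fun_upd[where J = I]) (use k in auto)
  define Q where "Q = distr (PiM I M \<Otimes>\<^sub>M M k) (PiM I M) (\<lambda>x. (fst x)(k := snd x))"
  have "PiM I M = Q"
  proof (rule measure_eqI_PiM_infinite)
    show "sets (PiM I M) = sets (PiM I M)" "sets Q = sets (PiM I M)" by (auto simp: Q_def)
    show "finite_measure (PiM I M)" by (rule P.finite_measure)
    fix A J assume J: "finite J" "J \<subseteq> I" and A: "\<And>i. i \<in> J \<Longrightarrow> A i \<in> sets (M i)"
    \<comment> \<open>The constraint that the cylinder puts on the fresh coordinate; if there is
      none, the factor has mass 1.\<close>
    define Ak where "Ak = (if k \<in> J then A k else space (M k))"
    have Ak: "Ak \<in> sets (M k)" using A by (auto simp: Ak_def)
    let ?E = "prod_emb I M J (Pi\<^sub>E J A)"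
    let ?E' = "prod_emb I M (J - {k}) (Pi\<^sub>E (J - {k}) A)"
    have E: "?E \<in> sets (PiM I M)" and E': "?E' \<in> sets (PiM I M)"
      using J A by (auto intro!: sets_PiM_I)
    have "(\<lambda>x. (fst x)(k := snd x)) -` ?E \<inter> space (PiM I M \<Otimes>\<^sub>M M k) = ?E' \<times> Ak"
    proof (rule set_eqI)
      fix x :: "('i \<Rightarrow> 'a) \<times> 'a"
      obtain w s where x: "x = (w, s)" by (cases x)
      have "x \<in> ?E' \<times> Ak \<longleftrightarrow> w \<in> space (PiM I M) \<and> (\<forall>i\<in>J - {k}. w i \<in> A i) \<and> s \<in> Ak"
        unfolding x by (auto simp: prod_emb_iff space_PiM PiE_def Pi_iff)
      also have "\<dots> \<longleftrightarrow> w \<in> space (PiM I M) \<and> s \<in> space (M k) \<and> (\<forall>i\<in>J. (w(k := s)) i \<in> A i)"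
        using sets.sets_into_space[OF Ak] by (auto simp: Ak_def)
      also have "\<dots> \<longleftrightarrow> x \<in> (\<lambda>x. (fst x)(k := snd x)) -` ?E \<inter> space (PiM I M \<Otimes>\<^sub>M M k)"
        unfolding x using k by (auto simp: prod_emb_iff space_PiM PiE_def Pi_iff space_pair_measure extensional_def)
      finally show "x \<in> (\<lambda>x. (fst x)(k := snd x)) -` ?E \<inter> space (PiM I M \<Otimes>\<^sub>M M k) \<longleftrightarrow> x \<in> ?E' \<times> Ak" by simp
    qed
    hence "emeasure Q ?E = emeasure (PiM I M \<Otimes>\<^sub>M M k) (?E' \<times> Ak)"
      unfolding Q_def using E by (subst emeasure_distr) auto
    also have "\<dots> = emeasure (PiM I M) ?E' * emeasure (M k) Ak"
      by (rule M.emeasure_pair_measure_Times[OF E' Ak])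
    also have "emeasure (PiM I M) ?E' = (\<Prod>i\<in>J - {k}. emeasure (M i) (A i))"
      using J A by (intro emeasure_PiM_emb) auto
    also have "\<dots> * emeasure (M k) Ak = (\<Prod>i\<in>J. emeasure (M i) (A i))"
    proof (cases "k \<in> J")
      case True
      thus ?thesis using J by (simp add: Ak_def prod.remove mult.commute)
    qed (simp add: Ak_def M.emeasure_space_1)
    also have "\<dots> = emeasure (PiM I M) ?E" using J A by (intro emeasure_PiM_emb[symmetric]) auto
    finally show "emeasure (PiM I M) ?E = emeasure Q ?E" by simp
  qed
  hence "(\<integral>\<^sup>+w. F w \<partial>PiM I M) = (\<integral>\<^sup>+w. F w \<partial>Q)" by simp
  also have "\<dots> = (\<integral>\<^sup>+x. F ((fst x)(k := snd x)) \<partial>(PiM I M \<Otimes>\<^sub>M M k))"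
    unfolding Q_def by (rule nn_integral_distr) measurable
  also have "\<dots> = (\<integral>\<^sup>+w. (\<integral>\<^sup>+s. F (w(k := s)) \<partial>M k) \<partial>PiM I M)"
    by (subst M.nn_integral_fst[symmetric]) auto
  finally show ?thesis .
qed

section \<open>Random potentials and solutions started at the end of a box\<close>

abbreviation pot_space :: "real \<Rightarrow> (int \<Rightarrow> real) measure" where
  "pot_space t \<equiv> PiM UNIV (\<lambda>_::int. unif (2 * t))"

lemma product_prob_space_pot:
  assumes "t > 0"
  shows "product_prob_space (\<lambda>_::int. unif (2 * t))"
proof -
  interpret prob_space "unif (2 * t)" using assms by (intro prob_space_unif) auto
  show ?thesis by standard
qed

lemma prob_space_pot: "t > 0 \<Longrightarrow> prob_space (pot_space t)"
  by (intro prob_space_PiM prob_space_unif) auto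

lemma pot_resample:
  assumes "t > 0" and [measurable]: "F \<in> borel_measurable (pot_space t)"
  shows "(\<integral>\<^sup>+w. F w \<partial>pot_space t) = (\<integral>\<^sup>+w. (\<integral>\<^sup>+s. F (w(k := s)) \<partial>unif (2 * t)) \<partial>pot_space t)"
  by (rule product_prob_space.nn_integral_PiM_resample[OF product_prob_space_pot[OF assms(1)]]) auto

lemma measurable_pot_component: "(\<lambda>w. w k) \<in> borel_measurable (pot_space t)"
proof -
  have "(\<lambda>w. w k) \<in> measurable (pot_space t) (unif (2 * t))"
    by (rule measurable_component_singleton) simp
  thus ?thesis by (simp cong: measurable_cong_sets)
qed

text \<open>The three-term recurrence with a Dirichlet condition at index 0, just outside the box,
  normalised at the end site 1. It is polymorphic because real energies occur in the probability
  estimates and complex ones in the Green function.\<close>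

fun chain_sol :: "(nat \<Rightarrow> real) \<Rightarrow> (nat \<Rightarrow> real) \<Rightarrow> 'a::real_normed_field \<Rightarrow> nat \<Rightarrow> 'a" where
  "chain_sol \<alpha> \<beta> z 0 = 0"
| "chain_sol \<alpha> \<beta> z (Suc 0) = 1"
| "chain_sol \<alpha> \<beta> z (Suc (Suc i)) =
    ((z - of_real (\<beta> (Suc i))) * chain_sol \<alpha> \<beta> z (Suc i) - of_real (\<alpha> i) * chain_sol \<alpha> \<beta> z i) / of_real (\<alpha> (Suc i))"

text \<open>The value at \<open>i\<close> ignores the potential at \<open>i\<close> and beyond: this
  is the independence behind resampling and spectral averaging.\<close>

lemma chain_sol_cong:
  assumes "\<And>j. 0 < j \<Longrightarrow> j < i \<Longrightarrow> \<beta> j = \<beta>' j"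
  shows "chain_sol \<alpha> \<beta> z i = chain_sol \<alpha> \<beta>' z i"
  using assms by (induction \<alpha> \<beta> z i rule: chain_sol.induct) auto

lemma measurable_chain_sol:
  fixes z :: "'b \<Rightarrow> 'a::{real_normed_field, second_countable_topology}"
  assumes [measurable]: "z \<in> borel_measurable N" "\<And>i. \<beta> i \<in> borel_measurable N"
  shows "(\<lambda>x. chain_sol \<alpha> (\<lambda>i. \<beta> i x) (z x) i) \<in> borel_measurable N"
proof (induction i rule: induct_nat_012)
  case (ge2 i)
  note [measurable] = ge2
  show ?case by simp
qed auto

text \<open>The chain runs inward from one end of a box: \<open>\<sigma>\<close> lists the sites,
  \<open>c\<close> is the given potential along them, \<open>\<alpha>\<close> the couplings.
  Injectivity of \<open>\<sigma>\<close> makes the random potentials along the chain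
  independent.\<close>

locale random_chain =
  fixes t A \<rho> :: real and r :: nat and \<alpha> c :: "nat \<Rightarrow> real" and \<sigma> :: "nat \<Rightarrow> int"
  assumes t: "t > 0" and \<alpha>_pos: "\<And>i. \<alpha> i > 0" and \<alpha>_le: "\<And>i. \<alpha> i \<le> A" and r: "2 * A \<le> real r * t"
    and inj: "inj \<sigma>" and \<rho>: "0 < \<rho>" "\<rho> < 1" "gap r \<le> \<rho> ^ 8"
begin

definition v :: "real \<Rightarrow> (int \<Rightarrow> real) \<Rightarrow> nat \<Rightarrow> real" where
  "v e w i = chain_sol \<alpha> (\<lambda>i. c i + w (\<sigma> i)) e i"

text \<open>Riccati variable: its successor is the energy minus the potential minus
  \<open>\<alpha>\<^sup>2 / y\<close>, so a fresh potential acts on it as a translation.\<close>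

abbreviation y :: "real \<Rightarrow> (int \<Rightarrow> real) \<Rightarrow> nat \<Rightarrow> real" where
  "y e w i \<equiv> \<alpha> i * v e w (Suc i) / v e w i"

abbreviation ratio :: "real \<Rightarrow> (int \<Rightarrow> real) \<Rightarrow> nat \<Rightarrow> nat \<Rightarrow> ennreal" where
  "ratio e w i j \<equiv> ennreal \<bar>v e w i / v e w j\<bar>"

lemma v_measurable[measurable]: "(\<lambda>w. v e w i) \<in> borel_measurable (pot_space t)"
  unfolding v_def by (intro measurable_chain_sol borel_measurable_add measurable_pot_component) measurable

lemma v_0[simp]: "v e w 0 = 0" and v_1[simp]: "v e w (Suc 0) = 1"
  by (simp_all add: v_def)

lemma v_rec: "\<alpha> (Suc i) * v e w (Suc (Suc i)) = (e - c (Suc i) - w (\<sigma> (Suc i))) * v e w (Suc i) - \<alpha> i * v e w i"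
  using \<alpha>_pos[of "Suc i"] by (simp add: v_def diff_diff_eq)

lemma v_upd: "i \<le> k \<Longrightarrow> v e (w(\<sigma> k := s)) i = v e w i"
  unfolding v_def using inj by (intro chain_sol_cong) (auto dest: injD)

lemma y_upd:
  assumes "v e w (Suc j) \<noteq> 0"
  shows "y e (w(\<sigma> (Suc j) := s)) (Suc j) = e - c (Suc j) - \<alpha> j * v e w j / v e w (Suc j) - s"
  using assms by (simp add: v_rec v_upd diff_divide_distrib)

text \<open>If \<open>v e w (Suc j)\<close> is nonzero, a zero at the next index pins the potential
  at \<open>\<sigma> (Suc j)\<close> to a single value, which has probability 0 after resampling.
  Off these null sets the Riccati recursion never divides by zero.\<close>

lemma AE_v_nonzero: "AE w in pot_space t. v e w (Suc j) \<noteq> 0"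
proof (induction j)
  case (Suc j)
  let ?B = "{w\<in>space (pot_space t). v e w (Suc (Suc j)) = 0 \<and> v e w (Suc j) \<noteq> 0}"
  have B[measurable]: "?B \<in> sets (pot_space t)" by measurable
  have "emeasure (pot_space t) ?B = (\<integral>\<^sup>+w. indicator ?B w \<partial>pot_space t)" by simp
  also have "\<dots> = (\<integral>\<^sup>+w. (\<integral>\<^sup>+s. indicator ?B (w(\<sigma> (Suc j) := s)) \<partial>unif (2 * t)) \<partial>pot_space t)"
    by (rule pot_resample[OF t]) measurable
  also have "\<dots> \<le> (\<integral>\<^sup>+w. (\<integral>\<^sup>+s. indicator {e - c (Suc j) - \<alpha> j * v e w j / v e w (Suc j)} s \<partial>unif (2 * t)) \<partial>pot_space t)"
  proof (intro nn_integral_mono)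
    fix w s
    have "s = e - c (Suc j) - \<alpha> j * v e w j / v e w (Suc j)" if "w(\<sigma> (Suc j) := s) \<in> ?B"
      using y_upd[of e w j s] that by (auto simp: v_upd)
    thus "indicator ?B (w(\<sigma> (Suc j) := s)) \<le> (indicator {e - c (Suc j) - \<alpha> j * v e w j / v e w (Suc j)} s :: ennreal)"
      by (auto simp: indicator_def)
  qed
  also have "\<dots> = 0"
  proof -
    have "(\<integral>\<^sup>+s. indicator {x} s \<partial>unif (2 * t)) = 0" for x
      using t by (subst nn_integral_indicator, simp, cases "x \<in> {0..2 * t}") (simp_all add: Int_insert_right)
    thus ?thesis by (simp only: nn_integral_const mult_zero_left)
  qed
  finally have "emeasure (pot_space t) ?B = 0" by simp
  hence "AE w in pot_space t. \<not> (v e w (Suc (Suc j)) = 0 \<and> v e w (Suc j) \<noteq> 0)"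
    using AE_iff_measurable[OF B, of "\<lambda>w. \<not> (v e w (Suc (Suc j)) = 0 \<and> v e w (Suc j) \<noteq> 0)"] by simp
  with Suc.IH show ?case by eventually_elim auto
qed simp

text \<open>The potential at \<open>\<sigma> (Suc j)\<close> does not enter \<open>v\<close> up to
  index \<open>Suc j\<close>. Integrating it out averages \<open>h\<close>, and the extra factor in
  \<open>ratio\<close> is the modulus of \<open>\<alpha> j / y e w j\<close>.\<close>

lemma chain_transfer_step:
  assumes ij: "0 < i" "i \<le> j" and h[measurable]: "h \<in> borel_measurable borel"
  shows "(\<integral>\<^sup>+w. ratio e w i (Suc j) * h (y e w (Suc j)) \<partial>pot_space t) =
    (\<integral>\<^sup>+w. ratio e w i j * transfer_op t (\<alpha> j) (e - c (Suc j)) h (y e w j) \<partial>pot_space t)"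
proof -
  have "(\<integral>\<^sup>+w. ratio e w i (Suc j) * h (y e w (Suc j)) \<partial>pot_space t) =
    (\<integral>\<^sup>+w. (\<integral>\<^sup>+s. ennreal \<bar>v e (w(\<sigma> (Suc j) := s)) i / v e (w(\<sigma> (Suc j) := s)) (Suc j)\<bar> *
        h (y e (w(\<sigma> (Suc j) := s)) (Suc j)) \<partial>unif (2 * t)) \<partial>pot_space t)"
    by (rule pot_resample[OF t]) measurable
  also have "\<dots> = (\<integral>\<^sup>+w. ratio e w i j * transfer_op t (\<alpha> j) (e - c (Suc j)) h (y e w j) \<partial>pot_space t)"
  proof (rule nn_integral_cong_AE)
    obtain j' where j': "j = Suc j'" using ij by (cases j) auto
    show "AE w in pot_space t. (\<integral>\<^sup>+s. ennreal \<bar>v e (w(\<sigma> (Suc j) := s)) i / v e (w(\<sigma> (Suc j) := s)) (Suc j)\<bar> *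
        h (y e (w(\<sigma> (Suc j) := s)) (Suc j)) \<partial>unif (2 * t)) =
        ratio e w i j * transfer_op t (\<alpha> j) (e - c (Suc j)) h (y e w j)"
      using AE_v_nonzero[of e j] AE_v_nonzero[of e j', folded j']
    proof eventually_elim
      case (elim w)
      have a: "\<alpha> j > 0" by (rule \<alpha>_pos)
      have eq: "\<alpha> j * v e w j / v e w (Suc j) = (\<alpha> j)\<^sup>2 / y e w j"
        using elim a by (simp add: power2_eq_square)
      have "ratio e w i (Suc j) = ratio e w i j * ennreal (\<alpha> j / \<bar>y e w j\<bar>)"
        using elim a by (subst ennreal_mult'[symmetric]) (auto simp: abs_mult abs_divide)
      moreover have "(\<integral>\<^sup>+s. ennreal \<bar>v e (w(\<sigma> (Suc j) := s)) i / v e (w(\<sigma> (Suc j) := s)) (Suc j)\<bar> *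
        h (y e (w(\<sigma> (Suc j) := s)) (Suc j)) \<partial>unif (2 * t)) =
        (\<integral>\<^sup>+s. ratio e w i (Suc j) * h (e - c (Suc j) - (\<alpha> j)\<^sup>2 / y e w j - s) \<partial>unif (2 * t))"
        using ij by (simp only: y_upd[OF elim(1), unfolded eq]) (simp add: v_upd)
      moreover have "(\<integral>\<^sup>+s. ratio e w i (Suc j) * h (e - c (Suc j) - (\<alpha> j)\<^sup>2 / y e w j - s) \<partial>unif (2 * t)) =
          ratio e w i (Suc j) * (\<integral>\<^sup>+s. h (e - c (Suc j) - (\<alpha> j)\<^sup>2 / y e w j - s) \<partial>unif (2 * t))"
      proof -
        have "(\<integral>\<^sup>+s. K * h (d - s) \<partial>unif (2 * t)) = K * (\<integral>\<^sup>+s. h (d - s) \<partial>unif (2 * t))" for K d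
          by (rule nn_integral_cmult) measurable
        thus ?thesis .
      qed
      ultimately show ?case by (simp only: transfer_op_def mult.assoc)
    qed
  qed
  finally show ?thesis .
qed

lemma chain_transfer_base:
  assumes h[measurable]: "h \<in> borel_measurable borel"
  shows "(\<integral>\<^sup>+w. h (y e w (Suc i)) \<partial>pot_space t) \<le> (\<integral>\<^sup>+w. (\<integral>\<^sup>+s. h (e - c (Suc i) - \<alpha> i * v e w i / v e w (Suc i) - s) \<partial>unif (2 * t)) \<partial>pot_space t)"
proof -
  have "(\<integral>\<^sup>+w. h (y e w (Suc i)) \<partial>pot_space t) =
    (\<integral>\<^sup>+w. (\<integral>\<^sup>+s. h (y e (w(\<sigma> (Suc i) := s)) (Suc i)) \<partial>unif (2 * t)) \<partial>pot_space t)"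
    by (rule pot_resample[OF t]) measurable
  also have "\<dots> = (\<integral>\<^sup>+w. (\<integral>\<^sup>+s. h (e - c (Suc i) - \<alpha> i * v e w i / v e w (Suc i) - s) \<partial>unif (2 * t)) \<partial>pot_space t)"
    by (rule nn_integral_cong_AE, use AE_v_nonzero[of e i] in eventually_elim) (simp add: y_upd)
  finally show ?thesis by simp
qed

text \<open>Given the other potentials, \<open>y\<close> has a density of at most
  \<open>1 / (2 * t)\<close>, so the L2 norm of \<open>h\<close> bounds its second moment.\<close>

lemma chain_decay_0:
  assumes h[measurable]: "h \<in> borel_measurable borel" and i: "0 < i"
  shows "(\<integral>\<^sup>+w. ratio e w i i * h (y e w i) \<partial>pot_space t)\<^sup>2 \<le>
     ennreal (1 / (2 * t)) * L2sq h"
proof -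
  interpret P: prob_space "pot_space t" by (rule prob_space_pot[OF t])
  obtain i' where i': "i = Suc i'" using i by (cases i) auto
  \<comment> \<open>\<open>ratio e w i i\<close> is 1, or 0 where \<open>v e w i = 0\<close>,
    because \<open>0 / 0 = 0\<close>.\<close>
  have "(\<integral>\<^sup>+w. ratio e w i i * h (y e w i) \<partial>pot_space t)\<^sup>2 \<le> (\<integral>\<^sup>+w. h (y e w i) \<partial>pot_space t)\<^sup>2"
    by (intro power_mono nn_integral_mono) (auto intro!: mult_right_mono[where b = "1::ennreal", simplified] simp: divide_le_eq)
  also have "\<dots> \<le> (\<integral>\<^sup>+w. (h (y e w i))\<^sup>2 \<partial>pot_space t)"
    by (rule nn_integral_square_le_prob[OF P.prob_space_axioms]) measurable
  also have "\<dots> \<le> (\<integral>\<^sup>+w. (\<integral>\<^sup>+s. (h (e - c i - \<alpha> i' * v e w i' / v e w i - s))\<^sup>2 \<partial>unif (2 * t)) \<partial>pot_space t)"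
    unfolding i' by (rule chain_transfer_base[where h = "\<lambda>x. (h x)\<^sup>2"]) measurable
  also have "\<dots> \<le> (\<integral>\<^sup>+w. ennreal (1 / (2 * t)) * L2sq h \<partial>pot_space t)"
  proof (rule nn_integral_mono)
    fix w :: "int \<Rightarrow> real"
    let ?d = "e - c i - \<alpha> i' * v e w i' / v e w i"
    have "(\<integral>\<^sup>+s. (h (?d - s))\<^sup>2 \<partial>unif (2 * t)) = ennreal (1 / (2 * t)) * (\<integral>\<^sup>+s. (h (?d - s))\<^sup>2 * indicator {0..2 * t} s \<partial>lborel)"
      using t by (intro nn_integral_unif) auto
    also have "\<dots> \<le> ennreal (1 / (2 * t)) * (\<integral>\<^sup>+s. (h (?d - s))\<^sup>2 \<partial>lborel)"
      by (intro mult_left_mono nn_integral_mono) (auto simp: indicator_def)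
    also have "(\<integral>\<^sup>+s. (h (?d - s))\<^sup>2 \<partial>lborel) = L2sq h"
      using nn_integral_real_affine[of "\<lambda>x. (h x)\<^sup>2" "- 1" ?d] by simp
    finally show "(\<integral>\<^sup>+s. (h (?d - s))\<^sup>2 \<partial>unif (2 * t)) \<le> ennreal (1 / (2 * t)) * L2sq h" .
  qed
  also have "\<dots> = ennreal (1 / (2 * t)) * L2sq h"
    using P.emeasure_space_1 by simp
  finally show ?thesis .
qed

text \<open>Each pair of steps gains \<open>\<rho> ^ 8\<close> from the gap; a left-over odd step
  merely contracts, hence \<open>k div 2\<close>.\<close>

lemma chain_decay:
  assumes h: "h \<in> borel_measurable borel" and i: "0 < i"
  shows "(\<integral>\<^sup>+w. ratio e w i (i + k) * h (y e w (i + k)) \<partial>pot_space t)\<^sup>2 \<le>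
     ennreal (1 / (2 * t)) * ennreal (\<rho> ^ (8 * (k div 2))) * L2sq h"
  using h
proof (induction k arbitrary: h rule: induct_nat_012)
  case (0 h)
  thus ?case using chain_decay_0[OF 0 i] by simp
next
  case (1 h)
  note [measurable] = 1
  let ?L = "transfer_op t (\<alpha> i) (e - c (Suc i)) h"
  have L[measurable]: "?L \<in> borel_measurable borel" using t by measurable
  have "(\<integral>\<^sup>+w. ratio e w i (i + 1) * h (y e w (i + 1)) \<partial>pot_space t)\<^sup>2 =
    (\<integral>\<^sup>+w. ratio e w i i * ?L (y e w i) \<partial>pot_space t)\<^sup>2"
    using chain_transfer_step[of i i h e] i by simp
  also have "\<dots> \<le> ennreal (1 / (2 * t)) * L2sq (?L)"
    by (rule chain_decay_0[OF L i])
  also have "\<dots> \<le> ennreal (1 / (2 * t)) * L2sq h"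
    using t \<alpha>_pos by (intro mult_left_mono transfer_op_norm_le) auto
  finally show ?case by simp
next
  case (ge2 k h)
  note [measurable] = ge2.prems
  let ?L = "transfer_op t (\<alpha> (i + k)) (e - c (Suc (i + k))) (transfer_op t (\<alpha> (Suc (i + k))) (e - c (Suc (Suc (i + k)))) h)"
  have L[measurable]: "?L \<in> borel_measurable borel" using t by measurable
  have "(\<integral>\<^sup>+w. ratio e w i (i + Suc (Suc k)) * h (y e w (i + Suc (Suc k))) \<partial>pot_space t) =
    (\<integral>\<^sup>+w. ratio e w i (i + k) * ?L (y e w (i + k)) \<partial>pot_space t)"
    using chain_transfer_step[of i "Suc (i + k)" h e] chain_transfer_step[of i "i + k" "transfer_op t (\<alpha> (Suc (i + k))) (e - c (Suc (Suc (i + k)))) h" e] i t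
    by (simp only: add_Suc_right) (simp add: le_SucI)
  hence "(\<integral>\<^sup>+w. ratio e w i (i + Suc (Suc k)) * h (y e w (i + Suc (Suc k))) \<partial>pot_space t)\<^sup>2 \<le>
    ennreal (1 / (2 * t)) * ennreal (\<rho> ^ (8 * (k div 2))) * L2sq (?L)"
    using ge2.IH(1)[OF L] by simp
  also have "\<dots> \<le> ennreal (1 / (2 * t)) * ennreal (\<rho> ^ (8 * (k div 2))) * (ennreal (\<rho> ^ 8) * L2sq h)"
  proof (rule mult_left_mono)
    have "L2sq (?L) \<le> ennreal (gap r) * L2sq h"
      using \<alpha>_pos \<alpha>_le[of "Suc (i + k)"] r t by (intro transfer_op_gap) auto
    also have "\<dots> \<le> ennreal (\<rho> ^ 8) * L2sq h"
      using \<rho>(3) by (intro mult_right_mono ennreal_leI) auto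
    finally show "L2sq (?L) \<le> ennreal (\<rho> ^ 8) * L2sq h" .
  qed auto
  also have "\<dots> = ennreal (1 / (2 * t)) * (ennreal (\<rho> ^ (8 * (k div 2))) * ennreal (\<rho> ^ 8)) * L2sq h"
    by (simp only: mult.assoc)
  also have "ennreal (\<rho> ^ (8 * (k div 2))) * ennreal (\<rho> ^ 8) = ennreal (\<rho> ^ (8 * (Suc (Suc k) div 2)))"
    using \<rho> by (subst ennreal_mult[symmetric]) (auto simp: power_add)
  finally show ?case .
qed

end

text \<open>The weight \<open>a / \<bar>y\<bar>\<close> of the last step is not square integrable at
  0, so it is cut off at \<open>1 / C\<close> and smaller ratios are treated as a separate event.
  Inversion turns the integral into the length of an interval.\<close>

lemma nn_integral_cutoff_inverse_square:
  fixes a C :: real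
  assumes "a > 0" "C > 0"
  shows "(\<integral>\<^sup>+y. (ennreal (a / \<bar>y\<bar>) * indicator {y. \<bar>y\<bar> \<ge> 1 / C} y)\<^sup>2 \<partial>lborel) = ennreal (2 * a\<^sup>2 * C)"
proof -
  have "(\<integral>\<^sup>+y. (ennreal (a / \<bar>y\<bar>) * indicator {y. \<bar>y\<bar> \<ge> 1 / C} y)\<^sup>2 \<partial>lborel) =
    (\<integral>\<^sup>+y. indicator {- (a\<^sup>2 * C)..a\<^sup>2 * C} (- a\<^sup>2 / y) * ennreal (a\<^sup>2 / y\<^sup>2) \<partial>lborel)"
  proof (intro nn_integral_cong)
    fix y :: real
    have "\<bar>y\<bar> \<ge> 1 / C \<longleftrightarrow> - a\<^sup>2 / y \<in> {- (a\<^sup>2 * C)..a\<^sup>2 * C}" if "y \<noteq> 0"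
    proof -
      have "- a\<^sup>2 / y \<in> {- (a\<^sup>2 * C)..a\<^sup>2 * C} \<longleftrightarrow> \<bar>a\<^sup>2 / y\<bar> \<le> a\<^sup>2 * C" unfolding abs_le_iff atLeastAtMost_iff by auto
      also have "\<dots> \<longleftrightarrow> a\<^sup>2 / \<bar>y\<bar> \<le> a\<^sup>2 * C" by (simp add: abs_divide)
      also have "\<dots> \<longleftrightarrow> \<bar>y\<bar> \<ge> 1 / C" using that assms by (simp add: field_simps)
      finally show ?thesis by simp
    qed
    thus "(ennreal (a / \<bar>y\<bar>) * indicator {y. \<bar>y\<bar> \<ge> 1 / C} y)\<^sup>2 =
        indicator {- (a\<^sup>2 * C)..a\<^sup>2 * C} (- a\<^sup>2 / y) * ennreal (a\<^sup>2 / y\<^sup>2)"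
      using assms by (cases "y = 0") (auto simp: indicator_def ennreal_power power_divide)
  qed
  also have "\<dots> = (\<integral>\<^sup>+z. indicator {- (a\<^sup>2 * C)..a\<^sup>2 * C} z \<partial>lborel)"
    using assms by (intro nn_integral_inversion) auto
  also have "\<dots> = ennreal (2 * a\<^sup>2 * C)" using assms by (simp add: field_simps)
  finally show ?thesis .
qed

lemma ennreal_le_of_power2_le:
  assumes "(x::ennreal)\<^sup>2 \<le> ennreal (y\<^sup>2)" "y \<ge> 0"
  shows "x \<le> ennreal y"
proof (cases x)
  case (real r)
  hence "r\<^sup>2 \<le> y\<^sup>2" using assms by (simp add: ennreal_power)
  thus ?thesis using real assms power2_le_imp_le[of r y] by (auto intro: ennreal_leI)
qed (use assms in \<open>auto simp: power2_eq_square top_unique\<close>)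

context random_chain
begin

text \<open>A window of length \<open>2 / C\<close> meets a density of at most
  \<open>1 / (2 * t)\<close>.\<close>

lemma small_ratio_prob:
  assumes C: "C > 0"
  shows "(\<integral>\<^sup>+w. indicator {x. \<bar>x\<bar> < 1 / C} (y e w (Suc i)) \<partial>pot_space t) \<le> ennreal (1 / (t * C))"
proof -
  interpret P: prob_space "pot_space t" by (rule prob_space_pot[OF t])
  have "(\<integral>\<^sup>+w. indicator {x. \<bar>x\<bar> < 1 / C} (y e w (Suc i)) \<partial>pot_space t) \<le>
     (\<integral>\<^sup>+w. (\<integral>\<^sup>+s. indicator {x. \<bar>x\<bar> < 1 / C} (e - c (Suc i) - \<alpha> i * v e w i / v e w (Suc i) - s) \<partial>unif (2 * t)) \<partial>pot_space t)"
    by (rule chain_transfer_base) measurable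
  also have "\<dots> \<le> (\<integral>\<^sup>+w. ennreal (1 / (t * C)) \<partial>pot_space t)"
  proof (rule nn_integral_mono)
    fix w :: "int \<Rightarrow> real"
    define d where "d = e - c (Suc i) - \<alpha> i * v e w i / v e w (Suc i)"
    have "(\<integral>\<^sup>+s. indicator {x. \<bar>x\<bar> < 1 / C} (d - s) \<partial>unif (2 * t)) =
       ennreal (1 / (2 * t)) * (\<integral>\<^sup>+s. indicator {x. \<bar>x\<bar> < 1 / C} (d - s) * indicator {0..2 * t} s \<partial>lborel)"
      using t by (intro nn_integral_unif) auto
    also have "\<dots> \<le> ennreal (1 / (2 * t)) * (\<integral>\<^sup>+s. indicator {d - 1 / C..d + 1 / C} s \<partial>lborel)"
      by (intro mult_left_mono nn_integral_mono) (auto simp: indicator_def)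
    also have "\<dots> = ennreal (1 / (2 * t)) * ennreal (2 / C)" using C by simp
    also have "\<dots> = ennreal (1 / (t * C))" using t C by (subst ennreal_mult[symmetric]) auto
    finally show "(\<integral>\<^sup>+s. indicator {x. \<bar>x\<bar> < 1 / C} (e - c (Suc i) - \<alpha> i * v e w i / v e w (Suc i) - s) \<partial>unif (2 * t)) \<le> ennreal (1 / (t * C))"
      unfolding d_def .
  qed
  also have "\<dots> = ennreal (1 / (t * C))" using P.emeasure_space_1 by simp
  finally show ?thesis .
qed

text \<open>Failure of decay from index \<open>M\<close> towards the end of the box. Only potentials
  at indices below \<open>M\<close> enter.\<close>

definition bad :: "real \<Rightarrow> nat \<Rightarrow> real \<Rightarrow> (int \<Rightarrow> real) \<Rightarrow> bool" where
  "bad C M e w \<longleftrightarrow> (\<exists>i\<in>{1..M}. \<bar>v e w i\<bar> > C * \<rho> ^ (M - i) * \<bar>v e w M\<bar>)"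

lemma bad_measurable[measurable]: "Measurable.pred (pot_space t) (bad C M e)"
  unfolding bad_def by measurable

text \<open>Off the event of a small last ratio, Markov's inequality is applied to
  \<open>v i / v M\<close> for each \<open>i\<close>, and the union over \<open>i\<close> has a sum
  that does not grow with \<open>M\<close>. The bound is uniform in \<open>e\<close> and tends to 0
  as \<open>C\<close> grows.\<close>

lemma bad_prob:
  assumes C: "C \<ge> 1" and M: "M \<ge> 1"
  shows "(\<integral>\<^sup>+w. indicator {w. bad C M e w} w \<partial>pot_space t) \<le> ennreal (1 / (t * C) + A / (sqrt (t * C) * \<rho> ^ 4 * (1 - \<rho>)))"
proof (cases "M = 1")
  case True
  \<comment> \<open>For \<open>M = 1\<close> the only candidate is \<open>i = M\<close>, which
    cannot violate the bound since \<open>C \<ge> 1\<close>.\<close>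
  hence "bad C M e = (\<lambda>_. False)" using C by (auto simp: bad_def fun_eq_iff)
  thus ?thesis by simp
next
  case False
  then obtain n where n: "M = Suc n" "n \<ge> 1" using M by (cases M) auto
  then obtain n' where n': "n = Suc n'" by (cases n) auto
  have A: "A > 0" using \<alpha>_pos[of 0] \<alpha>_le[of 0] by linarith
  define h where "h y = ennreal (\<alpha> n / \<bar>y\<bar>) * indicator {y. \<bar>y\<bar> \<ge> 1 / C} y" for y
  have [measurable]: "h \<in> borel_measurable borel" unfolding h_def by measurable
  \<comment> \<open>The square root of the bound of \<open>chain_decay\<close>, since \<open>1 / (2
    * t) * (2 * (\<alpha> n)\<^sup>2 * C) = (\<alpha> n)\<^sup>2 * C / t\<close>.\<close>
  define X where "X i = \<alpha> n * sqrt (C / t) * \<rho> ^ (4 * ((n - i) div 2))" for i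
  have X_nonneg: "X i \<ge> 0" for i using \<alpha>_pos[of n] \<rho> C t by (simp add: X_def)
  define E where "E i = (\<integral>\<^sup>+w. ratio e w i n * h (y e w n) \<partial>pot_space t)" for i
  have E_le: "E i \<le> ennreal (X i)" if i: "i \<in> {1..n}" for i
  proof (rule ennreal_le_of_power2_le)
    have "(E i)\<^sup>2 \<le> ennreal (1 / (2 * t)) * ennreal (\<rho> ^ (8 * ((n - i) div 2))) * L2sq h"
      unfolding E_def using chain_decay[of h i e "n - i"] i by simp
    also have "L2sq h = ennreal (2 * (\<alpha> n)\<^sup>2 * C)"
      unfolding h_def using C \<alpha>_pos[of n] by (intro nn_integral_cutoff_inverse_square) auto
    also have "ennreal (1 / (2 * t)) * ennreal (\<rho> ^ (8 * ((n - i) div 2))) * ennreal (2 * (\<alpha> n)\<^sup>2 * C) =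
       ennreal (1 / (2 * t) * \<rho> ^ (8 * ((n - i) div 2)) * (2 * (\<alpha> n)\<^sup>2 * C))"
    proof -
      have "ennreal p * ennreal q * ennreal s = ennreal (p * q * s)" if "p \<ge> 0" "q \<ge> 0" "s \<ge> 0" for p q s
        using that by (simp add: ennreal_mult)
      thus ?thesis using t \<rho> C by simp
    qed
    also have "1 / (2 * t) * \<rho> ^ (8 * ((n - i) div 2)) * (2 * (\<alpha> n)\<^sup>2 * C) = (X i)\<^sup>2"
    proof -
      have "\<rho> ^ (8 * k) = (\<rho> ^ (4 * k))\<^sup>2" for k by (simp add: power_mult[symmetric] mult.commute)
      thus ?thesis using t C by (simp add: X_def power_mult_distrib)
    qed
    finally show "(E i)\<^sup>2 \<le> ennreal ((X i)\<^sup>2)" .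
  qed (rule X_nonneg)
  \<comment> \<open>Markov factor: a violation at \<open>i\<close> means that \<open>K i\<close>
    times the modulus of \<open>v i / v M\<close> exceeds 1.\<close>
  define K where "K i = 1 / (C * \<rho> ^ (M - i))" for i
  have K_nonneg: "K i \<ge> 0" for i using C \<rho> by (simp add: K_def)
  have "(\<integral>\<^sup>+w. indicator {w. bad C M e w} w \<partial>pot_space t) \<le>
     (\<integral>\<^sup>+w. indicator {x. \<bar>x\<bar> < 1 / C} (y e w n) + (\<Sum>i\<in>{1..n}. ennreal (K i) * (ratio e w i n * h (y e w n))) \<partial>pot_space t)"
  proof (rule nn_integral_mono_AE, use AE_v_nonzero[of e n] AE_v_nonzero[of e n'] in eventually_elim)
    case (elim w)
    show ?case
    proof (cases "bad C M e w \<and> \<bar>y e w n\<bar> \<ge> 1 / C")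
      case True
      then obtain i where i: "i \<in> {1..M}" "\<bar>v e w i\<bar> > C * \<rho> ^ (M - i) * \<bar>v e w M\<bar>"
        unfolding bad_def by blast
      have "i \<noteq> M"
      proof
        assume "i = M"
        moreover have "\<bar>v e w M\<bar> \<le> C * \<bar>v e w M\<bar>" using C by (simp add: mult_le_cancel_right1)
        ultimately show False using i by simp
      qed
      hence i': "i \<in> {1..n}" using i n by auto
      have h: "h (y e w n) = ennreal (\<bar>v e w n\<bar> / \<bar>v e w M\<bar>)"
        using True elim \<alpha>_pos[of n] unfolding h_def n' n by (simp add: abs_mult)
      have "K i * (\<bar>v e w i / v e w n\<bar> * (\<bar>v e w n\<bar> / \<bar>v e w M\<bar>)) \<ge> 1"
        using i(2) elim C \<rho> unfolding n' n K_def by (simp add: abs_mult field_simps)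
      hence "1 \<le> ennreal (K i) * (ratio e w i n * h (y e w n))"
        unfolding h using K_nonneg by (simp add: ennreal_mult'[symmetric] ennreal_mult[symmetric])
      also have "\<dots> \<le> (\<Sum>i\<in>{1..n}. ennreal (K i) * (ratio e w i n * h (y e w n)))"
        using i' by (intro member_le_sum) auto
      finally show ?thesis using True by simp
    next
      case False
      thus ?thesis by (cases "bad C M e w") (auto simp: not_le)
    qed
  qed
  also have "\<dots> = (\<integral>\<^sup>+w. indicator {x. \<bar>x\<bar> < 1 / C} (y e w n) \<partial>pot_space t) + (\<Sum>i\<in>{1..n}. ennreal (K i) * E i)"
    unfolding E_def by (subst nn_integral_add, measurable) (subst nn_integral_sum, measurable, simp add: nn_integral_cmult)
  also have "\<dots> \<le> ennreal (1 / (t * C)) + (\<Sum>i\<in>{1..n}. ennreal (K i) * ennreal (X i))"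
    unfolding n'(1) using C E_le by (intro add_mono small_ratio_prob sum_mono mult_left_mono) (auto simp: n')
  also have "(\<Sum>i\<in>{1..n}. ennreal (K i) * ennreal (X i)) = ennreal (\<Sum>i\<in>{1..n}. K i * X i)"
    using K_nonneg X_nonneg by (simp add: ennreal_mult[symmetric])
  also have "(\<Sum>i\<in>{1..n}. K i * X i) \<le> A / (sqrt (t * C) * \<rho> ^ 4 * (1 - \<rho>))"
  proof -
    have "K i * X i \<le> A / (sqrt (t * C) * \<rho> ^ 4) * \<rho> ^ (n - i)" if "i \<in> {1..n}" for i
    proof -
      \<comment> \<open>Rounding in \<open>div 2\<close> and the shift \<open>M = n + 1\<close> cost
        at most four powers. Half of the exponent \<open>2 * (M - i)\<close> cancels the denominator
        of \<open>K i\<close>, the other half makes the sum geometric.\<close>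
      have "\<rho> ^ (4 * ((n - i) div 2)) * \<rho> ^ 4 \<le> \<rho> ^ (2 * (M - i))"
        unfolding power_add[symmetric] using that \<rho> n by (intro power_decreasing) auto
      hence "\<rho> ^ (4 * ((n - i) div 2)) \<le> \<rho> ^ (M - i) * \<rho> ^ (M - i) / \<rho> ^ 4"
        using \<rho> by (simp add: field_simps power_add[symmetric] mult_2)
      hence "X i \<le> A * sqrt (C / t) * (\<rho> ^ (M - i) * \<rho> ^ (M - i) / \<rho> ^ 4)"
        unfolding X_def using \<alpha>_le[of n] \<alpha>_pos[of n] C t \<rho> A by (intro mult_mono) auto
      hence "K i * X i \<le> K i * (A * sqrt (C / t) * (\<rho> ^ (M - i) * \<rho> ^ (M - i) / \<rho> ^ 4))"
        using K_nonneg by (rule mult_left_mono)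
      also have "\<dots> = A * (sqrt (C / t) / C) / \<rho> ^ 4 * \<rho> ^ (M - i)"
        using \<rho> C unfolding K_def by (simp add: field_simps)
      also have "sqrt (C / t) / C = 1 / sqrt (t * C)"
        using C t by (simp add: real_sqrt_divide real_sqrt_mult field_simps)
      also have "A * (1 / sqrt (t * C)) / \<rho> ^ 4 * \<rho> ^ (M - i) = A / (sqrt (t * C) * \<rho> ^ 4) * \<rho> ^ (M - i)" by simp
      also have "\<dots> \<le> A / (sqrt (t * C) * \<rho> ^ 4) * \<rho> ^ (n - i)"
        using n A \<rho> t C by (intro mult_left_mono power_decreasing) auto
      finally show ?thesis .
    qed
    hence "(\<Sum>i\<in>{1..n}. K i * X i) \<le> (\<Sum>i\<in>{1..n}. A / (sqrt (t * C) * \<rho> ^ 4) * \<rho> ^ (n - i))"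
      by (rule sum_mono)
    also have "\<dots> = A / (sqrt (t * C) * \<rho> ^ 4) * (\<Sum>i\<in>{1..n}. \<rho> ^ (n - i))" by (simp add: sum_distrib_left)
    also have "(\<Sum>i\<in>{1..n}. \<rho> ^ (n - i)) = (\<Sum>i<n. \<rho> ^ i)"
      by (rule sum.reindex_bij_witness[of _ "\<lambda>i. n - i" "\<lambda>i. n - i"]) auto
    also have "\<dots> = (1 - \<rho> ^ n) / (1 - \<rho>)" using \<rho> by (subst sum_gp_strict) auto
    also have "\<dots> \<le> 1 / (1 - \<rho>)" using \<rho> by (intro divide_right_mono) auto
    finally show ?thesis using A t C \<rho> by (simp add: mult_left_mono field_simps)
  qed
  finally show ?thesis using t C A \<rho> by (simp add: ennreal_plus[symmetric] add_left_mono ennreal_leI del: ennreal_plus)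
qed

end

section \<open>Eigenbases of finite boxes\<close>

text \<open>Tychonoff. It serves twice: for the existence of eigenbases and for limits of
  eigenvectors as the boxes grow.\<close>

lemma compact_unit_cube_fun: "compact {f :: 'i \<Rightarrow> real. \<forall>p. f p \<in> {-1..1}}"
proof -
  have "compactin (product_topology (\<lambda>_. euclidean) UNIV) (PiE UNIV (\<lambda>_::'i. {-1..1::real}))"
    by (subst compactin_PiE) auto
  moreover have "PiE UNIV (\<lambda>_::'i. {-1..1::real}) = {f. \<forall>p. f p \<in> {-1..1}}" by auto
  ultimately show ?thesis by (simp add: euclidean_product_topology)
qed

text \<open>First-order condition at a maximum; \<open>x = q / d\<close> is a point small enough for
  the linear term to win.\<close>

lemma quadratic_nonpos_imp_linear_coeff_zero:
  fixes p q :: real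
  assumes "\<And>x. p * x\<^sup>2 + 2 * q * x \<le> 0"
  shows "q = 0"
proof (rule ccontr)
  assume "q \<noteq> 0"
  define d where "d = \<bar>p\<bar> + 1"
  have d: "d > 0" "p + 2 * d > 0" by (auto simp: d_def)
  have "p * (q / d)\<^sup>2 + 2 * q * (q / d) = (q / d)\<^sup>2 * (p + 2 * d)"
    using d by (simp add: power2_eq_square field_simps)
  also have "\<dots> > 0" using d \<open>q \<noteq> 0\<close> by (intro mult_pos_pos) auto
  finally show False using assms[of "q / d"] by simp
qed

text \<open>Maximise \<open>\<Sum>i. i * \<langle>\<phi>\<^sub>i, A \<phi>\<^sub>i\<rangle>\<close> over orthonormal bases: as the weights are distinct, rotating two basis vectors
  into each other shows that the off-diagonal elements vanish at a maximum.\<close>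

theorem symmetric_matrix_eigenbasis:
  fixes A :: "int \<Rightarrow> int \<Rightarrow> real" and L :: "int set"
  assumes L: "finite L" and sym: "\<And>m n. m \<in> L \<Longrightarrow> n \<in> L \<Longrightarrow> A m n = A n m"
  obtains \<phi> :: "int \<Rightarrow> int \<Rightarrow> real" and E :: "int \<Rightarrow> real" where
    "\<And>i j. i \<in> L \<Longrightarrow> j \<in> L \<Longrightarrow> (\<Sum>n\<in>L. \<phi> i n * \<phi> j n) = (if i = j then 1 else 0)"
    "\<And>m n. m \<in> L \<Longrightarrow> n \<in> L \<Longrightarrow> (\<Sum>i\<in>L. \<phi> i m * \<phi> i n) = (if m = n then 1 else 0)"
    "\<And>i m. i \<in> L \<Longrightarrow> m \<in> L \<Longrightarrow> (\<Sum>n\<in>L. A m n * \<phi> i n) = E i * \<phi> i m"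
proof -
  define ip where "ip u w = (\<Sum>n\<in>L. u n * w n)" for u w :: "int \<Rightarrow> real"
  define bf where "bf u w = (\<Sum>m\<in>L. \<Sum>n\<in>L. u m * A m n * w n)" for u w :: "int \<Rightarrow> real"
  define O1 where "O1 = {f :: int \<times> int \<Rightarrow> real. \<forall>i\<in>L. \<forall>j\<in>L. (\<Sum>n\<in>L. f (i, n) * f (j, n)) = (if i = j then 1 else 0)}"
  define O2 where "O2 = {f :: int \<times> int \<Rightarrow> real. \<forall>m\<in>L. \<forall>n\<in>L. (\<Sum>i\<in>L. f (i, m) * f (i, n)) = (if m = n then 1 else 0)}"
  \<comment> \<open>Row and column orthonormality are both imposed, so neither has to be derived
    from the other. The cube also bounds entries off \<open>L\<close>, which makes the set compact
    in the full function space.\<close>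
  define K where "K = {f :: int \<times> int \<Rightarrow> real. \<forall>p. f p \<in> {-1..1}} \<inter> (O1 \<inter> O2)"
  define J where "J f = (\<Sum>i\<in>L. of_int i * bf (\<lambda>m. f (i, m)) (\<lambda>m. f (i, m)))" for f :: "int \<times> int \<Rightarrow> real"
  have cont[continuous_intros]: "continuous_on UNIV (\<lambda>f :: int \<times> int \<Rightarrow> real. f p)" for p
    by (rule continuous_on_product_coordinates)
  have "closed O1" unfolding O1_def Ball_def
    by (intro closed_Collect_all closed_Collect_imp closed_Collect_eq continuous_intros) auto
  moreover have "closed O2" unfolding O2_def Ball_def
    by (intro closed_Collect_all closed_Collect_imp closed_Collect_eq continuous_intros) auto
  ultimately have compact: "compact K"
    unfolding K_def by (intro compact_Int_closed compact_unit_cube_fun closed_Int)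
  have "(\<lambda>p. if fst p = snd p then 1 else 0) \<in> K"
    using L by (auto simp: K_def O1_def O2_def if_distrib[where f = "\<lambda>x. x * _"] cong: if_cong)
  hence "K \<noteq> {}" by blast
  moreover have "continuous_on UNIV J" unfolding J_def bf_def by (intro continuous_intros)
  hence "continuous_on K J" by (rule continuous_on_subset) simp
  ultimately obtain f where f: "f \<in> K" and max: "\<And>g. g \<in> K \<Longrightarrow> J g \<le> J f"
    using continuous_attains_sup[OF compact] by blast
  define \<phi> where "\<phi> i m = f (i, m)" for i m
  have bound: "f p \<in> {-1..1}" for p using f unfolding K_def by blast
  have orth1: "(\<Sum>n\<in>L. \<phi> i n * \<phi> j n) = (if i = j then 1 else 0)" if "i \<in> L" "j \<in> L" for i j
    using f that by (auto simp: K_def O1_def \<phi>_def)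
  have orth2: "(\<Sum>i\<in>L. \<phi> i m * \<phi> i n) = (if m = n then 1 else 0)" if "m \<in> L" "n \<in> L" for m n
    using f that by (auto simp: K_def O2_def \<phi>_def)
  have bf_sym: "bf u w = bf w u" for u w
    unfolding bf_def by (subst sum.swap) (intro sum.cong refl, auto simp: sym)
  have bf_lin: "bf (\<lambda>m. p * u m + q * w m) z = p * bf u z + q * bf w z" for p q u w z
    unfolding bf_def by (simp add: sum.distrib sum_distrib_left algebra_simps)
  have bf_lin2: "bf z (\<lambda>m. p * u m + q * w m) = p * bf z u + q * bf z w" for p q u w z
    by (subst (1 2 3) bf_sym) (rule bf_lin)
  have ip_lin: "ip (\<lambda>m. p * u m + q * w m) z = p * ip u z + q * ip w z" for p q u w z
    unfolding ip_def by (simp add: sum.distrib sum_distrib_left algebra_simps)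
  have ip_lin2: "ip z (\<lambda>m. p * u m + q * w m) = p * ip z u + q * ip z w" for p q u w z
    unfolding ip_def by (simp add: sum.distrib sum_distrib_left algebra_simps)
  have ip_diff: "ip (\<lambda>m. p * u m - q * w m) z = p * ip u z - q * ip w z"
    "ip z (\<lambda>m. p * u m - q * w m) = p * ip z u - q * ip z w" for p q u w z
    unfolding ip_def by (simp_all add: sum_subtractf sum_distrib_left algebra_simps)
  have bf_cong: "bf u w = bf u' w'" if "\<And>m. m \<in> L \<Longrightarrow> u m = u' m" "\<And>m. m \<in> L \<Longrightarrow> w m = w' m" for u w u' w'
    unfolding bf_def using that by (intro sum.cong) auto
  have off: "bf (\<phi> i) (\<phi> j) = 0" if ij: "i \<in> L" "j \<in> L" "i \<noteq> j" for i j
  proof -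
    define \<alpha> \<beta> \<gamma> where "\<alpha> = bf (\<phi> i) (\<phi> i)" and "\<beta> = bf (\<phi> i) (\<phi> j)" and "\<gamma> = bf (\<phi> j) (\<phi> j)"
    have key: "(of_int i - of_int j) * (\<gamma> - \<alpha>) * x\<^sup>2 + 2 * ((of_int i - of_int j) * \<beta>) * x \<le> 0" for x :: real
    proof -
      \<comment> \<open>\<open>cc\<close> and \<open>ss\<close> are cosine and sine of the angle
        with tangent \<open>x\<close>. Comparing \<open>J\<close> before and after the rotation and
        dividing by \<open>cc\<^sup>2\<close> leaves a quadratic in \<open>x\<close> whose linear
        coefficient is \<open>2 * (i - j)\<close> times the off-diagonal element.\<close>
      define cc where "cc = 1 / sqrt (1 + x\<^sup>2)"
      define ss where "ss = x * cc"
      have pos: "1 + x\<^sup>2 > 0" by (simp add: add_pos_nonneg)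
      have cc2: "cc\<^sup>2 * (1 + x\<^sup>2) = 1" using pos by (simp add: cc_def power_divide)
      hence cs: "cc\<^sup>2 + ss\<^sup>2 = 1" by (simp add: ss_def power_mult_distrib algebra_simps)
      define \<psi> where "\<psi> k m = (if k = i then cc * \<phi> i m + ss * \<phi> j m
         else if k = j then - ss * \<phi> i m + cc * \<phi> j m else \<phi> k m)" for k m
      define g where "g p = (if snd p \<in> L then \<psi> (fst p) (snd p) else f p)" for p
      have split: "(\<Sum>k\<in>L. F k) = F i + F j + (\<Sum>k\<in>L - {i, j}. F k)" for F :: "int \<Rightarrow> real"
        using L ij by (simp add: sum.remove[of L i] sum.remove[of "L - {i}" j] Diff_insert2[symmetric] add.assoc)
      have o1: "ip (\<psi> k) (\<psi> l) = (if k = l then 1 else 0)" if kl: "k \<in> L" "l \<in> L" for k l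
      proof -
        have base: "ip (\<phi> k) (\<phi> l) = (if k = l then 1 else 0)" if "k \<in> L" "l \<in> L" for k l
          unfolding ip_def by (rule orth1[OF that])
        have psi: "\<psi> i = (\<lambda>m. cc * \<phi> i m + ss * \<phi> j m)" "\<psi> j = (\<lambda>m. - ss * \<phi> i m + cc * \<phi> j m)"
          "k \<noteq> i \<Longrightarrow> k \<noteq> j \<Longrightarrow> \<psi> k = \<phi> k" for k
          using ij by (auto simp: \<psi>_def fun_eq_iff)
        show ?thesis
          using kl ij cs
          by (cases "k = i"; cases "k = j"; cases "l = i"; cases "l = j")
            (simp_all add: psi ip_lin ip_lin2 ip_diff base power2_eq_square)
      qed
      have o2: "(\<Sum>k\<in>L. \<psi> k m * \<psi> k n) = (if m = n then 1 else 0)" if mn: "m \<in> L" "n \<in> L" for m n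
      proof -
        have "\<psi> i m * \<psi> i n + \<psi> j m * \<psi> j n = (cc\<^sup>2 + ss\<^sup>2) * (\<phi> i m * \<phi> i n + \<phi> j m * \<phi> j n)"
          using ij by (simp add: \<psi>_def power2_eq_square algebra_simps)
        moreover have "(\<Sum>k\<in>L - {i, j}. \<psi> k m * \<psi> k n) = (\<Sum>k\<in>L - {i, j}. \<phi> k m * \<phi> k n)"
          by (intro sum.cong) (auto simp: \<psi>_def)
        ultimately have "(\<Sum>k\<in>L. \<psi> k m * \<psi> k n) = (\<Sum>k\<in>L. \<phi> k m * \<phi> k n)"
          by (simp add: split cs)
        thus ?thesis using orth2[OF mn] by simp
      qed
      have "g \<in> K"
      proof -
        have "g (k, m) \<in> {-1..1}" for k m
        proof (cases "m \<in> L \<and> k \<in> L")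
          case True
          have "(\<psi> k m)\<^sup>2 \<le> (\<Sum>k\<in>L. \<psi> k m * \<psi> k m)"
            using True L member_le_sum[of k L "\<lambda>k. \<psi> k m * \<psi> k m"] by (simp add: power2_eq_square)
          hence "\<bar>\<psi> k m\<bar> \<le> 1" using o2[of m m] True by (simp add: abs_square_le_1)
          thus ?thesis using True by (simp add: g_def abs_le_iff)
        next
          case False
          hence "g (k, m) = f (k, m)" using ij by (auto simp: g_def \<psi>_def \<phi>_def)
          thus ?thesis using bound[of "(k, m)"] by simp
        qed
        moreover have "g \<in> O1" using o1 unfolding O1_def ip_def by (auto simp: g_def cong: sum.cong)
        moreover have "g \<in> O2" using o2 unfolding O2_def by (auto simp: g_def cong: sum.cong)
        ultimately show ?thesis unfolding K_def by auto
      qed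
      hence "J g \<le> J f" by (rule max)
      moreover have "J g = (\<Sum>k\<in>L. of_int k * bf (\<psi> k) (\<psi> k))"
        unfolding J_def by (intro sum.cong refl arg_cong2[where f = "(*)"] bf_cong) (auto simp: g_def)
      moreover have "J f = (\<Sum>k\<in>L. of_int k * bf (\<phi> k) (\<phi> k))" by (simp add: J_def \<phi>_def[abs_def])
      moreover have "(\<Sum>k\<in>L - {i, j}. of_int k * bf (\<psi> k) (\<psi> k)) = (\<Sum>k\<in>L - {i, j}. of_int k * bf (\<phi> k) (\<phi> k))"
        by (intro sum.cong refl arg_cong2[where f = "(*)"] bf_cong) (auto simp: \<psi>_def)
      moreover have "bf (\<psi> i) (\<psi> i) = cc\<^sup>2 * \<alpha> + 2 * cc * ss * \<beta> + ss\<^sup>2 * \<gamma>"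
      proof -
        have "\<psi> i = (\<lambda>m. cc * \<phi> i m + ss * \<phi> j m)" by (auto simp: \<psi>_def)
        thus ?thesis by (simp add: bf_lin bf_lin2 \<alpha>_def \<beta>_def \<gamma>_def bf_sym[of "\<phi> j" "\<phi> i"] power2_eq_square algebra_simps)
      qed
      moreover have "bf (\<psi> j) (\<psi> j) = ss\<^sup>2 * \<alpha> - 2 * cc * ss * \<beta> + cc\<^sup>2 * \<gamma>"
      proof -
        have psi_j: "\<psi> j = (\<lambda>m. - ss * \<phi> i m + cc * \<phi> j m)" using ij by (auto simp: \<psi>_def)
        show ?thesis unfolding psi_j bf_lin bf_lin2
          by (simp add: \<alpha>_def \<beta>_def \<gamma>_def bf_sym[of "\<phi> j" "\<phi> i"] power2_eq_square algebra_simps)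
      qed
      ultimately have "of_int i * (cc\<^sup>2 * \<alpha> + 2 * cc * ss * \<beta> + ss\<^sup>2 * \<gamma>) + of_int j * (ss\<^sup>2 * \<alpha> - 2 * cc * ss * \<beta> + cc\<^sup>2 * \<gamma>)
          \<le> of_int i * \<alpha> + of_int j * \<gamma>"
        unfolding \<alpha>_def \<gamma>_def by (simp add: split)
      also have "of_int i * \<alpha> + of_int j * \<gamma> = (cc\<^sup>2 + ss\<^sup>2) * (of_int i * \<alpha> + of_int j * \<gamma>)" using cs by simp
      finally have "cc\<^sup>2 * ((of_int i - of_int j) * (\<gamma> - \<alpha>) * x\<^sup>2 + 2 * ((of_int i - of_int j) * \<beta>) * x) \<le> 0"
        unfolding ss_def by (simp add: power2_eq_square algebra_simps)
      moreover have "cc\<^sup>2 > 0" using pos by (simp add: cc_def)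
      ultimately show ?thesis by (simp add: mult_le_0_iff)
    qed
    have "(of_int i - of_int j :: real) * \<beta> = 0" by (rule quadratic_nonpos_imp_linear_coeff_zero[OF key])
    thus ?thesis using ij by (simp add: \<beta>_def)
  qed
  have eig: "(\<Sum>n\<in>L. A m n * \<phi> i n) = bf (\<phi> i) (\<phi> i) * \<phi> i m" if im: "i \<in> L" "m \<in> L" for i m
  proof -
    define g where "g m = (\<Sum>n\<in>L. A m n * \<phi> i n)" for m
    have proj: "(\<Sum>m'\<in>L. \<phi> j m' * g m') = bf (\<phi> j) (\<phi> i)" for j
      unfolding g_def bf_def by (simp add: sum_distrib_left mult.assoc)
    have "g m = (\<Sum>m'\<in>L. (\<Sum>j\<in>L. \<phi> j m * \<phi> j m') * g m')"
      using im L by (simp add: orth2 if_distrib[where f = "\<lambda>x. x * _"] cong: if_cong)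
    also have "\<dots> = (\<Sum>j\<in>L. \<phi> j m * (\<Sum>m'\<in>L. \<phi> j m' * g m'))"
      unfolding sum_distrib_right sum_distrib_left by (subst sum.swap) (simp add: mult.assoc)
    also have "\<dots> = (\<Sum>j\<in>L. if j = i then \<phi> i m * bf (\<phi> i) (\<phi> i) else 0)"
      using im off by (intro sum.cong) (auto simp: proj)
    also have "\<dots> = bf (\<phi> i) (\<phi> i) * \<phi> i m" using im L by simp
    finally show ?thesis unfolding g_def .
  qed
  show thesis using that[OF orth1 orth2 eig] .
qed

section \<open>Boxes, their solutions from both ends, and the diagonal Green function\<close>

abbreviation sites :: "nat \<Rightarrow> int set" where
  "sites N \<equiv> {- int N..int N}"

text \<open>Index 0 is the first site outside the box and index 1 the end site, as in
  \<open>chain_sol\<close>.\<close>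

definition siteR :: "nat \<Rightarrow> nat \<Rightarrow> int" where "siteR N i = int N + 1 - int i"
definition siteL :: "nat \<Rightarrow> nat \<Rightarrow> int" where "siteL N i = - int N - 1 + int i"

text \<open>\<open>a n\<close> joins \<open>n\<close> and \<open>n + 1\<close>; so the coupling from
  the \<open>i\<close>-th site to the next one inward is \<open>a (siteR N i - 1)\<close> from the
  right but \<open>a (siteL N i)\<close> from the left.\<close>

definition solR :: "(int \<Rightarrow> real) \<Rightarrow> (int \<Rightarrow> real) \<Rightarrow> nat \<Rightarrow> 'a::real_normed_field \<Rightarrow> nat \<Rightarrow> 'a" where
  "solR a \<beta> N z = chain_sol (\<lambda>i. a (siteR N i - 1)) (\<lambda>i. \<beta> (siteR N i)) z"
definition solL :: "(int \<Rightarrow> real) \<Rightarrow> (int \<Rightarrow> real) \<Rightarrow> nat \<Rightarrow> 'a::real_normed_field \<Rightarrow> nat \<Rightarrow> 'a" where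
  "solL a \<beta> N z = chain_sol (\<lambda>i. a (siteL N i)) (\<lambda>i. \<beta> (siteL N i)) z"

abbreviation jac :: "(int \<Rightarrow> real) \<Rightarrow> (int \<Rightarrow> real) \<Rightarrow> (int \<Rightarrow> real) \<Rightarrow> int \<Rightarrow> real" where
  "jac a \<beta> f n \<equiv> a n * f (n + 1) + a (n - 1) * f (n - 1) + \<beta> n * f n"

abbreviation jac_of_real ::
    "(int \<Rightarrow> real) \<Rightarrow> (int \<Rightarrow> real) \<Rightarrow> (int \<Rightarrow> 'a::real_normed_field) \<Rightarrow> int \<Rightarrow> 'a" where
  "jac_of_real a \<beta> f n \<equiv> of_real (a n) * f (n + 1) + of_real (a (n - 1)) * f (n - 1) + of_real (\<beta> n) * f n"

text \<open>The sites also label the eigenvectors, being a set of the right size. Extension by zero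
  encodes the Dirichlet conditions, so the equation can use the whole-line expression
  \<open>jac\<close>; the second conjunct is completeness.\<close>

definition box_eigensystem ::
    "(int \<Rightarrow> real) \<Rightarrow> (int \<Rightarrow> real) \<Rightarrow> nat \<Rightarrow> (int \<Rightarrow> int \<Rightarrow> real) \<Rightarrow> (int \<Rightarrow> real) \<Rightarrow> bool" where
  "box_eigensystem a \<beta> N \<phi> E \<longleftrightarrow>
    (\<forall>i\<in>sites N. \<forall>j\<in>sites N. (\<Sum>n\<in>sites N. \<phi> i n * \<phi> j n) = (if i = j then 1 else 0)) \<and>
    (\<forall>m\<in>sites N. \<forall>n\<in>sites N. (\<Sum>i\<in>sites N. \<phi> i m * \<phi> i n) = (if m = n then 1 else 0)) \<and>
    (\<forall>i\<in>sites N. \<forall>n\<in>sites N. jac a \<beta> (\<phi> i) n = E i * \<phi> i n) \<and>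
    (\<forall>i n. n \<notin> sites N \<longrightarrow> \<phi> i n = 0)"

lemma box_eigensystem_exists: "\<exists>\<phi> E. box_eigensystem a \<beta> N \<phi> E"
proof -
  define A where "A m n = (if n = m + 1 then a m else 0) + (if n = m - 1 then a n else 0) + (if n = m then \<beta> m else 0)" for m n
  obtain \<phi> E where \<phi>:
    "\<And>i j. i \<in> sites N \<Longrightarrow> j \<in> sites N \<Longrightarrow> (\<Sum>n\<in>sites N. \<phi> i n * \<phi> j n) = (if i = j then 1 else 0)"
    "\<And>m n. m \<in> sites N \<Longrightarrow> n \<in> sites N \<Longrightarrow> (\<Sum>i\<in>sites N. \<phi> i m * \<phi> i n) = (if m = n then 1 else 0)"
    "\<And>i m. i \<in> sites N \<Longrightarrow> m \<in> sites N \<Longrightarrow> (\<Sum>n\<in>sites N. A m n * \<phi> i n) = E i * \<phi> i m"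
    by (rule symmetric_matrix_eigenbasis[of "sites N" A]) (auto simp: A_def)
  define \<psi> where "\<psi> i n = (if n \<in> sites N then \<phi> i n else 0)" for i n
  have pick: "(\<Sum>n\<in>sites N. (if n = k then c n else 0) * \<phi> i n) = c k * \<psi> i k" for c :: "int \<Rightarrow> real" and k i
    by (simp add: \<psi>_def if_distrib[where f = "\<lambda>x. x * _"] sum.delta cong: if_cong)
  have "jac a \<beta> (\<psi> i) n = E i * \<psi> i n"
    if i: "i \<in> sites N" and n: "n \<in> sites N" for i n
  proof -
    have "(\<Sum>k\<in>sites N. A n k * \<phi> i k) = (\<Sum>k\<in>sites N. (if k = n + 1 then a n else 0) * \<phi> i k) +
        (\<Sum>k\<in>sites N. (if k = n - 1 then a k else 0) * \<phi> i k) + (\<Sum>k\<in>sites N. (if k = n then \<beta> n else 0) * \<phi> i k)"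
      by (simp add: A_def sum.distrib[symmetric] distrib_right)
    also have "\<dots> = jac a \<beta> (\<psi> i) n"
      by (simp only: pick[of "n + 1" "\<lambda>_. a n"] pick[of "n - 1" a] pick[of n "\<lambda>_. \<beta> n"])
    finally show ?thesis using \<phi>(3)[OF i n] n by (simp add: \<psi>_def)
  qed
  moreover have "(\<Sum>n\<in>sites N. \<psi> i n * \<psi> j n) = (\<Sum>n\<in>sites N. \<phi> i n * \<phi> j n)" for i j
    by (intro sum.cong) (auto simp: \<psi>_def)
  moreover have "(\<Sum>i\<in>sites N. \<psi> i m * \<psi> i n) = (\<Sum>i\<in>sites N. \<phi> i m * \<phi> i n)" if "m \<in> sites N" "n \<in> sites N" for m n
    using that by (intro sum.cong) (auto simp: \<psi>_def)
  moreover have "\<psi> i n = 0" if "n \<notin> sites N" for i n using that by (simp only: \<psi>_def if_False)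
  ultimately have "box_eigensystem a \<beta> N \<psi> E"
    unfolding box_eigensystem_def using \<phi>(1,2) by simp
  thus ?thesis by blast
qed

text \<open>The equation is asked for only strictly to the right of \<open>m\<close>. This covers
  eigenvectors as well as resolvent columns, whose equation has a source at
  \<open>m\<close>.\<close>

lemma solR_propagate:
  fixes f :: "int \<Rightarrow> 'a::real_normed_field"
  assumes a: "\<And>n. a n > 0" and m: "- int N \<le> m" "m \<le> int N"
    and f0: "f (int N + 1) = 0"
    and eq: "\<And>n. m < n \<Longrightarrow> n \<le> int N \<Longrightarrow> jac_of_real a \<beta> f n = z * f n"
  shows "int i \<le> int N + 1 - m \<Longrightarrow> f (siteR N i) = f (int N) * solR a \<beta> N z i"
proof (induction i rule: induct_nat_012)
  case (ge2 i)
  define n where "n = int N - int i"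
  have s: "siteR N (Suc i) = n" "siteR N i = n + 1" "siteR N (Suc (Suc i)) = n - 1" by (auto simp: siteR_def n_def)
  have IH: "f (n + 1) = f (int N) * solR a \<beta> N z i" "f n = f (int N) * solR a \<beta> N z (Suc i)"
    using ge2 by (auto simp: s)
  have "of_real (a (n - 1)) * f (n - 1) = (z - of_real (\<beta> n)) * f n - of_real (a n) * f (n + 1)"
    using eq[of n] ge2.prems by (simp add: n_def algebra_simps)
  hence "f (n - 1) = ((z - of_real (\<beta> n)) * f n - of_real (a n) * f (n + 1)) / of_real (a (n - 1))"
    using a[of "n - 1"] by (simp add: field_simps)
  thus ?case unfolding s IH by (simp add: solR_def s algebra_simps)
qed (auto simp: siteR_def solR_def f0)

lemma solL_propagate:
  fixes f :: "int \<Rightarrow> 'a::real_normed_field"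
  assumes a: "\<And>n. a n > 0" and m: "- int N \<le> m" "m \<le> int N"
    and f0: "f (- int N - 1) = 0"
    and eq: "\<And>n. - int N \<le> n \<Longrightarrow> n < m \<Longrightarrow> jac_of_real a \<beta> f n = z * f n"
  shows "int i \<le> m + int N + 1 \<Longrightarrow> f (siteL N i) = f (- int N) * solL a \<beta> N z i"
proof (induction i rule: induct_nat_012)
  case (ge2 i)
  define n where "n = - int N + int i"
  have s: "siteL N (Suc i) = n" "siteL N i = n - 1" "siteL N (Suc (Suc i)) = n + 1" by (auto simp: siteL_def n_def)
  have IH: "f (n - 1) = f (- int N) * solL a \<beta> N z i" "f n = f (- int N) * solL a \<beta> N z (Suc i)"
    using ge2 by (auto simp: s)
  have "of_real (a n) * f (n + 1) = (z - of_real (\<beta> n)) * f n - of_real (a (n - 1)) * f (n - 1)"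
    using eq[of n] ge2.prems by (simp add: n_def algebra_simps)
  hence "f (n + 1) = ((z - of_real (\<beta> n)) * f n - of_real (a (n - 1)) * f (n - 1)) / of_real (a n)"
    using a[of n] by (simp add: field_simps)
  thus ?case unfolding s IH by (simp add: solL_def s algebra_simps)
qed (auto simp: siteL_def solL_def f0)

text \<open>The indices at which the solutions started from the right and left end of the box reach \<open>m\<close>.\<close>
definition lenR :: "nat \<Rightarrow> int \<Rightarrow> nat" where "lenR N m = nat (int N + 1 - m)"
definition lenL :: "nat \<Rightarrow> int \<Rightarrow> nat" where "lenL N m = nat (m + int N + 1)"

text \<open>What the two sides of the box contribute to the equation at \<open>m\<close> once they
  are eliminated: the quotients of neighbouring values are those of the end solutions.\<close>

definition self_energy :: "(int \<Rightarrow> real) \<Rightarrow> (int \<Rightarrow> real) \<Rightarrow> nat \<Rightarrow> int \<Rightarrow> complex \<Rightarrow> complex" where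
  "self_energy a \<beta> N m z =
    of_real (a m) * solR a \<beta> N z (lenR N m - 1) / solR a \<beta> N z (lenR N m) +
    of_real (a (m - 1)) * solL a \<beta> N z (lenL N m - 1) / solL a \<beta> N z (lenL N m)"

text \<open>Schur complement formula for the diagonal resolvent entry at \<open>m\<close>. For
  \<open>m\<close> in the box the potential at \<open>m\<close> enters only through the explicit
  \<open>\<beta> m\<close>, and measurability requires no choice of eigenvectors.\<close>

definition green :: "(int \<Rightarrow> real) \<Rightarrow> (int \<Rightarrow> real) \<Rightarrow> nat \<Rightarrow> int \<Rightarrow> complex \<Rightarrow> complex" where
  "green a \<beta> N m z = 1 / (of_real (\<beta> m) - z + self_energy a \<beta> N m z)"

text \<open>The resolvent column \<open>\<psi>\<close> built from the eigensystem solves the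
  equation with unit source at \<open>m\<close>. On each side it is thus a multiple of the end
  solution, and the Schur formula returns \<open>\<psi> m\<close>.\<close>

lemma Im_green_eq_poisson_sum:
  assumes a: "\<And>n. a n > 0" and m: "m \<in> sites N" and sys: "box_eigensystem a \<beta> N \<phi> E" and y: "y > 0"
  shows "Im (green a \<beta> N m (Complex x y)) = (\<Sum>i\<in>sites N. (\<phi> i m)\<^sup>2 * (y / ((E i - x)\<^sup>2 + y\<^sup>2)))"
proof -
  define z where "z = Complex x y"
  have orth: "(\<Sum>i\<in>sites N. \<phi> i m * \<phi> i n) = (if m = n then 1 else 0)" if "n \<in> sites N" for n
    using sys m that unfolding box_eigensystem_def by blast
  have eqn: "jac a \<beta> (\<phi> i) n = E i * \<phi> i n" if "i \<in> sites N" "n \<in> sites N" for i n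
    using sys that unfolding box_eigensystem_def by blast
  have zero: "\<phi> i n = 0" if "n \<notin> sites N" for i n
    using sys that unfolding box_eigensystem_def by blast
  have nz: "of_real (E i) - z \<noteq> 0" for i
  proof
    assume "of_real (E i) - z = 0"
    hence "Im (of_real (E i) - z) = 0" by simp
    thus False using y by (simp add: z_def)
  qed
  define \<psi> where "\<psi> n = (\<Sum>i\<in>sites N. of_real (\<phi> i m) * of_real (\<phi> i n) / (of_real (E i) - z))" for n
  have \<psi>_zero: "\<psi> n = 0" if "n \<notin> sites N" for n by (simp add: \<psi>_def zero[OF that])
  have \<psi>_eq: "jac_of_real a \<beta> \<psi> n - z * \<psi> n =
      (if m = n then 1 else 0)" if n: "n \<in> sites N" for n
  proof -
    have "jac_of_real a \<beta> \<psi> n - z * \<psi> n =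
       (\<Sum>i\<in>sites N. of_real (\<phi> i m) * (of_real (jac a \<beta> (\<phi> i) n) - z * of_real (\<phi> i n)) / (of_real (E i) - z))"
      unfolding \<psi>_def by (simp add: sum_distrib_left sum.distrib[symmetric] sum_subtractf[symmetric] diff_divide_distrib add_divide_distrib algebra_simps)
    also have "\<dots> = (\<Sum>i\<in>sites N. of_real (\<phi> i m * \<phi> i n))"
    proof (rule sum.cong)
      fix i assume i: "i \<in> sites N"
      have "of_real (E i * \<phi> i n) - z * of_real (\<phi> i n) = (of_real (E i) - z) * of_real (\<phi> i n)" by (simp add: algebra_simps)
      thus "of_real (\<phi> i m) * (of_real (jac a \<beta> (\<phi> i) n) - z * of_real (\<phi> i n)) / (of_real (E i) - z) =
          complex_of_real (\<phi> i m * \<phi> i n)"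
        using nz[of i] by (simp only: eqn[OF i n]) simp
    qed simp
    also have "\<dots> = of_real (\<Sum>i\<in>sites N. \<phi> i m * \<phi> i n)" by simp
    finally show ?thesis using orth[OF n] by simp
  qed
  have Im_\<psi>: "Im (\<psi> m) = (\<Sum>i\<in>sites N. (\<phi> i m)\<^sup>2 * (y / ((E i - x)\<^sup>2 + y\<^sup>2)))"
    unfolding \<psi>_def by (simp add: z_def Im_divide power2_eq_square)
  \<comment> \<open>This excludes \<open>\<psi> m = 0\<close>, by which the quotients below
    divide.\<close>
  have "Im (\<psi> m) > 0"
  proof -
    have pos: "y / ((E i - x)\<^sup>2 + y\<^sup>2) > 0" for i using y by (simp add: add_nonneg_pos)
    have "(\<Sum>i\<in>sites N. (\<phi> i m)\<^sup>2) = 1" using orth[OF m] by (simp add: power2_eq_square)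
    then obtain i where i: "i \<in> sites N" "(\<phi> i m)\<^sup>2 \<noteq> 0" by (metis sum.neutral zero_neq_one)
    have "0 < (\<phi> i m)\<^sup>2 * (y / ((E i - x)\<^sup>2 + y\<^sup>2))" using i(2) by (intro mult_pos_pos pos) auto
    moreover have "0 \<le> (\<phi> k m)\<^sup>2 * (y / ((E k - x)\<^sup>2 + y\<^sup>2))" for k
      by (intro mult_nonneg_nonneg less_imp_le[OF pos]) auto
    ultimately show ?thesis unfolding Im_\<psi> using i(1) by (intro sum_pos2[of _ i]) auto
  qed
  hence \<psi>m: "\<psi> m \<noteq> 0" by auto
  have m': "- int N \<le> m" "m \<le> int N" using m by auto
  have R: "\<psi> (siteR N i) = \<psi> (int N) * solR a \<beta> N z i" if "int i \<le> int N + 1 - m" for i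
  proof (rule solR_propagate[OF a m' _ _ that])
    show "\<psi> (int N + 1) = 0" by (rule \<psi>_zero) auto
    show "jac_of_real a \<beta> \<psi> n = z * \<psi> n" if "m < n" "n \<le> int N" for n
      using \<psi>_eq[of n] that m' by simp
  qed
  have L: "\<psi> (siteL N i) = \<psi> (- int N) * solL a \<beta> N z i" if "int i \<le> m + int N + 1" for i
  proof (rule solL_propagate[OF a m' _ _ that])
    show "\<psi> (- int N - 1) = 0" by (rule \<psi>_zero) auto
    show "jac_of_real a \<beta> \<psi> n = z * \<psi> n" if "- int N \<le> n" "n < m" for n
      using \<psi>_eq[of n] that m' by simp
  qed
  have "siteR N (lenR N m) = m" "siteR N (lenR N m - 1) = m + 1" "siteL N (lenL N m) = m" "siteL N (lenL N m - 1) = m - 1"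
    using m' by (auto simp: siteR_def siteL_def lenR_def lenL_def)
  hence R1: "\<psi> m = \<psi> (int N) * solR a \<beta> N z (lenR N m)" and R2: "\<psi> (m + 1) = \<psi> (int N) * solR a \<beta> N z (lenR N m - 1)"
    and L1: "\<psi> m = \<psi> (- int N) * solL a \<beta> N z (lenL N m)" and L2: "\<psi> (m - 1) = \<psi> (- int N) * solL a \<beta> N z (lenL N m - 1)"
    using R[of "lenR N m"] R[of "lenR N m - 1"] L[of "lenL N m"] L[of "lenL N m - 1"] m' by (auto simp: lenR_def lenL_def)
  have ratioR: "solR a \<beta> N z (lenR N m - 1) / solR a \<beta> N z (lenR N m) = \<psi> (m + 1) / \<psi> m"
    using R1 R2 \<psi>m by (auto simp: field_simps)
  have ratioL: "solL a \<beta> N z (lenL N m - 1) / solL a \<beta> N z (lenL N m) = \<psi> (m - 1) / \<psi> m"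
    using L1 L2 \<psi>m by (auto simp: field_simps)
  have "(of_real (\<beta> m) - z + self_energy a \<beta> N m z) * \<psi> m = 1"
    unfolding self_energy_def using \<psi>_eq[OF m] \<psi>m ratioR ratioL
    by (simp add: distrib_right left_diff_distrib times_divide_eq_right[symmetric] del: times_divide_eq_right) (simp add: algebra_simps)
  hence "green a \<beta> N m z = \<psi> m" unfolding green_def by (auto simp: divide_eq_eq mult.commute)
  thus ?thesis using Im_\<psi> by (simp add: z_def)
qed

text \<open>The eigenvalue equation is evaluated at a site where the eigenvector is largest in
  modulus.\<close>

lemma box_eigenvalue_bound:
  assumes sys: "box_eigensystem a \<beta> N \<phi> E" and i: "i \<in> sites N"
    and a: "\<And>n. \<bar>a n\<bar> \<le> A" and b: "\<And>n. \<bar>\<beta> n\<bar> \<le> B"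
  shows "\<bar>E i\<bar> \<le> 2 * A + B"
proof -
  have zero: "\<phi> i n = 0" if "n \<notin> sites N" for n using sys that unfolding box_eigensystem_def by blast
  have norm: "(\<Sum>n\<in>sites N. \<phi> i n * \<phi> i n) = 1" using sys i unfolding box_eigensystem_def by simp
  obtain n where n: "n \<in> sites N" and max: "\<And>k. k \<in> sites N \<Longrightarrow> \<bar>\<phi> i k\<bar> \<le> \<bar>\<phi> i n\<bar>"
  proof -
    have "Max ((\<lambda>k. \<bar>\<phi> i k\<bar>) ` sites N) \<in> (\<lambda>k. \<bar>\<phi> i k\<bar>) ` sites N" by (rule Max_in) auto
    then obtain n where n: "n \<in> sites N" "Max ((\<lambda>k. \<bar>\<phi> i k\<bar>) ` sites N) = \<bar>\<phi> i n\<bar>" by blast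
    have "\<bar>\<phi> i k\<bar> \<le> Max ((\<lambda>k. \<bar>\<phi> i k\<bar>) ` sites N)" if "k \<in> sites N" for k using that by (intro Max_ge) auto
    thus thesis using that[of n] n by simp
  qed
  have max': "\<bar>\<phi> i k\<bar> \<le> \<bar>\<phi> i n\<bar>" for k using max[of k] zero[of k] by (cases "k \<in> sites N") auto
  have pos: "\<bar>\<phi> i n\<bar> > 0"
  proof (rule ccontr)
    assume "\<not> \<bar>\<phi> i n\<bar> > 0"
    hence "\<phi> i k = 0" for k using max'[of k] by simp
    thus False using norm by simp
  qed
  have AB: "A \<ge> 0" "B \<ge> 0" using a[of 0] b[of 0] by linarith+
  have "\<bar>E i\<bar> * \<bar>\<phi> i n\<bar> = \<bar>jac a \<beta> (\<phi> i) n\<bar>"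
    using sys i n unfolding box_eigensystem_def by (simp add: abs_mult[symmetric])
  also have "\<dots> \<le> \<bar>a n\<bar> * \<bar>\<phi> i (n + 1)\<bar> + \<bar>a (n - 1)\<bar> * \<bar>\<phi> i (n - 1)\<bar> + \<bar>\<beta> n\<bar> * \<bar>\<phi> i n\<bar>"
    unfolding abs_mult[symmetric] by linarith
  also have "\<dots> \<le> A * \<bar>\<phi> i n\<bar> + A * \<bar>\<phi> i n\<bar> + B * \<bar>\<phi> i n\<bar>"
    using a b max' AB by (intro add_mono mult_mono) auto
  finally have "\<bar>E i\<bar> * \<bar>\<phi> i n\<bar> \<le> (2 * A + B) * \<bar>\<phi> i n\<bar>" by (simp add: algebra_simps)
  thus ?thesis using pos by simp
qed

section \<open>Spectral averaging\<close>

text \<open>As a function of \<open>s\<close> the integrand is a Cauchy kernel of total mass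
  \<open>pi\<close>, whatever \<open>\<zeta>\<close> is; \<open>1 / (2 * t)\<close> is the density
  of the law.\<close>

lemma unif_cauchy_bound:
  assumes t: "t > 0"
  shows "(\<integral>\<^sup>+s. ennreal (Im (1 / (of_real s + \<zeta>))) \<partial>unif (2 * t)) \<le> ennreal (pi / (2 * t))"
proof -
  define x \<kappa> where "x = Re \<zeta>" and "\<kappa> = - Im \<zeta>"
  have Im_eq: "Im (1 / (of_real s + \<zeta>)) = \<kappa> / ((s + x)\<^sup>2 + \<kappa>\<^sup>2)" for s
    by (simp add: Im_divide x_def \<kappa>_def)
  show ?thesis
  proof (cases "\<kappa> > 0")
    \<comment> \<open>Here the imaginary part is never positive and \<open>ennreal\<close> cuts it
      off to 0.\<close>
    case False
    hence "\<kappa> / ((s + x)\<^sup>2 + \<kappa>\<^sup>2) \<le> 0" for s by (intro divide_nonpos_nonneg) auto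
    thus ?thesis unfolding Im_eq by (simp add: ennreal_neg)
  next
    case True
    have pos: "(s + x)\<^sup>2 + \<kappa>\<^sup>2 > 0" for s using True by (simp add: add_nonneg_pos)
    have "(\<integral>\<^sup>+s. ennreal (\<kappa> / ((s + x)\<^sup>2 + \<kappa>\<^sup>2)) * indicator {0..2 * t} s \<partial>lborel) =
      ennreal (arctan ((2 * t + x) / \<kappa>) - arctan ((0 + x) / \<kappa>))"
    proof (rule nn_integral_FTC_Icc[where F = "\<lambda>s. arctan ((s + x) / \<kappa>)"])
      fix s
      have "1 / \<kappa> * inverse (1 + ((s + x) / \<kappa>)\<^sup>2) = \<kappa> / ((s + x)\<^sup>2 + \<kappa>\<^sup>2)"
        using True pos[of s] by (simp add: field_simps power2_eq_square)
      moreover have "((\<lambda>s. arctan ((s + x) / \<kappa>)) has_real_derivative 1 / \<kappa> * inverse (1 + ((s + x) / \<kappa>)\<^sup>2)) (at s)"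
        using True by (auto intro!: derivative_eq_intros)
      ultimately show "((\<lambda>s. arctan ((s + x) / \<kappa>)) has_real_derivative \<kappa> / ((s + x)\<^sup>2 + \<kappa>\<^sup>2)) (at s)"
        by simp
      show "0 \<le> \<kappa> / ((s + x)\<^sup>2 + \<kappa>\<^sup>2)" using True pos[of s] by (intro divide_nonneg_pos) auto
    qed (use t in auto)
    also have "\<dots> \<le> ennreal pi"
      using arctan_ubound[of "(2 * t + x) / \<kappa>"] arctan_lbound[of "(0 + x) / \<kappa>"] by (intro ennreal_leI) linarith
    finally have "ennreal (1 / (2 * t)) * (\<integral>\<^sup>+s. ennreal (\<kappa> / ((s + x)\<^sup>2 + \<kappa>\<^sup>2)) * indicator {0..2 * t} s \<partial>lborel) \<le>
       ennreal (1 / (2 * t)) * ennreal pi" by (rule mult_left_mono) auto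
    also have "\<dots> = ennreal (pi / (2 * t))" using t by (subst ennreal_mult[symmetric]) auto
    finally show ?thesis unfolding Im_eq using t by (subst nn_integral_unif) auto
  qed
qed

lemma inj_siteR: "inj (siteR N)" and inj_siteL: "inj (siteL N)"
  by (auto simp: inj_def siteR_def siteL_def)

locale random_jacobi =
  fixes a b :: "int \<Rightarrow> real" and t A B \<rho> :: real and r :: nat
  assumes t: "t > 0" and a_pos: "\<And>n. a n > 0" and a_le: "\<And>n. a n \<le> A" and r: "2 * A \<le> real r * t"
    and b_le: "\<And>n. \<bar>b n\<bar> \<le> B"
    and \<rho>: "0 < \<rho>" "\<rho> < 1" "gap r \<le> \<rho> ^ 8"
begin

lemma random_chain_R: "random_chain t A \<rho> r (\<lambda>i. a (siteR N i - 1)) (siteR N)"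
  using t a_pos a_le r inj_siteR \<rho> by unfold_locales auto

lemma random_chain_L: "random_chain t A \<rho> r (\<lambda>i. a (siteL N i)) (siteL N)"
  using t a_pos a_le r inj_siteL \<rho> by unfold_locales auto

definition pot :: "(int \<Rightarrow> real) \<Rightarrow> int \<Rightarrow> real" where "pot w n = b n + w n"

text \<open>Stated at every real energy, not only at eigenvalues, so that the estimate at fixed
  energy applies.\<close>

definition badR :: "real \<Rightarrow> nat \<Rightarrow> int \<Rightarrow> real \<Rightarrow> (int \<Rightarrow> real) \<Rightarrow> bool" where
  "badR C N m e w \<longleftrightarrow> (\<exists>i\<in>{1..lenR N m}. \<bar>solR a (pot w) N e i\<bar> > C * \<rho> ^ (lenR N m - i) * \<bar>solR a (pot w) N e (lenR N m)\<bar>)"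

definition badL :: "real \<Rightarrow> nat \<Rightarrow> int \<Rightarrow> real \<Rightarrow> (int \<Rightarrow> real) \<Rightarrow> bool" where
  "badL C N m e w \<longleftrightarrow> (\<exists>i\<in>{1..lenL N m}. \<bar>solL a (pot w) N e i\<bar> > C * \<rho> ^ (lenL N m - i) * \<bar>solL a (pot w) N e (lenL N m)\<bar>)"

definition bad :: "real \<Rightarrow> nat \<Rightarrow> int \<Rightarrow> real \<Rightarrow> (int \<Rightarrow> real) \<Rightarrow> bool" where
  "bad C N m e w \<longleftrightarrow> badR C N m e w \<or> badL C N m e w"

definition p_bad :: "real \<Rightarrow> real" where
  "p_bad C = 1 / (t * C) + A / (sqrt (t * C) * \<rho> ^ 4 * (1 - \<rho>))"

lemma A_pos: "A > 0" using a_pos[of 0] a_le[of 0] by linarith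

lemma p_bad_nonneg: "C \<ge> 1 \<Longrightarrow> p_bad C \<ge> 0"
  using t \<rho> A_pos by (auto simp: p_bad_def intro!: add_nonneg_nonneg divide_nonneg_nonneg)

lemma measurable_solR:
  fixes z :: "'b \<Rightarrow> 'c::{real_normed_field, second_countable_topology}"
  assumes "z \<in> borel_measurable Q" "\<And>k. (\<lambda>x. w x k) \<in> borel_measurable Q"
  shows "(\<lambda>x. solR a (pot (w x)) N (z x) i) \<in> borel_measurable Q"
  unfolding solR_def pot_def by (intro measurable_chain_sol borel_measurable_add assms) auto

lemma measurable_solL:
  fixes z :: "'b \<Rightarrow> 'c::{real_normed_field, second_countable_topology}"
  assumes "z \<in> borel_measurable Q" "\<And>k. (\<lambda>x. w x k) \<in> borel_measurable Q"
  shows "(\<lambda>x. solL a (pot (w x)) N (z x) i) \<in> borel_measurable Q"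
  unfolding solL_def pot_def by (intro measurable_chain_sol borel_measurable_add assms) auto

lemma measurable_bad:
  assumes e: "e \<in> borel_measurable Q" and w: "\<And>k. (\<lambda>x. w x k) \<in> borel_measurable Q"
  shows "Measurable.pred Q (\<lambda>x. bad C N m (e x) (w x))"
proof -
  note [measurable] = measurable_solR[OF e w] measurable_solL[OF e w]
  show ?thesis unfolding bad_def badR_def badL_def by measurable
qed

lemma measurable_green:
  assumes e[measurable]: "e \<in> borel_measurable Q" and w: "\<And>k. (\<lambda>x. w x k) \<in> borel_measurable Q"
  shows "(\<lambda>x. Im (green a (pot (w x)) N m (Complex (e x) \<eta>))) \<in> borel_measurable Q"
proof -
  have [measurable]: "(\<lambda>x. Complex (e x) \<eta>) \<in> borel_measurable Q" unfolding Complex_eq by measurable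
  have z: "(\<lambda>x. Complex (e x) \<eta>) \<in> borel_measurable Q" by measurable
  note [measurable] = measurable_solR[OF z w] measurable_solL[OF z w]
  have [measurable]: "(\<lambda>x. pot (w x) m) \<in> borel_measurable Q"
    unfolding pot_def by (intro borel_measurable_add w) auto
  show ?thesis unfolding green_def self_energy_def by measurable
qed

lemma bad_prob:
  assumes C: "C \<ge> 1" and m: "m \<in> sites N"
  shows "(\<integral>\<^sup>+w. indicator {w. bad C N m e w} w \<partial>pot_space t) \<le> ennreal (2 * p_bad C)"
proof -
  interpret R: random_chain t A \<rho> r "\<lambda>i. a (siteR N i - 1)" "\<lambda>i. b (siteR N i)" "siteR N" by (rule random_chain_R)
  interpret L: random_chain t A \<rho> r "\<lambda>i. a (siteL N i)" "\<lambda>i. b (siteL N i)" "siteL N" by (rule random_chain_L)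
  have R: "badR C N m e w \<longleftrightarrow> R.bad C (lenR N m) e w" for w
    by (simp add: badR_def R.bad_def R.v_def solR_def pot_def)
  have L: "badL C N m e w \<longleftrightarrow> L.bad C (lenL N m) e w" for w
    by (simp add: badL_def L.bad_def L.v_def solL_def pot_def)
  have "(\<integral>\<^sup>+w. indicator {w. bad C N m e w} w \<partial>pot_space t) \<le>
     (\<integral>\<^sup>+w. indicator {w. R.bad C (lenR N m) e w} w + indicator {w. L.bad C (lenL N m) e w} w \<partial>pot_space t)"
    by (intro nn_integral_mono) (auto simp: bad_def R L indicator_def)
  also have "\<dots> = (\<integral>\<^sup>+w. indicator {w. R.bad C (lenR N m) e w} w \<partial>pot_space t) + (\<integral>\<^sup>+w. indicator {w. L.bad C (lenL N m) e w} w \<partial>pot_space t)"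
    by (rule nn_integral_add) measurable
  also have "\<dots> \<le> ennreal (p_bad C) + ennreal (p_bad C)"
    unfolding p_bad_def using C m by (intro add_mono R.bad_prob L.bad_prob) (auto simp: lenR_def lenL_def)
  also have "\<dots> = ennreal (2 * p_bad C)" using p_bad_nonneg[OF C] by (simp add: ennreal_plus[symmetric] del: ennreal_plus)
  finally show ?thesis .
qed

text \<open>\<open>2 * A + B + 2 * t\<close> bounds all box eigenvalues for potentials in the
  support; the extra 1 puts them in the interior of the energy window.\<close>

definition Rad :: real where "Rad = 2 * A + B + 2 * t + 1"

lemma Rad_pos: "Rad > 0" using A_pos t b_le[of 0] unfolding Rad_def by linarith

text \<open>Mass of the bad energies for the spectral measure at \<open>m\<close>, smeared by a
  Poisson kernel of width \<open>\<eta>\<close> (up to the factor \<open>pi\<close>). Unlike a sum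
  over chosen eigenvectors it is measurable in \<open>w\<close>.\<close>

definition smeared_bad_weight :: "real \<Rightarrow> nat \<Rightarrow> int \<Rightarrow> real \<Rightarrow> (int \<Rightarrow> real) \<Rightarrow> ennreal" where
  "smeared_bad_weight C N m \<eta> w = (\<integral>\<^sup>+e. ennreal (Im (green a (pot w) N m (Complex e \<eta>))) *
     indicator {e. \<bar>e\<bar> < Rad \<and> bad C N m e w} e \<partial>lborel)"

lemma solR_upd: "i \<le> lenR N m \<Longrightarrow> m \<in> sites N \<Longrightarrow> solR a (pot (w(m := s))) N z i = solR a (pot w) N z i"
  unfolding solR_def by (intro chain_sol_cong) (auto simp: pot_def siteR_def lenR_def)

lemma solL_upd: "i \<le> lenL N m \<Longrightarrow> m \<in> sites N \<Longrightarrow> solL a (pot (w(m := s))) N z i = solL a (pot w) N z i"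
  unfolding solL_def by (intro chain_sol_cong) (auto simp: pot_def siteL_def lenL_def)

lemma bad_upd: "m \<in> sites N \<Longrightarrow> bad C N m e (w(m := s)) \<longleftrightarrow> bad C N m e w"
  unfolding bad_def badR_def badL_def by (simp add: solR_upd solL_upd)

lemma self_energy_upd: "m \<in> sites N \<Longrightarrow> self_energy a (pot (w(m := s))) N m z = self_energy a (pot w) N m z"
  unfolding self_energy_def by (simp add: solR_upd solL_upd)

text \<open>Spectral averaging: as a function of the potential at \<open>m\<close> alone, the Green function has the form \<open>1 / (s + \<zeta>)\<close>.\<close>

lemma green_average:
  assumes m: "m \<in> sites N"
  shows "(\<integral>\<^sup>+s. ennreal (Im (green a (pot (w(m := s))) N m z)) \<partial>unif (2 * t)) \<le> ennreal (pi / (2 * t))"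
proof -
  have "green a (pot (w(m := s))) N m z = 1 / (of_real s + (of_real (b m) - z + self_energy a (pot w) N m z))" for s
    unfolding green_def self_energy_upd[OF m] by (simp add: pot_def algebra_simps)
  thus ?thesis using unif_cauchy_bound[OF t] by simp
qed

abbreviation smeared_density :: "real \<Rightarrow> nat \<Rightarrow> int \<Rightarrow> real \<Rightarrow> (int \<Rightarrow> real) \<times> real \<Rightarrow> ennreal" where
  "smeared_density C N m \<eta> x \<equiv> ennreal (Im (green a (pot (fst x)) N m (Complex (snd x) \<eta>))) *
     indicator {x. \<bar>snd x\<bar> < Rad \<and> bad C N m (snd x) (fst x)} x"

lemma smeared_bad_weight_measurable[measurable]: "smeared_bad_weight C N m \<eta> \<in> borel_measurable (pot_space t)"
proof -
  have comp: "(\<lambda>x. fst (x :: (int \<Rightarrow> real) \<times> real) k) \<in> borel_measurable (pot_space t \<Otimes>\<^sub>M lborel)" for k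
    by (rule measurable_compose[OF _ measurable_pot_component]) measurable
  have [measurable]: "(\<lambda>x. Im (green a (pot (fst x)) N m (Complex (snd x) \<eta>))) \<in> borel_measurable (pot_space t \<Otimes>\<^sub>M lborel)"
    "Measurable.pred (pot_space t \<Otimes>\<^sub>M lborel) (\<lambda>x. bad C N m (snd x) (fst x))"
    by (auto intro!: measurable_green[OF _ comp] measurable_bad[OF _ comp])
  have "(\<lambda>w. \<integral>\<^sup>+e. smeared_density C N m \<eta> (w, e) \<partial>lborel) \<in> borel_measurable (pot_space t)"
    by (rule lborel.borel_measurable_nn_integral_fst) measurable
  also have "(\<lambda>w. \<integral>\<^sup>+e. smeared_density C N m \<eta> (w, e) \<partial>lborel) = smeared_bad_weight C N m \<eta>"
    unfolding smeared_bad_weight_def by (intro ext nn_integral_cong) (auto simp: indicator_def)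
  finally show ?thesis .
qed

text \<open>Fubini leaves the energy for last. At fixed energy, resampling the potential at
  \<open>m\<close> does not affect the bad event, so the averaged Green function and the probability
  multiply. The bound is uniform in \<open>N\<close> and \<open>\<eta>\<close>.\<close>

lemma smeared_bad_weight_expectation:
  assumes C: "C \<ge> 1" and m: "m \<in> sites N"
  shows "(\<integral>\<^sup>+w. smeared_bad_weight C N m \<eta> w \<partial>pot_space t) \<le> ennreal (2 * Rad * (pi / (2 * t)) * (2 * p_bad C))"
proof -
  interpret P: prob_space "pot_space t" by (rule prob_space_pot[OF t])
  interpret PL: pair_sigma_finite "pot_space t" lborel by standard
  have comp: "(\<lambda>x. fst (x :: (int \<Rightarrow> real) \<times> real) k) \<in> borel_measurable (pot_space t \<Otimes>\<^sub>M lborel)" for k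
    by (rule measurable_compose[OF _ measurable_pot_component]) measurable
  have [measurable]: "(\<lambda>x. Im (green a (pot (fst x)) N m (Complex (snd x) \<eta>))) \<in> borel_measurable (pot_space t \<Otimes>\<^sub>M lborel)"
    "Measurable.pred (pot_space t \<Otimes>\<^sub>M lborel) (\<lambda>x. bad C N m (snd x) (fst x))"
    by (auto intro!: measurable_green[OF _ comp] measurable_bad[OF _ comp])
  have [measurable]: "(\<lambda>w. Im (green a (pot w) N m (Complex e \<eta>))) \<in> borel_measurable (pot_space t)"
    "Measurable.pred (pot_space t) (\<lambda>w. bad C N m e w)" for e
    by (auto intro!: measurable_green[OF _ measurable_pot_component] measurable_bad[OF _ measurable_pot_component])
  have single: "(\<integral>\<^sup>+w. ennreal (Im (green a (pot w) N m (Complex e \<eta>))) * indicator {w. bad C N m e w} w \<partial>pot_space t) \<le>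
      ennreal (pi / (2 * t)) * ennreal (2 * p_bad C)" for e
  proof -
    have "(\<integral>\<^sup>+w. ennreal (Im (green a (pot w) N m (Complex e \<eta>))) * indicator {w. bad C N m e w} w \<partial>pot_space t) =
      (\<integral>\<^sup>+w. (\<integral>\<^sup>+s. ennreal (Im (green a (pot (w(m := s))) N m (Complex e \<eta>))) * indicator {w. bad C N m e w} (w(m := s)) \<partial>unif (2 * t)) \<partial>pot_space t)"
      by (rule pot_resample[OF t]) measurable
    also have "\<dots> \<le> (\<integral>\<^sup>+w. ennreal (pi / (2 * t)) * indicator {w. bad C N m e w} w \<partial>pot_space t)"
    proof (rule nn_integral_mono)
      fix w
      show "(\<integral>\<^sup>+s. ennreal (Im (green a (pot (w(m := s))) N m (Complex e \<eta>))) * indicator {w. bad C N m e w} (w(m := s)) \<partial>unif (2 * t)) \<le>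
          ennreal (pi / (2 * t)) * indicator {w. bad C N m e w} w"
        using green_average[OF m, of w "Complex e \<eta>"] by (cases "bad C N m e w") (auto simp: bad_upd[OF m])
    qed
    also have "\<dots> = ennreal (pi / (2 * t)) * (\<integral>\<^sup>+w. indicator {w. bad C N m e w} w \<partial>pot_space t)"
      by (rule nn_integral_cmult) measurable
    also have "\<dots> \<le> ennreal (pi / (2 * t)) * ennreal (2 * p_bad C)" by (intro mult_left_mono bad_prob C m) auto
    finally show ?thesis .
  qed
  have "(\<integral>\<^sup>+w. smeared_bad_weight C N m \<eta> w \<partial>pot_space t) =
     (\<integral>\<^sup>+w. (\<integral>\<^sup>+e. smeared_density C N m \<eta> (w, e) \<partial>lborel) \<partial>pot_space t)"
    unfolding smeared_bad_weight_def by (intro nn_integral_cong) (auto simp: indicator_def)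
  also have "\<dots> = (\<integral>\<^sup>+e. (\<integral>\<^sup>+w. smeared_density C N m \<eta> (w, e) \<partial>pot_space t) \<partial>lborel)"
    by (rule PL.Fubini[symmetric]) measurable
  also have "\<dots> = (\<integral>\<^sup>+e. (\<integral>\<^sup>+w. ennreal (Im (green a (pot w) N m (Complex e \<eta>))) * indicator {w. bad C N m e w} w \<partial>pot_space t) * indicator {- Rad<..<Rad} e \<partial>lborel)"
  proof (rule nn_integral_cong)
    fix e
    show "(\<integral>\<^sup>+w. smeared_density C N m \<eta> (w, e) \<partial>pot_space t) =
       (\<integral>\<^sup>+w. ennreal (Im (green a (pot w) N m (Complex e \<eta>))) * indicator {w. bad C N m e w} w \<partial>pot_space t) * indicator {- Rad<..<Rad} e"
      by (cases "\<bar>e\<bar> < Rad") (auto simp: indicator_def abs_less_iff)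
  qed
  also have "\<dots> \<le> (\<integral>\<^sup>+e. ennreal (pi / (2 * t)) * ennreal (2 * p_bad C) * indicator {- Rad<..<Rad} e \<partial>lborel)"
    by (intro nn_integral_mono mult_right_mono single) auto
  also have "\<dots> = ennreal (pi / (2 * t)) * ennreal (2 * p_bad C) * ennreal (2 * Rad)"
    using Rad_pos by (simp add: nn_integral_cmult_indicator)
  also have "\<dots> = ennreal (2 * Rad * (pi / (2 * t)) * (2 * p_bad C))"
  proof -
    have "ennreal x * ennreal y * ennreal z = ennreal (z * x * y)" if "x \<ge> 0" "y \<ge> 0" "z \<ge> 0" for x y z
      using that by (simp add: ennreal_mult mult_ac)
    thus ?thesis using t p_bad_nonneg[OF C] Rad_pos pi_ge_zero by simp
  qed
  finally show ?thesis .
qed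

end

section \<open>From smeared weights to the weights of bad eigenvectors\<close>

lemma continuous_on_chain_sol: "continuous_on UNIV (\<lambda>z::'a::real_normed_field. chain_sol \<alpha> \<beta> z i)"
proof (induction i rule: induct_nat_012)
  case (ge2 i)
  show ?case
    unfolding chain_sol.simps divide_inverse by (intro continuous_intros ge2)
qed auto

context random_jacobi
begin

abbreviation bad_weight ::
    "real \<Rightarrow> nat \<Rightarrow> int \<Rightarrow> (int \<Rightarrow> real) \<Rightarrow> (int \<Rightarrow> int \<Rightarrow> real) \<Rightarrow> (int \<Rightarrow> real) \<Rightarrow> real" where
  "bad_weight C N m w \<phi> E \<equiv> \<Sum>i\<in>{i\<in>sites N. bad C N m (E i) w}. (\<phi> i m)\<^sup>2"

text \<open>The defining inequalities are strict and the solutions continuous in the energy. Hence a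
  bad eigenvalue has a whole neighbourhood of bad energies, which the smeared measure can
  see.\<close>

lemma open_bad: "open {e. bad C N m e w}"
proof -
  have "{e. bad C N m e w} =
     (\<Union>i\<in>{1..lenR N m}. {e. C * \<rho> ^ (lenR N m - i) * \<bar>solR a (pot w) N e (lenR N m)\<bar> < \<bar>solR a (pot w) N e i\<bar>}) \<union>
     (\<Union>i\<in>{1..lenL N m}. {e. C * \<rho> ^ (lenL N m - i) * \<bar>solL a (pot w) N e (lenL N m)\<bar> < \<bar>solL a (pot w) N e i\<bar>})"
    by (auto simp: bad_def badR_def badL_def)
  also have "open \<dots>"
    unfolding solR_def solL_def
    by (intro open_Un open_UN ballI open_Collect_less continuous_intros continuous_on_chain_sol)
  finally show ?thesis .
qed

text \<open>The Poisson kernel is at least \<open>1 / (2 * \<eta>)\<close> on an interval of length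
  \<open>2 * \<eta>\<close> about each eigenvalue, so every weight is recovered in full.\<close>

lemma bad_weight_le_smeared:
  assumes m: "m \<in> sites N" and sys: "box_eigensystem a (pot w) N \<phi> E" and \<eta>: "\<eta> > 0"
    and S: "S \<subseteq> sites N"
    and ball: "\<And>i e. i \<in> S \<Longrightarrow> \<bar>e - E i\<bar> < \<eta> \<Longrightarrow> \<bar>e\<bar> < Rad \<and> bad C N m e w"
  shows "ennreal (\<Sum>i\<in>S. (\<phi> i m)\<^sup>2) \<le> smeared_bad_weight C N m \<eta> w"
proof -
  have fin: "finite S" using S by (rule finite_subset) simp
  have "ennreal (\<Sum>i\<in>S. (\<phi> i m)\<^sup>2) = (\<Sum>i\<in>S. ennreal ((\<phi> i m)\<^sup>2 / (2 * \<eta>)) * ennreal (2 * \<eta>))"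
    using \<eta> by (simp add: ennreal_mult[symmetric])
  also have "\<dots> = (\<Sum>i\<in>S. \<integral>\<^sup>+e. ennreal ((\<phi> i m)\<^sup>2 / (2 * \<eta>)) * indicator {E i - \<eta><..<E i + \<eta>} e \<partial>lborel)"
    using \<eta> by (intro sum.cong) (auto simp: nn_integral_cmult_indicator)
  also have "\<dots> = (\<integral>\<^sup>+e. (\<Sum>i\<in>S. ennreal ((\<phi> i m)\<^sup>2 / (2 * \<eta>)) * indicator {E i - \<eta><..<E i + \<eta>} e) \<partial>lborel)"
    by (rule nn_integral_sum[symmetric]) auto
  also have "\<dots> \<le> smeared_bad_weight C N m \<eta> w"
    unfolding smeared_bad_weight_def
  proof (rule nn_integral_mono)
    fix e
    show "(\<Sum>i\<in>S. ennreal ((\<phi> i m)\<^sup>2 / (2 * \<eta>)) * indicator {E i - \<eta><..<E i + \<eta>} e) \<le>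
       ennreal (Im (green a (pot w) N m (Complex e \<eta>))) * indicator {e. \<bar>e\<bar> < Rad \<and> bad C N m e w} e"
    proof (cases "\<bar>e\<bar> < Rad \<and> bad C N m e w")
      case True
      have nonneg: "0 \<le> (\<phi> i m)\<^sup>2 * (\<eta> / ((E i - e)\<^sup>2 + \<eta>\<^sup>2))" for i
        using \<eta> by (intro mult_nonneg_nonneg divide_nonneg_nonneg) auto
      have "(\<Sum>i\<in>S. ennreal ((\<phi> i m)\<^sup>2 / (2 * \<eta>)) * indicator {E i - \<eta><..<E i + \<eta>} e) \<le>
         (\<Sum>i\<in>S. ennreal ((\<phi> i m)\<^sup>2 * (\<eta> / ((E i - e)\<^sup>2 + \<eta>\<^sup>2))))"
      proof (rule sum_mono)
        fix i
        show "ennreal ((\<phi> i m)\<^sup>2 / (2 * \<eta>)) * indicator {E i - \<eta><..<E i + \<eta>} e \<le> ennreal ((\<phi> i m)\<^sup>2 * (\<eta> / ((E i - e)\<^sup>2 + \<eta>\<^sup>2)))"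
        proof (cases "e \<in> {E i - \<eta><..<E i + \<eta>}")
          case True
          hence "\<bar>E i - e\<bar> \<le> \<eta>" by auto
          hence "(E i - e)\<^sup>2 \<le> \<eta>\<^sup>2" using \<eta> by (simp add: abs_le_square_iff[symmetric])
          hence "\<eta> / (2 * \<eta>\<^sup>2) \<le> \<eta> / ((E i - e)\<^sup>2 + \<eta>\<^sup>2)" using \<eta> by (intro divide_left_mono) (auto simp: add_nonneg_pos)
          hence "1 / (2 * \<eta>) \<le> \<eta> / ((E i - e)\<^sup>2 + \<eta>\<^sup>2)" using \<eta> by (simp add: power2_eq_square)
          hence "(\<phi> i m)\<^sup>2 * (1 / (2 * \<eta>)) \<le> (\<phi> i m)\<^sup>2 * (\<eta> / ((E i - e)\<^sup>2 + \<eta>\<^sup>2))" by (intro mult_left_mono) auto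
          thus ?thesis using True by (auto intro: ennreal_leI)
        qed simp
      qed
      also have "\<dots> = ennreal (\<Sum>i\<in>S. (\<phi> i m)\<^sup>2 * (\<eta> / ((E i - e)\<^sup>2 + \<eta>\<^sup>2)))"
        using nonneg by (intro sum_ennreal) auto
      also have "\<dots> \<le> ennreal (\<Sum>i\<in>sites N. (\<phi> i m)\<^sup>2 * (\<eta> / ((E i - e)\<^sup>2 + \<eta>\<^sup>2)))"
        using nonneg S by (intro ennreal_leI sum_mono2) auto
      also have "\<dots> = ennreal (Im (green a (pot w) N m (Complex e \<eta>)))"
        using Im_green_eq_poisson_sum[OF a_pos m sys \<eta>] by simp
      finally show ?thesis using True by simp
    next
      case False
      hence "e \<notin> {E i - \<eta><..<E i + \<eta>}" if "i \<in> S" for i using ball[OF that, of e] by (auto simp: abs_less_iff)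
      thus ?thesis by (simp add: sum.neutral)
    qed
  qed
  finally show ?thesis .
qed

abbreviation liminf_bad_weight :: "real \<Rightarrow> nat \<Rightarrow> int \<Rightarrow> (int \<Rightarrow> real) \<Rightarrow> ennreal" where
  "liminf_bad_weight C N m w \<equiv> liminf (\<lambda>k. smeared_bad_weight C N m (1 / real (Suc k)) w)"

text \<open>A box has finitely many eigenvalues, so all sufficiently small \<open>\<eta>\<close>
  serve every bad one at once. The limit inferior stays measurable and suits Fatou.\<close>

lemma bad_weight_le_liminf:
  assumes m: "m \<in> sites N" and sys: "box_eigensystem a (pot w) N \<phi> E" and w: "\<And>n. w n \<in> {0..2 * t}"
  shows "ennreal (bad_weight C N m w \<phi> E) \<le>
     liminf_bad_weight C N m w"
proof (rule Liminf_bounded)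
  define S where "S = {i\<in>sites N. bad C N m (E i) w}"
  have finS: "finite S" unfolding S_def by (rule finite_subset[of _ "sites N"]) auto
  have lim: "(\<lambda>k. 1 / real (Suc k)) \<longlonglongrightarrow> 0"
    using LIMSEQ_inverse_real_of_nat by (simp add: divide_inverse)
  have "\<forall>i\<in>S. eventually (\<lambda>k. \<forall>e. \<bar>e - E i\<bar> < 1 / real (Suc k) \<longrightarrow> \<bar>e\<bar> < Rad \<and> bad C N m e w) sequentially"
  proof
    fix i assume i: "i \<in> S"
    have "\<bar>pot w n\<bar> \<le> B + 2 * t" for n using w[of n] b_le[of n] by (auto simp: pot_def)
    hence "\<bar>E i\<bar> \<le> 2 * A + (B + 2 * t)"
      using i a_pos a_le by (intro box_eigenvalue_bound[OF sys]) (auto simp: S_def abs_of_pos)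
    hence "E i \<in> {e. \<bar>e\<bar> < Rad} \<inter> {e. bad C N m e w}" using i by (auto simp: S_def Rad_def)
    moreover have "open ({e. \<bar>e\<bar> < Rad} \<inter> {e. bad C N m e w})"
      by (intro open_Int open_bad open_Collect_less continuous_intros)
    ultimately obtain d where d: "d > 0" "ball (E i) d \<subseteq> {e. \<bar>e\<bar> < Rad} \<inter> {e. bad C N m e w}"
      by (meson open_contains_ball)
    have "eventually (\<lambda>k. 1 / real (Suc k) < d) sequentially" by (rule order_tendstoD(2)[OF lim d(1)])
    thus "eventually (\<lambda>k. \<forall>e. \<bar>e - E i\<bar> < 1 / real (Suc k) \<longrightarrow> \<bar>e\<bar> < Rad \<and> bad C N m e w) sequentially"
    proof eventually_elim
      case (elim k)
      show ?case
      proof (intro allI impI)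
        fix e assume "\<bar>e - E i\<bar> < 1 / real (Suc k)"
        hence "e \<in> ball (E i) d" using elim by (simp add: dist_real_def abs_minus_commute)
        thus "\<bar>e\<bar> < Rad \<and> bad C N m e w" using d by blast
      qed
    qed
  qed
  hence "eventually (\<lambda>k. \<forall>i\<in>S. \<forall>e. \<bar>e - E i\<bar> < 1 / real (Suc k) \<longrightarrow> \<bar>e\<bar> < Rad \<and> bad C N m e w) sequentially"
    by (rule eventually_ball_finite[OF finS])
  thus "eventually (\<lambda>k. ennreal (bad_weight C N m w \<phi> E) \<le> smeared_bad_weight C N m (1 / real (Suc k)) w) sequentially"
    unfolding S_def[symmetric]
    by eventually_elim (rule bad_weight_le_smeared[OF m sys], auto simp: S_def)
qed

lemma p_bad_tendsto: "(\<lambda>n. p_bad (real (Suc n))) \<longlonglongrightarrow> 0"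
proof -
  have lim: "(\<lambda>k. 1 / real (Suc k)) \<longlonglongrightarrow> 0"
    using LIMSEQ_inverse_real_of_nat by (simp add: divide_inverse)
  have "(\<lambda>k. (1 / t) * (1 / real (Suc k)) + A / (sqrt t * \<rho> ^ 4 * (1 - \<rho>)) * sqrt (1 / real (Suc k))) \<longlonglongrightarrow>
     (1 / t) * 0 + A / (sqrt t * \<rho> ^ 4 * (1 - \<rho>)) * sqrt 0"
    by (intro tendsto_intros lim)
  moreover have "p_bad (real (Suc k)) = (1 / t) * (1 / real (Suc k)) + A / (sqrt t * \<rho> ^ 4 * (1 - \<rho>)) * sqrt (1 / real (Suc k))" for k
    unfolding p_bad_def by (simp add: real_sqrt_mult real_sqrt_divide)
  ultimately show ?thesis by simp
qed

text \<open>Fatou is applied to the box size and to the smearing width, and the resulting bound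
  tends to 0 as \<open>C\<close> grows. Weights are small only along infinitely many boxes, but with
  one \<open>C\<close> for all of them.\<close>

lemma AE_frequently_small_bad_weight:
  "AE w in pot_space t. \<forall>\<kappa>>0. \<exists>C\<ge>1. \<forall>N0. \<exists>N\<ge>N0. m \<in> sites N \<and>
     liminf_bad_weight C N m w < ennreal \<kappa>"
proof -
  define N' where "N' N = N + nat \<bar>m\<bar>" for N
  have m: "m \<in> sites (N' N)" for N by (auto simp: N'_def)
  define \<Phi> where "\<Phi> n w = liminf (\<lambda>N. liminf_bad_weight (real (Suc n)) (N' N) m w)" for n w
  have [measurable]: "\<Phi> n \<in> borel_measurable (pot_space t)" for n unfolding \<Phi>_def by measurable
  define K where "K = 2 * Rad * (pi / (2 * t)) * 2"
  have bound: "(\<integral>\<^sup>+w. \<Phi> n w \<partial>pot_space t) \<le> ennreal (K * p_bad (real (Suc n)))" for n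
  proof -
    have liminf_le: "liminf u \<le> c" if "\<And>k. u k \<le> c" for u :: "nat \<Rightarrow> ennreal" and c
      using Liminf_mono[of u "\<lambda>_. c" sequentially] that by (simp add: Liminf_const)
    have "(\<integral>\<^sup>+w. \<Phi> n w \<partial>pot_space t) \<le>
       liminf (\<lambda>N. \<integral>\<^sup>+w. liminf_bad_weight (real (Suc n)) (N' N) m w \<partial>pot_space t)"
      unfolding \<Phi>_def by (rule nn_integral_liminf) measurable
    also have "\<dots> \<le> ennreal (K * p_bad (real (Suc n)))"
    proof (rule liminf_le)
      fix N
      have "(\<integral>\<^sup>+w. liminf_bad_weight (real (Suc n)) (N' N) m w \<partial>pot_space t) \<le>
         liminf (\<lambda>k. \<integral>\<^sup>+w. smeared_bad_weight (real (Suc n)) (N' N) m (1 / real (Suc k)) w \<partial>pot_space t)"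
        by (rule nn_integral_liminf) measurable
      also have "\<dots> \<le> ennreal (K * p_bad (real (Suc n)))"
      proof (rule liminf_le)
        fix k
        show "(\<integral>\<^sup>+w. smeared_bad_weight (real (Suc n)) (N' N) m (1 / real (Suc k)) w \<partial>pot_space t) \<le> ennreal (K * p_bad (real (Suc n)))"
          using smeared_bad_weight_expectation[OF _ m, of "real (Suc n)"] unfolding K_def by (simp add: mult.assoc)
      qed
      finally show "(\<integral>\<^sup>+w. liminf_bad_weight (real (Suc n)) (N' N) m w \<partial>pot_space t) \<le> ennreal (K * p_bad (real (Suc n)))" .
    qed
    finally show ?thesis .
  qed
  have "(\<integral>\<^sup>+w. (INF n. \<Phi> n w) \<partial>pot_space t) \<le> ennreal (K * p_bad (real (Suc n)))" for n
    by (rule order_trans[OF nn_integral_mono bound[of n]]) (auto intro: INF_lower)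
  moreover have "(\<lambda>n. ennreal (K * p_bad (real (Suc n)))) \<longlonglongrightarrow> ennreal (K * 0)"
    by (intro tendsto_intros p_bad_tendsto)
  ultimately have "(\<integral>\<^sup>+w. (INF n. \<Phi> n w) \<partial>pot_space t) \<le> ennreal (K * 0)"
    by (intro LIMSEQ_le_const) auto
  hence "(\<integral>\<^sup>+w. (INF n. \<Phi> n w) \<partial>pot_space t) = 0" by simp
  hence "AE w in pot_space t. (INF n. \<Phi> n w) = 0" by (subst (asm) nn_integral_0_iff_AE) auto
  thus ?thesis
  proof eventually_elim
    case (elim w)
    show ?case
    proof (intro allI impI)
      fix \<kappa> :: real assume "\<kappa> > 0"
      hence "(INF n. \<Phi> n w) < ennreal \<kappa>" using elim by simp
      then obtain n where n: "\<Phi> n w < ennreal \<kappa>" by (auto simp: INF_less_iff)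
      have "\<exists>N\<ge>N0. m \<in> sites N \<and> liminf_bad_weight (real (Suc n)) N m w < ennreal \<kappa>" for N0
      proof (rule ccontr)
        assume contra: "\<not> ?thesis"
        have "ennreal \<kappa> \<le> \<Phi> n w"
          unfolding \<Phi>_def
        proof (rule Liminf_bounded, rule eventually_sequentiallyI)
          fix N assume "N \<ge> N0"
          hence "N' N \<ge> N0" by (simp add: N'_def)
          thus "ennreal \<kappa> \<le> liminf_bad_weight (real (Suc n)) (N' N) m w"
            using contra m[of N] by (meson not_less)
        qed
        thus False using n by simp
      qed
      thus "\<exists>C\<ge>1. \<forall>N0. \<exists>N\<ge>N0. m \<in> sites N \<and> liminf_bad_weight C N m w < ennreal \<kappa>"
        by (intro exI[of _ "real (Suc n)"]) auto
    qed
  qed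
qed

text \<open>\<open>C\<close> is chosen before the boxes: a common envelope is what survives the
  limit. All eigensystems of a box are covered, so any of them may be picked later.\<close>

abbreviation localizing :: "(int \<Rightarrow> real) \<Rightarrow> bool" where
  "localizing w \<equiv> \<forall>m. \<forall>\<kappa>>0. \<exists>C\<ge>1. \<forall>N0. \<exists>N\<ge>N0. m \<in> sites N \<and>
     (\<forall>\<phi> E. box_eigensystem a (pot w) N \<phi> E \<longrightarrow> bad_weight C N m w \<phi> E < \<kappa>)"

theorem ex_localizing_potential:
  "\<exists>w. (\<forall>n. w n \<in> {0..2 * t}) \<and> localizing w"
proof -
  interpret P: prob_space "pot_space t" by (rule prob_space_pot[OF t])
  have "AE w in pot_space t. w n \<in> {0..2 * t}" for n
  proof (rule AE_PiM_component)
    show "prob_space (unif (2 * t))" using t by (intro prob_space_unif) auto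
    show "AE x in unif (2 * t). x \<in> {0..2 * t}" using t by (intro AE_uniform_measureI) auto
  qed auto
  hence "AE w in pot_space t. \<forall>n. w n \<in> {0..2 * t}" by (subst AE_all_countable) simp
  moreover have "AE w in pot_space t. \<forall>m. \<forall>\<kappa>>0. \<exists>C\<ge>1. \<forall>N0. \<exists>N\<ge>N0. m \<in> sites N \<and>
     liminf_bad_weight C N m w < ennreal \<kappa>"
    using AE_frequently_small_bad_weight by (subst AE_all_countable) simp
  ultimately have "AE w in pot_space t. (\<forall>n. w n \<in> {0..2 * t}) \<and> (\<forall>m. \<forall>\<kappa>>0. \<exists>C\<ge>1. \<forall>N0. \<exists>N\<ge>N0. m \<in> sites N \<and>
     liminf_bad_weight C N m w < ennreal \<kappa>)"
    by eventually_elim blast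
  hence "\<exists>w. (\<forall>n. w n \<in> {0..2 * t}) \<and> (\<forall>m. \<forall>\<kappa>>0. \<exists>C\<ge>1. \<forall>N0. \<exists>N\<ge>N0. m \<in> sites N \<and>
     liminf_bad_weight C N m w < ennreal \<kappa>)"
    by (rule eventually_happens'[OF P.ae_filter_bot])
  then obtain w where w: "\<forall>n. w n \<in> {0..2 * t}" and small: "\<forall>m. \<forall>\<kappa>>0. \<exists>C\<ge>1. \<forall>N0. \<exists>N\<ge>N0. m \<in> sites N \<and>
     liminf_bad_weight C N m w < ennreal \<kappa>"
    by blast
  have weight: "bad_weight C N m w \<phi> E < \<kappa>"
    if "m \<in> sites N" "liminf_bad_weight C N m w < ennreal \<kappa>"
      "box_eigensystem a (pot w) N \<phi> E" for \<kappa> C N m \<phi> E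
  proof -
    have "ennreal (bad_weight C N m w \<phi> E) < ennreal \<kappa>"
      by (rule le_less_trans[OF bad_weight_le_liminf[OF that(1,3)] that(2)]) (use w in blast)
    thus ?thesis by (simp add: ennreal_less_iff sum_nonneg)
  qed
  show ?thesis
  proof (intro exI[of _ w] conjI w allI impI)
    fix m and \<kappa> :: real assume "\<kappa> > 0"
    then obtain C where C: "C \<ge> 1" "\<forall>N0. \<exists>N\<ge>N0. m \<in> sites N \<and>
       liminf_bad_weight C N m w < ennreal \<kappa>" using small by blast
    have "\<exists>N\<ge>N0. m \<in> sites N \<and> (\<forall>\<phi> E. box_eigensystem a (pot w) N \<phi> E \<longrightarrow>
        bad_weight C N m w \<phi> E < \<kappa>)" for N0
      using C(2) weight by meson
    thus "\<exists>C\<ge>1. \<forall>N0. \<exists>N\<ge>N0. m \<in> sites N \<and> (\<forall>\<phi> E. box_eigensystem a (pot w) N \<phi> E \<longrightarrow>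
        bad_weight C N m w \<phi> E < \<kappa>)" using C(1) by blast
  qed
qed

text \<open>On each side of \<open>m\<close> the eigenvector is a multiple of the end solution at
  its own energy, and badness does not depend on such a multiple.\<close>

lemma not_bad_imp_envelope:
  assumes m: "m \<in> sites N" and sys: "box_eigensystem a (pot w) N \<phi> E" and i: "i \<in> sites N"
    and good: "\<not> bad C N m (E i) w" and C: "C \<ge> 1"
  shows "\<bar>\<phi> i n\<bar> \<le> C * \<rho> ^ nat \<bar>n - m\<bar> * \<bar>\<phi> i m\<bar>"
proof (cases "n \<in> sites N")
  case False
  hence "\<phi> i n = 0" using sys unfolding box_eigensystem_def by blast
  thus ?thesis using C \<rho> by simp
next
  case n: True
  have zero: "\<phi> i n = 0" if "n \<notin> sites N" for n using sys that unfolding box_eigensystem_def by blast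
  have eqn: "jac_of_real a (pot w) (\<phi> i) n = E i * \<phi> i n" if "n \<in> sites N" for n
    using sys i that unfolding box_eigensystem_def by simp
  have m': "- int N \<le> m" "m \<le> int N" using m by auto
  show ?thesis
  proof (cases "n \<ge> m")
    case True
    have R: "\<phi> i (siteR N k) = \<phi> i (int N) * solR a (pot w) N (E i) k" if "int k \<le> int N + 1 - m" for k
      by (rule solR_propagate[OF a_pos m' _ _ that]) (use m' in \<open>auto intro!: zero eqn[unfolded of_real_eq_id id_apply]\<close>)
    define k where "k = nat (int N + 1 - n)"
    have k: "siteR N k = n" "siteR N (lenR N m) = m" "k \<in> {1..lenR N m}" "int k \<le> int N + 1 - m" "lenR N m - k = nat \<bar>n - m\<bar>"
      using n m' True by (auto simp: k_def siteR_def lenR_def)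
    have "\<bar>solR a (pot w) N (E i) k\<bar> \<le> C * \<rho> ^ (lenR N m - k) * \<bar>solR a (pot w) N (E i) (lenR N m)\<bar>"
      using good k(3) unfolding bad_def badR_def by (auto simp: not_less)
    hence "\<bar>\<phi> i (int N)\<bar> * \<bar>solR a (pot w) N (E i) k\<bar> \<le> \<bar>\<phi> i (int N)\<bar> * (C * \<rho> ^ (lenR N m - k) * \<bar>solR a (pot w) N (E i) (lenR N m)\<bar>)"
      by (rule mult_left_mono) auto
    thus ?thesis using R[OF k(4)] R[of "lenR N m"] m' unfolding k(1,2,5) by (simp add: abs_mult lenR_def mult_ac)
  next
    case False
    have L: "\<phi> i (siteL N k) = \<phi> i (- int N) * solL a (pot w) N (E i) k" if "int k \<le> m + int N + 1" for k
      by (rule solL_propagate[OF a_pos m' _ _ that]) (use m' in \<open>auto intro!: zero eqn[unfolded of_real_eq_id id_apply]\<close>)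
    define k where "k = nat (n + int N + 1)"
    have k: "siteL N k = n" "siteL N (lenL N m) = m" "k \<in> {1..lenL N m}" "int k \<le> m + int N + 1" "lenL N m - k = nat \<bar>n - m\<bar>"
      using n m' False by (auto simp: k_def siteL_def lenL_def)
    have "\<bar>solL a (pot w) N (E i) k\<bar> \<le> C * \<rho> ^ (lenL N m - k) * \<bar>solL a (pot w) N (E i) (lenL N m)\<bar>"
      using good k(3) unfolding bad_def badL_def by (auto simp: not_less)
    hence "\<bar>\<phi> i (- int N)\<bar> * \<bar>solL a (pot w) N (E i) k\<bar> \<le> \<bar>\<phi> i (- int N)\<bar> * (C * \<rho> ^ (lenL N m - k) * \<bar>solL a (pot w) N (E i) (lenL N m)\<bar>)"
      by (rule mult_left_mono) auto
    thus ?thesis using L[OF k(4)] L[of "lenL N m"] m' unfolding k(1,2,5) by (simp add: abs_mult lenL_def mult_ac)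
  qed
qed

end

section \<open>Passage to the whole line\<close>

lemma summable_on_int_geometric:
  fixes q :: real
  assumes q: "0 \<le> q" "q < 1"
  shows "(\<lambda>n::int. q ^ nat \<bar>n - m\<bar>) summable_on UNIV"
proof -
  have geo: "(\<lambda>k::nat. q ^ (k + j)) summable_on UNIV" for j
    using q by (intro summable_nonneg_imp_summable_on) (auto simp: power_add intro!: summable_mult2 summable_geometric)
  have "(\<lambda>n::int. q ^ nat \<bar>n\<bar>) summable_on range int"
    using geo[of 0] by (subst summable_on_reindex) (auto simp: o_def)
  moreover have "(\<lambda>n::int. q ^ nat \<bar>n\<bar>) summable_on range (\<lambda>k::nat. - int k - 1)"
  proof (subst summable_on_reindex)
    have "(\<lambda>n::int. q ^ nat \<bar>n\<bar>) \<circ> (\<lambda>k::nat. - int k - 1) = (\<lambda>k. q ^ (k + 1))"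
      by (auto simp: fun_eq_iff nat_add_distrib intro!: arg_cong[where f = "\<lambda>k. q ^ k"])
    thus "((\<lambda>n::int. q ^ nat \<bar>n\<bar>) \<circ> (\<lambda>k::nat. - int k - 1)) summable_on UNIV" using geo[of 1] by simp
  qed (auto simp: inj_on_def)
  ultimately have "(\<lambda>n::int. q ^ nat \<bar>n\<bar>) summable_on (range int \<union> range (\<lambda>k::nat. - int k - 1))"
    by (intro summable_on_Un_disjoint) auto
  moreover have "range int \<union> range (\<lambda>k::nat. - int k - 1) = UNIV"
  proof -
    have "n \<in> range int \<union> range (\<lambda>k::nat. - int k - 1)" for n :: int
    proof (cases "n \<ge> 0")
      case True thus ?thesis by (auto intro!: image_eqI[of _ _ "nat n"])
    next
      case False thus ?thesis by (intro UnI2 image_eqI[of _ _ "nat (- n - 1)"]) auto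
    qed
    thus ?thesis by blast
  qed
  ultimately have "(\<lambda>n::int. q ^ nat \<bar>n\<bar>) summable_on UNIV" by simp
  moreover have "bij_betw (\<lambda>n::int. n - m) UNIV UNIV"
    by (rule bij_betw_byWitness[where f' = "\<lambda>n. n + m"]) auto
  ultimately show ?thesis
    using summable_on_reindex_bij_betw[of "\<lambda>n::int. n - m" UNIV UNIV "\<lambda>n. q ^ nat \<bar>n\<bar>"] by simp
qed

text \<open>Sums over the integers are treated as integrals for counting measure.\<close>

lemma infsum_dominated_convergence:
  fixes f :: "nat \<Rightarrow> int \<Rightarrow> complex"
  assumes lim: "\<And>n. (\<lambda>k. f k n) \<longlonglongrightarrow> g n" and bound: "\<And>k n. norm (f k n) \<le> Q n"
    and Q: "Q summable_on UNIV"
  shows "(\<lambda>k. \<Sum>\<^sub>\<infinity>n. f k n) \<longlonglongrightarrow> (\<Sum>\<^sub>\<infinity>n. g n)"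
proof -
  have Q_nonneg: "Q n \<ge> 0" for n using bound[of 0 n] norm_ge_zero order_trans by blast
  have g_bound: "norm (g n) \<le> Q n" for n
    by (rule LIMSEQ_le_const2[OF tendsto_norm[OF lim]]) (use bound in auto)
  have Qi: "integrable (count_space UNIV) Q"
    using Q Q_nonneg abs_summable_equivalent[of Q UNIV] by (simp add: abs_summable_on_def set_integrable_def)
  have abs: "Infinite_Set_Sum.abs_summable_on h UNIV" if "\<And>n. norm (h n) \<le> Q n" for h :: "int \<Rightarrow> complex"
    unfolding abs_summable_on_def set_integrable_def
    by (rule Bochner_Integration.integrable_bound[OF Qi]) (use that Q_nonneg in auto)
  have eq: "(\<Sum>\<^sub>\<infinity>n. h n) = (\<integral>n. h n \<partial>count_space UNIV)" if "\<And>n. norm (h n) \<le> Q n" for h :: "int \<Rightarrow> complex"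
    using infsetsum_infsum[OF abs[OF that]] by (simp add: infsetsum_def)
  have "(\<lambda>k. \<integral>n. f k n \<partial>count_space UNIV) \<longlonglongrightarrow> (\<integral>n. g n \<partial>count_space UNIV)"
    by (rule integral_dominated_convergence[OF _ _ Qi]) (use lim bound in auto)
  thus ?thesis using eq[of g] eq[of "f _"] g_bound bound by simp
qed

lemma exp_decaying_geometric:
  assumes \<rho>: "0 < \<rho>" "\<rho> < 1" and K: "K > 0" and bound: "\<And>n. norm (u n) \<le> K * \<rho> ^ nat \<bar>n - m\<bar>"
  shows "exp_decaying u"
proof -
  have pos: "K * \<rho> powr (- of_int \<bar>m\<bar>) > 0" "- ln \<rho> > 0" using K \<rho> by auto
  have "norm (u n) \<le> K * \<rho> powr (- of_int \<bar>m\<bar>) * exp (- (- ln \<rho>) * of_int \<bar>n\<bar>)" for n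
  proof -
    have "norm (u n) \<le> K * \<rho> ^ nat \<bar>n - m\<bar>" by (rule bound)
    also have "\<rho> ^ nat \<bar>n - m\<bar> = \<rho> powr of_int \<bar>n - m\<bar>" using \<rho> by (simp add: powr_realpow[symmetric])
    \<comment> \<open>Recentring from \<open>m\<close> to 0 by the triangle inequality; the base is
      below 1.\<close>
    also have "\<dots> \<le> \<rho> powr (of_int \<bar>n\<bar> - of_int \<bar>m\<bar>)" using \<rho> by (intro powr_mono') auto
    also have "\<dots> = \<rho> powr (- of_int \<bar>m\<bar>) * exp (- (- ln \<rho>) * of_int \<bar>n\<bar>)"
      using \<rho> by (simp add: powr_def exp_add[symmetric] algebra_simps)
    finally show ?thesis
      using K by (simp add: mult.assoc mult_left_mono)
  qed
  thus ?thesis unfolding exp_decaying_def using pos by blast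
qed

lemma in_l2_bounded:
  assumes "in_l2 v"
  shows "norm (v n) \<le> sqrt (\<Sum>\<^sub>\<infinity>n. (norm (v n))\<^sup>2)"
proof (rule real_le_rsqrt)
  have "(\<Sum>k\<in>{n}. (norm (v k))\<^sup>2) \<le> (\<Sum>\<^sub>\<infinity>n. (norm (v n))\<^sup>2)"
    using assms by (intro finite_sum_le_infsum) (auto simp: in_l2_def)
  thus "(norm (v n))\<^sup>2 \<le> (\<Sum>\<^sub>\<infinity>n. (norm (v n))\<^sup>2)" by simp
qed

lemma box_expansion:
  fixes v :: "int \<Rightarrow> complex"
  assumes sys: "box_eigensystem a \<beta> N \<phi> E" and m: "m \<in> sites N"
  defines "c \<equiv> \<lambda>i. \<Sum>n\<in>sites N. of_real (\<phi> i n) * v n"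
  shows "v m = (\<Sum>i\<in>sites N. of_real (\<phi> i m) * c i)"
    and "(\<Sum>i\<in>sites N. (norm (c i))\<^sup>2) = (\<Sum>n\<in>sites N. (norm (v n))\<^sup>2)"
proof -
  have orth: "(\<Sum>i\<in>sites N. \<phi> i m * \<phi> i n) = (if m = n then 1 else 0)" if "m \<in> sites N" "n \<in> sites N" for m n
    using sys that unfolding box_eigensystem_def by blast
  have exp: "v m = (\<Sum>i\<in>sites N. of_real (\<phi> i m) * c i)" if m: "m \<in> sites N" for m
  proof -
    have "(\<Sum>i\<in>sites N. of_real (\<phi> i m) * c i) = (\<Sum>n\<in>sites N. of_real (\<Sum>i\<in>sites N. \<phi> i m * \<phi> i n) * v n)"
      unfolding c_def of_real_sum sum_distrib_left sum_distrib_right by (subst sum.swap) (simp add: mult.assoc)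
    also have "\<dots> = (\<Sum>n\<in>sites N. if n = m then v n else 0)" using m orth by (intro sum.cong) auto
    also have "\<dots> = v m" using m by simp
    finally show ?thesis by simp
  qed
  show "v m = (\<Sum>i\<in>sites N. of_real (\<phi> i m) * c i)" by (rule exp[OF m])
  have "of_real (\<Sum>n\<in>sites N. (norm (v n))\<^sup>2) = (\<Sum>n\<in>sites N. cnj (v n) * v n)"
    unfolding of_real_sum complex_norm_square by (simp add: mult.commute)
  also have "\<dots> = (\<Sum>n\<in>sites N. cnj (v n) * (\<Sum>i\<in>sites N. of_real (\<phi> i n) * c i))"
    by (intro sum.cong refl) (subst (2) exp, auto)
  also have "\<dots> = (\<Sum>i\<in>sites N. cnj (c i) * c i)"
    unfolding sum_distrib_left by (subst sum.swap) (simp add: c_def sum_distrib_right sum_distrib_left mult_ac)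
  also have "\<dots> = of_real (\<Sum>i\<in>sites N. (norm (c i))\<^sup>2)"
    unfolding of_real_sum complex_norm_square by (simp add: mult.commute)
  finally have "complex_of_real (\<Sum>n\<in>sites N. (norm (v n))\<^sup>2) = of_real (\<Sum>i\<in>sites N. (norm (c i))\<^sup>2)" .
  thus "(\<Sum>i\<in>sites N. (norm (c i))\<^sup>2) = (\<Sum>n\<in>sites N. (norm (v n))\<^sup>2)" by (simp only: of_real_eq_iff)
qed

text \<open>Square integrability follows from the decay. The energy is real and explicit because
  orthogonality and simplicity are argued energy by energy.\<close>

definition localized_eigenfunction :: "(int \<Rightarrow> real) \<Rightarrow> (int \<Rightarrow> real) \<Rightarrow> real \<Rightarrow> (int \<Rightarrow> complex) \<Rightarrow> bool" where
  "localized_eigenfunction a \<beta> E u \<longleftrightarrow> exp_decaying u \<and> u \<noteq> (\<lambda>_. 0) \<and> jacobi a \<beta> u = (\<lambda>n. of_real E * u n)"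

text \<open>Compactness of the unit cube and of the energy range gives pointwise convergence along a
  subsequence. \<open>low\<close> keeps the limit from vanishing at \<open>m\<close>;
  \<open>env\<close> passes to the limit and dominates the sums against \<open>v\<close>, so the
  lower bound \<open>\<theta>\<close> survives.\<close>

lemma box_eigenfunctions_limit:
  fixes f :: "nat \<Rightarrow> int \<Rightarrow> real" and e :: "nat \<Rightarrow> real" and Ns :: "nat \<Rightarrow> nat" and v :: "int \<Rightarrow> complex"
  assumes \<rho>: "0 < \<rho>" "\<rho> < 1" and C: "C > 0" and W: "W > 0"
    and Ns: "\<And>k. Ns k \<ge> k"
    and zero: "\<And>k n. n \<notin> sites (Ns k) \<Longrightarrow> f k n = 0"
    and eqn: "\<And>k n. n \<in> sites (Ns k) \<Longrightarrow> jac a \<beta> (f k) n = e k * f k n"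
    and bound1: "\<And>k n. \<bar>f k n\<bar> \<le> 1" and e: "\<And>k. \<bar>e k\<bar> \<le> R"
    and env: "\<And>k n. \<bar>f k n\<bar> \<le> C * \<rho> ^ nat \<bar>n - m\<bar> * \<bar>f k m\<bar>" and low: "\<And>k. 1 \<le> W * (f k m)\<^sup>2"
    and v: "in_l2 v" and \<theta>: "\<And>k. norm (\<Sum>n\<in>sites (Ns k). of_real (f k n) * v n) \<ge> \<theta>"
  shows "\<exists>E u. localized_eigenfunction a \<beta> E u \<and> norm (l2_inner u v) \<ge> \<theta>"
proof -
  have "compact ({f :: int \<Rightarrow> real. \<forall>p. f p \<in> {-1..1}} \<times> {- R..R})"
    by (intro compact_Times compact_unit_cube_fun) auto
  hence "seq_compact ({f :: int \<Rightarrow> real. \<forall>p. f p \<in> {-1..1}} \<times> {- R..R})"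
    by (simp add: compact_eq_seq_compact_metric)
  moreover have "\<forall>k. (f k, e k) \<in> {f :: int \<Rightarrow> real. \<forall>p. f p \<in> {-1..1}} \<times> {- R..R}"
    using bound1 e by (auto simp: abs_le_iff minus_le_iff)
  ultimately obtain l s where s: "strict_mono s" and lim: "((\<lambda>k. (f k, e k)) \<circ> s) \<longlonglongrightarrow> l"
    by (rule seq_compactE)
  define g E where "g = fst l" and "E = snd l"
  have "(\<lambda>k. f (s k)) \<longlonglongrightarrow> g" using tendsto_fst[OF lim] by (simp add: o_def g_def)
  hence lim_f: "(\<lambda>k. f (s k) n) \<longlonglongrightarrow> g n" for n
    using continuous_on_tendsto_compose[OF continuous_on_product_coordinates[of n]] by auto
  have lim_e: "(\<lambda>k. e (s k)) \<longlonglongrightarrow> E" using tendsto_snd[OF lim] by (simp add: o_def E_def)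
  have s_ge: "s k \<ge> k" for k using s by (rule seq_suble)
  have env_g: "\<bar>g n\<bar> \<le> C * \<rho> ^ nat \<bar>n - m\<bar> * \<bar>g m\<bar>" for n
    by (rule LIMSEQ_le[OF tendsto_rabs[OF lim_f] tendsto_mult_left[OF tendsto_rabs[OF lim_f]]]) (use env in auto)
  have "1 \<le> W * (g m)\<^sup>2"
    by (rule LIMSEQ_le_const[OF tendsto_mult_left[OF tendsto_power[OF lim_f]]]) (use low in auto)
  hence gm: "g m \<noteq> 0" by auto
  have eq_g: "jac a \<beta> g n = E * g n" for n
  proof (rule LIMSEQ_unique)
    show "(\<lambda>k. jac a \<beta> (f (s k)) n) \<longlonglongrightarrow> jac a \<beta> g n"
      by (intro tendsto_intros lim_f)
    \<comment> \<open>The equation at a fixed \<open>n\<close> holds as soon as the box contains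
      \<open>n\<close>.\<close>
    have "eventually (\<lambda>k. e (s k) * f (s k) n = jac a \<beta> (f (s k)) n) sequentially"
    proof (rule eventually_sequentiallyI[of "nat \<bar>n\<bar>"])
      fix k assume "k \<ge> nat \<bar>n\<bar>"
      hence "n \<in> sites (Ns (s k))" using s_ge[of k] Ns[of "s k"] by auto
      thus "e (s k) * f (s k) n = jac a \<beta> (f (s k)) n" using eqn by simp
    qed
    moreover have "(\<lambda>k. e (s k) * f (s k) n) \<longlonglongrightarrow> E * g n" by (intro tendsto_intros lim_f lim_e)
    ultimately show "(\<lambda>k. jac a \<beta> (f (s k)) n) \<longlonglongrightarrow> E * g n"
      by (rule Lim_transform_eventually[rotated])
  qed
  define u where "u n = complex_of_real (g n)" for n
  have "exp_decaying u"
  proof (rule exp_decaying_geometric[OF \<rho>])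
    show "C * \<bar>g m\<bar> > 0" using C gm by simp
    show "norm (u n) \<le> C * \<bar>g m\<bar> * \<rho> ^ nat \<bar>n - m\<bar>" for n using env_g[of n] by (simp add: u_def mult_ac)
  qed
  moreover have "u \<noteq> (\<lambda>_. 0)" using gm by (auto simp: u_def fun_eq_iff)
  moreover have "jacobi a \<beta> u = (\<lambda>n. of_real E * u n)"
  proof
    fix n
    have "jacobi a \<beta> u n = of_real (jac a \<beta> g n)" by (simp add: jacobi_def u_def)
    thus "jacobi a \<beta> u n = of_real E * u n" by (simp only: eq_g) (simp add: u_def)
  qed
  moreover have "norm (l2_inner u v) \<ge> \<theta>"
  proof -
    define V where "V = sqrt (\<Sum>\<^sub>\<infinity>n. (norm (v n))\<^sup>2)"
    have vV: "norm (v n) \<le> V" for n unfolding V_def by (rule in_l2_bounded[OF v])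
    have "(\<lambda>k. \<Sum>\<^sub>\<infinity>n. of_real (f (s k) n) * v n) \<longlonglongrightarrow> (\<Sum>\<^sub>\<infinity>n. of_real (g n) * v n)"
    proof (rule infsum_dominated_convergence)
      show "(\<lambda>k. of_real (f (s k) n) * v n) \<longlonglongrightarrow> of_real (g n) * v n" for n by (intro tendsto_intros lim_f)
      show "norm (of_real (f (s k) n) * v n) \<le> C * \<rho> ^ nat \<bar>n - m\<bar> * V" for k n
      proof -
        have "\<bar>f (s k) n\<bar> \<le> C * \<rho> ^ nat \<bar>n - m\<bar> * \<bar>f (s k) m\<bar>" by (rule env)
        also have "\<dots> \<le> C * \<rho> ^ nat \<bar>n - m\<bar> * 1" using C \<rho> bound1 by (intro mult_left_mono) auto
        finally show ?thesis using vV[of n] C \<rho> by (auto simp: norm_mult intro!: mult_mono)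
      qed
      show "(\<lambda>n. C * \<rho> ^ nat \<bar>n - m\<bar> * V) summable_on UNIV"
        using \<rho> by (intro summable_on_cmult_left summable_on_cmult_right summable_on_int_geometric) auto
    qed
    moreover have "(\<Sum>\<^sub>\<infinity>n. of_real (f (s k) n) * v n) = (\<Sum>n\<in>sites (Ns (s k)). of_real (f (s k) n) * v n)" for k
    proof -
      have "(\<Sum>\<^sub>\<infinity>n. of_real (f (s k) n) * v n) = (\<Sum>\<^sub>\<infinity>n\<in>sites (Ns (s k)). of_real (f (s k) n) * v n)"
        by (rule infsum_cong_neutral) (auto intro!: zero)
      thus ?thesis by simp
    qed
    ultimately have "(\<lambda>k. norm (\<Sum>n\<in>sites (Ns (s k)). of_real (f (s k) n) * v n)) \<longlonglongrightarrow> norm (l2_inner u v)"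
      unfolding l2_inner_def u_def by (intro tendsto_norm) simp
    thus ?thesis by (rule LIMSEQ_le_const) (use \<theta> in auto)
  qed
  ultimately show ?thesis unfolding localized_eigenfunction_def by blast
qed

text \<open>\<open>v m\<close> is expanded in the basis of a large box. Bad eigenvectors contribute
  little by Cauchy--Schwarz. Good ones are at most \<open>W\<close> in number, and their
  coefficients become uniformly small, as otherwise a limit eigenfunction would not be orthogonal to
  \<open>v\<close>.\<close>

lemma (in random_jacobi) localized_eigenfunctions_complete:
  assumes w: "\<forall>n. w n \<in> {0..2 * t}"
    and small: "localizing w"
    and v: "in_l2 v" and perp: "\<And>E u. localized_eigenfunction a (pot w) E u \<Longrightarrow> l2_inner u v = 0"
  shows "v m = 0"
proof -
  obtain \<Phi> \<E> where sys: "\<And>N. box_eigensystem a (pot w) N (\<Phi> N) (\<E> N)"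
    using box_eigensystem_exists by metis
  define V where "V = (\<Sum>\<^sub>\<infinity>n. (norm (v n))\<^sup>2)"
  have V_nonneg: "V \<ge> 0" unfolding V_def by (rule infsum_nonneg) auto
  define c where "c N i = (\<Sum>n\<in>sites N. of_real (\<Phi> N i n) * v n)" for N i
  have sum_c: "(\<Sum>i\<in>sites N. (norm (c N i))\<^sup>2) \<le> V" if "m \<in> sites N" for N
  proof -
    have "(\<Sum>i\<in>sites N. (norm (c N i))\<^sup>2) = (\<Sum>n\<in>sites N. (norm (v n))\<^sup>2)"
      unfolding c_def by (rule box_expansion(2)[OF sys that])
    also have "\<dots> \<le> V" unfolding V_def using v by (intro finite_sum_le_infsum) (auto simp: in_l2_def)
    finally show ?thesis .
  qed
  have norm1: "(\<Sum>n\<in>sites N. (\<Phi> N i n)\<^sup>2) = 1" if "i \<in> sites N" for N i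
    using sys[of N] that unfolding box_eigensystem_def by (simp add: power2_eq_square)
  have weight1: "(\<Sum>i\<in>sites N. (\<Phi> N i m)\<^sup>2) = 1" if "m \<in> sites N" for N
    using sys[of N] that unfolding box_eigensystem_def by (simp add: power2_eq_square)
  have zero: "\<Phi> N i n = 0" if "n \<notin> sites N" for N i n
    using sys[of N] that unfolding box_eigensystem_def by blast
  have le1: "\<bar>\<Phi> N i n\<bar> \<le> 1" if "i \<in> sites N" for N i n
  proof (cases "n \<in> sites N")
    case True
    hence "(\<Phi> N i n)\<^sup>2 \<le> 1"
      using norm1[OF that] member_le_sum[of n "sites N" "\<lambda>n. (\<Phi> N i n)\<^sup>2"] by simp
    thus ?thesis by (simp add: abs_square_le_1)
  qed (simp add: zero)
  have pot_le: "\<bar>pot w n\<bar> \<le> B + 2 * t" for n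
  proof -
    have "w n \<in> {0..2 * t}" using w by blast
    thus ?thesis using b_le[of n] by (auto simp: pot_def)
  qed
  have key: "(norm (v m))\<^sup>2 \<le> \<kappa> * V" if \<kappa>: "\<kappa> > 0" for \<kappa> :: real
  proof -
    obtain C where C: "C \<ge> 1" and good: "\<And>N0. \<exists>N\<ge>N0. m \<in> sites N \<and>
      (\<forall>\<phi> E. box_eigensystem a (pot w) N \<phi> E \<longrightarrow> bad_weight C N m w \<phi> E < \<kappa>)"
      using small \<kappa> by blast
    \<comment> \<open>Squared l2 norm of the envelope: normalisation forces a good eigenvector to
      have weight at least \<open>1 / W\<close> at \<open>m\<close>.\<close>
    define W where "W = C\<^sup>2 * (\<Sum>\<^sub>\<infinity>n. (\<rho>\<^sup>2) ^ nat \<bar>n - m\<bar>)"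
    have \<rho>2: "0 \<le> \<rho>\<^sup>2" "\<rho>\<^sup>2 < 1" using \<rho> by (auto simp: power_less_one_iff)
    have low: "1 \<le> W * (\<Phi> N i m)\<^sup>2" if i: "i \<in> sites N" "m \<in> sites N" "\<not> bad C N m (\<E> N i) w" for N i
    proof -
      have "1 = (\<Sum>n\<in>sites N. (\<Phi> N i n)\<^sup>2)" using norm1[OF i(1)] by simp
      also have "\<dots> \<le> (\<Sum>n\<in>sites N. (C * \<rho> ^ nat \<bar>n - m\<bar> * \<bar>\<Phi> N i m\<bar>)\<^sup>2)"
      proof (rule sum_mono)
        fix n
        have "\<bar>\<Phi> N i n\<bar> \<le> C * \<rho> ^ nat \<bar>n - m\<bar> * \<bar>\<Phi> N i m\<bar>"
          by (rule not_bad_imp_envelope[OF i(2) sys i(1) i(3) C])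
        hence "\<bar>\<Phi> N i n\<bar>\<^sup>2 \<le> (C * \<rho> ^ nat \<bar>n - m\<bar> * \<bar>\<Phi> N i m\<bar>)\<^sup>2" by (intro power_mono) auto
        thus "(\<Phi> N i n)\<^sup>2 \<le> (C * \<rho> ^ nat \<bar>n - m\<bar> * \<bar>\<Phi> N i m\<bar>)\<^sup>2" by simp
      qed
      also have "\<dots> = C\<^sup>2 * (\<Sum>n\<in>sites N. (\<rho>\<^sup>2) ^ nat \<bar>n - m\<bar>) * (\<Phi> N i m)\<^sup>2"
        by (simp add: power_mult_distrib sum_distrib_left sum_distrib_right power_mult[symmetric] mult.commute)
      also have "\<dots> \<le> C\<^sup>2 * (\<Sum>\<^sub>\<infinity>n. (\<rho>\<^sup>2) ^ nat \<bar>n - m\<bar>) * (\<Phi> N i m)\<^sup>2"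
        using \<rho>2 by (intro mult_right_mono mult_left_mono finite_sum_le_infsum summable_on_int_geometric) auto
      finally show ?thesis unfolding W_def .
    qed
    have W: "W > 0"
    proof -
      have "(\<Sum>n\<in>{m}. (\<rho>\<^sup>2) ^ nat \<bar>n - m\<bar>) \<le> (\<Sum>\<^sub>\<infinity>n. (\<rho>\<^sup>2) ^ nat \<bar>n - m\<bar>)"
        using \<rho>2 by (intro finite_sum_le_infsum summable_on_int_geometric) auto
      thus ?thesis using C unfolding W_def by (intro mult_pos_pos) auto
    qed
    have uniform: "\<exists>N0. \<forall>N\<ge>N0. m \<in> sites N \<longrightarrow> (\<forall>i\<in>sites N. \<not> bad C N m (\<E> N i) w \<longrightarrow> norm (c N i) < \<theta>)" if \<theta>: "\<theta> > 0" for \<theta>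
    proof (rule ccontr)
      assume "\<not> ?thesis"
      hence "\<forall>k. \<exists>N i. N \<ge> k \<and> m \<in> sites N \<and> i \<in> sites N \<and> \<not> bad C N m (\<E> N i) w \<and> norm (c N i) \<ge> \<theta>"
        by (meson not_less)
      then obtain Ns I where NI: "\<And>k. Ns k \<ge> k" "\<And>k. m \<in> sites (Ns k)" "\<And>k. I k \<in> sites (Ns k)"
        "\<And>k. \<not> bad C (Ns k) m (\<E> (Ns k) (I k)) w" "\<And>k. norm (c (Ns k) (I k)) \<ge> \<theta>"
        by metis
      have "\<exists>E u. localized_eigenfunction a (pot w) E u \<and> norm (l2_inner u v) \<ge> \<theta>"
      proof (rule box_eigenfunctions_limit[OF \<rho>(1,2) _ W NI(1)])
        show "C > 0" using C by simp
        show "\<Phi> (Ns k) (I k) n = 0" if "n \<notin> sites (Ns k)" for k n by (rule zero[OF that])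
        show "jac a (pot w) (\<Phi> (Ns k) (I k)) n =
            \<E> (Ns k) (I k) * \<Phi> (Ns k) (I k) n" if "n \<in> sites (Ns k)" for k n
          using sys[of "Ns k"] NI(3)[of k] that unfolding box_eigensystem_def by blast
        show "\<bar>\<Phi> (Ns k) (I k) n\<bar> \<le> 1" for k n by (rule le1[OF NI(3)])
        show "\<bar>\<E> (Ns k) (I k)\<bar> \<le> 2 * A + (B + 2 * t)" for k
          by (rule box_eigenvalue_bound[OF sys NI(3)]) (use a_pos a_le pot_le in \<open>auto simp: abs_of_pos\<close>)
        show "\<bar>\<Phi> (Ns k) (I k) n\<bar> \<le> C * \<rho> ^ nat \<bar>n - m\<bar> * \<bar>\<Phi> (Ns k) (I k) m\<bar>" for k n
          by (rule not_bad_imp_envelope[OF NI(2) sys NI(3) NI(4) C])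
        show "1 \<le> W * (\<Phi> (Ns k) (I k) m)\<^sup>2" for k by (rule low[OF NI(3) NI(2) NI(4)])
        show "in_l2 v" by (rule v)
        show "\<theta> \<le> norm (\<Sum>n\<in>sites (Ns k). of_real (\<Phi> (Ns k) (I k) n) * v n)" for k using NI(5)[of k] by (simp only: c_def)
      qed
      thus False using perp \<theta> by fastforce
    qed
    have approx: "norm (v m) \<le> sqrt (\<kappa> * V) + W * \<theta>" if \<theta>: "\<theta> > 0" for \<theta>
    proof -
      obtain N0 where N0: "\<forall>N\<ge>N0. m \<in> sites N \<longrightarrow> (\<forall>i\<in>sites N. \<not> bad C N m (\<E> N i) w \<longrightarrow> norm (c N i) < \<theta>)"
        using uniform[OF \<theta>] by blast
      obtain N where N: "N \<ge> N0" "m \<in> sites N" and weight: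
        "\<forall>\<phi> E. box_eigensystem a (pot w) N \<phi> E \<longrightarrow> bad_weight C N m w \<phi> E < \<kappa>"
        using good by blast
      define S T where "S = {i\<in>sites N. bad C N m (\<E> N i) w}" and "T = sites N - S"
      have S: "S \<subseteq> sites N" by (auto simp: S_def)
      have small_w: "(\<Sum>i\<in>S. (\<Phi> N i m)\<^sup>2) < \<kappa>" using weight sys[of N] unfolding S_def by blast
      have "v m = (\<Sum>i\<in>sites N. of_real (\<Phi> N i m) * c N i)"
        unfolding c_def by (rule box_expansion(1)[OF sys N(2)])
      also have "\<dots> = (\<Sum>i\<in>T. of_real (\<Phi> N i m) * c N i) + (\<Sum>i\<in>S. of_real (\<Phi> N i m) * c N i)"
        unfolding T_def using S by (intro sum.subset_diff) auto
      finally have "norm (v m) \<le> norm (\<Sum>i\<in>T. of_real (\<Phi> N i m) * c N i) + norm (\<Sum>i\<in>S. of_real (\<Phi> N i m) * c N i)"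
        by (simp add: norm_triangle_ineq)
      moreover have "norm (\<Sum>i\<in>S. of_real (\<Phi> N i m) * c N i) \<le> sqrt (\<kappa> * V)"
      proof -
        have "norm (\<Sum>i\<in>S. of_real (\<Phi> N i m) * c N i) \<le> (\<Sum>i\<in>S. \<bar>\<Phi> N i m\<bar> * norm (c N i))"
          by (rule order_trans[OF norm_sum]) (simp add: norm_mult)
        also have "\<dots> \<le> sqrt (\<kappa> * V)"
        proof (rule real_le_rsqrt)
          have "(\<Sum>i\<in>S. \<bar>\<Phi> N i m\<bar> * norm (c N i))\<^sup>2 \<le> (\<Sum>i\<in>S. \<bar>\<Phi> N i m\<bar>\<^sup>2) * (\<Sum>i\<in>S. (norm (c N i))\<^sup>2)"
            by (rule Cauchy_Schwarz_ineq_sum)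
          also have "\<dots> \<le> \<kappa> * V"
          proof (rule mult_mono)
            show "(\<Sum>i\<in>S. \<bar>\<Phi> N i m\<bar>\<^sup>2) \<le> \<kappa>" using small_w by simp
            have "(\<Sum>i\<in>S. (norm (c N i))\<^sup>2) \<le> (\<Sum>i\<in>sites N. (norm (c N i))\<^sup>2)" using S by (intro sum_mono2) auto
            thus "(\<Sum>i\<in>S. (norm (c N i))\<^sup>2) \<le> V" using sum_c[OF N(2)] by linarith
          qed (use \<kappa> in \<open>auto intro!: sum_nonneg\<close>)
          finally show "(\<Sum>i\<in>S. \<bar>\<Phi> N i m\<bar> * norm (c N i))\<^sup>2 \<le> \<kappa> * V" .
        qed
        finally show ?thesis .
      qed
      moreover have "norm (\<Sum>i\<in>T. of_real (\<Phi> N i m) * c N i) \<le> W * \<theta>"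
      proof -
        have T: "i \<in> sites N" "\<not> bad C N m (\<E> N i) w" if "i \<in> T" for i using that by (auto simp: T_def S_def)
        \<comment> \<open>The weights at \<open>m\<close> add up to 1 and each good one is at least
          \<open>1 / W\<close>.\<close>
        have "real (card T) = (\<Sum>i\<in>T. 1)" by simp
        also have "\<dots> \<le> (\<Sum>i\<in>T. W * (\<Phi> N i m)\<^sup>2)" using T N(2) by (intro sum_mono low) auto
        also have "\<dots> = W * (\<Sum>i\<in>T. (\<Phi> N i m)\<^sup>2)" by (simp add: sum_distrib_left)
        also have "\<dots> \<le> W * (\<Sum>i\<in>sites N. (\<Phi> N i m)\<^sup>2)"
          using W by (intro mult_left_mono sum_mono2) (auto simp: T_def)
        finally have card: "real (card T) \<le> W" using weight1[OF N(2)] by simp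
        have "norm (\<Sum>i\<in>T. of_real (\<Phi> N i m) * c N i) \<le> (\<Sum>i\<in>T. \<bar>\<Phi> N i m\<bar> * norm (c N i))"
          by (rule order_trans[OF norm_sum]) (simp add: norm_mult)
        also have "\<dots> \<le> (\<Sum>i\<in>T. 1 * \<theta>)"
        proof (rule sum_mono)
          fix i assume i: "i \<in> T"
          have "norm (c N i) < \<theta>" using N0 N T[OF i] by blast
          thus "\<bar>\<Phi> N i m\<bar> * norm (c N i) \<le> 1 * \<theta>" using le1[OF T(1)[OF i]] by (intro mult_mono) auto
        qed
        also have "\<dots> = real (card T) * \<theta>" by simp
        also have "\<dots> \<le> W * \<theta>" using card \<theta> by (intro mult_right_mono) auto
        finally show ?thesis .
      qed
      ultimately show ?thesis by linarith
    qed
    \<comment> \<open>\<open>W\<close> depends on \<open>\<kappa>\<close> through \<open>C\<close>,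
      so \<open>\<theta>\<close> must tend to 0 first, with \<open>\<kappa>\<close> fixed.\<close>
    have "norm (v m) \<le> sqrt (\<kappa> * V)"
    proof (rule field_le_epsilon)
      fix \<epsilon> :: real assume "\<epsilon> > 0"
      thus "norm (v m) \<le> sqrt (\<kappa> * V) + \<epsilon>" using approx[of "\<epsilon> / W"] W by simp
    qed
    hence "(norm (v m))\<^sup>2 \<le> (sqrt (\<kappa> * V))\<^sup>2" by (intro power_mono) auto
    thus ?thesis using \<kappa> V_nonneg by simp
  qed
  have "(norm (v m))\<^sup>2 \<le> 0"
  proof (rule field_le_epsilon)
    fix \<epsilon> :: real assume \<epsilon>: "\<epsilon> > 0"
    \<comment> \<open>\<open>V + 1\<close> in place of \<open>V\<close> covers
      \<open>V = 0\<close>.\<close>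
    have "(norm (v m))\<^sup>2 \<le> \<epsilon> / (V + 1) * V" using \<epsilon> V_nonneg by (intro key) auto
    also have "\<dots> \<le> \<epsilon>" using \<epsilon> V_nonneg by (simp add: field_simps)
    finally show "(norm (v m))\<^sup>2 \<le> 0 + \<epsilon>" by simp
  qed
  thus ?thesis by simp
qed

section \<open>Orthogonality and simplicity of localized eigenfunctions, and the orthonormal
  basis\<close>

lemma exp_decaying_imp_geometric:
  assumes "exp_decaying u"
  obtains K q where "K > 0" "0 < q" "q < 1" "\<And>n. norm (u n) \<le> K * q ^ nat \<bar>n\<bar>"
proof -
  obtain C \<eta> where C: "C > 0" "\<eta> > 0" "\<And>n. norm (u n) \<le> C * exp (- \<eta> * of_int \<bar>n\<bar>)"
    using assms unfolding exp_decaying_def by blast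
  have "exp (- \<eta> * of_int \<bar>n\<bar>) = exp (- \<eta>) ^ nat \<bar>n\<bar>" for n
    by (simp add: exp_of_nat_mult[symmetric] mult.commute)
  thus thesis using that[of C "exp (- \<eta>)"] C by simp
qed

lemma exp_decaying_shift_summable:
  assumes "exp_decaying u"
  shows "(\<lambda>n. norm (u (n + j))) summable_on UNIV"
proof -
  obtain K q where K: "K > 0" "0 < q" "q < 1" "\<And>n. norm (u n) \<le> K * q ^ nat \<bar>n\<bar>"
    by (rule exp_decaying_imp_geometric[OF assms]) blast
  have "(\<lambda>n. K * q ^ nat \<bar>n - (- j)\<bar>) summable_on UNIV"
    using K by (intro summable_on_cmult_right summable_on_int_geometric) auto
  thus ?thesis by (rule summable_on_comparison_test) (use K(4)[of "_ + j"] in auto)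
qed

lemma exp_decaying_bounded:
  assumes "exp_decaying u"
  obtains K where "K > 0" "\<And>n. norm (u n) \<le> K"
proof -
  obtain K q where K: "K > 0" "0 < q" "q < 1" "\<And>n. norm (u n) \<le> K * q ^ nat \<bar>n\<bar>"
    by (rule exp_decaying_imp_geometric[OF assms]) blast
  have "K * q ^ nat \<bar>n\<bar> \<le> K * 1" for n using K by (intro mult_left_mono power_le_one) auto
  hence "norm (u n) \<le> K" for n using K(4)[of n] by (metis mult_1_right order_trans)
  thus thesis using that K(1) by blast
qed

lemma exp_decaying_in_l2:
  assumes "exp_decaying u"
  shows "in_l2 u"
proof -
  obtain K where K: "K > 0" "\<And>n. norm (u n) \<le> K" by (rule exp_decaying_bounded[OF assms]) blast
  have "(\<lambda>n. K * norm (u n)) summable_on UNIV"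
    using exp_decaying_shift_summable[OF assms, of 0] by (intro summable_on_cmult_right) simp
  thus ?thesis unfolding in_l2_def
    by (rule summable_on_comparison_test) (use K in \<open>auto simp: power2_eq_square intro!: mult_right_mono\<close>)
qed

text \<open>Discrete Wronskian weighted by the coupling, bilinear rather than sesquilinear.\<close>

definition casoratian :: "(int \<Rightarrow> real) \<Rightarrow> (int \<Rightarrow> complex) \<Rightarrow> (int \<Rightarrow> complex) \<Rightarrow> int \<Rightarrow> complex" where
  "casoratian a p q n = of_real (a n) * (p n * q (n + 1) - p (n + 1) * q n)"

text \<open>Discrete Lagrange identity. Different energies make the inner product telescope; equal
  energies make the Casoratian constant.\<close>

lemma casoratian_diff:
  assumes "jacobi a \<beta> p = (\<lambda>n. of_real E * p n)" "jacobi a \<beta> q = (\<lambda>n. of_real E' * q n)"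
  shows "casoratian a p q n - casoratian a p q (n - 1) = of_real (E' - E) * (p n * q n)"
proof -
  have p: "jac_of_real a \<beta> p n = of_real E * p n"
    and q: "jac_of_real a \<beta> q n = of_real E' * q n"
    using assms by (auto simp: jacobi_def fun_eq_iff)
  have "of_real (E' - E) * (p n * q n) = p n * (of_real E' * q n) - q n * (of_real E * p n)" by (simp add: algebra_simps)
  also have "\<dots> = casoratian a p q n - casoratian a p q (n - 1)"
    unfolding p[symmetric] q[symmetric] casoratian_def by (simp add: algebra_simps)
  finally show ?thesis by simp
qed

lemma casoratian_abs_summable:
  assumes a: "\<And>n. \<bar>a n\<bar> \<le> A" and p: "exp_decaying p" and q: "exp_decaying q"
  shows "(\<lambda>n. norm (casoratian a p q n)) summable_on UNIV"
proof -
  obtain K where K: "K > 0" "\<And>n. norm (q n) \<le> K" by (rule exp_decaying_bounded[OF q]) blast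
  have A: "A \<ge> 0" using a[of 0] by linarith
  have "(\<lambda>n. A * (K * norm (p (n + 0)) + K * norm (p (n + 1)))) summable_on UNIV"
    by (intro summable_on_cmult_right summable_on_add exp_decaying_shift_summable p)
  thus ?thesis
  proof (rule summable_on_comparison_test)
    fix n
    have "norm (p n * q (n + 1) - p (n + 1) * q n) \<le> norm (p n) * norm (q (n + 1)) + norm (p (n + 1)) * norm (q n)"
      by (metis norm_mult norm_triangle_ineq4)
    also have "\<dots> \<le> norm (p n) * K + norm (p (n + 1)) * K" using K by (intro add_mono mult_left_mono) auto
    finally show "norm (casoratian a p q n) \<le> A * (K * norm (p (n + 0)) + K * norm (p (n + 1)))"
      unfolding casoratian_def norm_mult using a[of n] A by (intro mult_mono) (auto simp: mult.commute)
  qed auto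
qed

text \<open>The Lagrange identity is summed over the line for \<open>cnj u\<close>, again a solution
  since coefficients and energy are real. The Casoratian and its shift are summable with the same
  sum.\<close>

lemma localized_eigenfunctions_orthogonal:
  assumes a: "\<And>n. \<bar>a n\<bar> \<le> A" and u: "localized_eigenfunction a \<beta> E u" and v: "localized_eigenfunction a \<beta> E' v"
    and ne: "E \<noteq> E'"
  shows "l2_inner u v = 0"
proof -
  define p where "p n = cnj (u n)" for n
  have p: "exp_decaying p" using u by (simp add: localized_eigenfunction_def exp_decaying_def p_def)
  have pJ: "jacobi a \<beta> p = (\<lambda>n. of_real E * p n)"
  proof
    fix n
    have "jacobi a \<beta> p n = cnj (jacobi a \<beta> u n)" by (simp add: jacobi_def p_def)
    thus "jacobi a \<beta> p n = of_real E * p n" using u by (simp add: localized_eigenfunction_def p_def)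
  qed
  have v': "exp_decaying v" "jacobi a \<beta> v = (\<lambda>n. of_real E' * v n)" using v by (auto simp: localized_eigenfunction_def)
  define W where "W = casoratian a p v"
  have sumW: "W summable_on UNIV" unfolding W_def
    by (rule abs_summable_summable[OF casoratian_abs_summable[OF a p v'(1)]])
  have bij: "bij_betw (\<lambda>n::int. n - 1) UNIV UNIV" by (rule bij_betw_byWitness[where f' = "\<lambda>n. n + 1"]) auto
  have sumW': "(\<lambda>n. W (n - 1)) summable_on UNIV"
    using summable_on_reindex_bij_betw[OF bij, of W] sumW by simp
  have infW': "(\<Sum>\<^sub>\<infinity>n. W (n - 1)) = (\<Sum>\<^sub>\<infinity>n. W n)" by (rule infsum_reindex_bij_betw[OF bij])
  have "of_real (E' - E) * l2_inner u v = (\<Sum>\<^sub>\<infinity>n. of_real (E' - E) * (p n * v n))"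
    unfolding l2_inner_def p_def by (rule infsum_cmult_right'[symmetric])
  also have "\<dots> = (\<Sum>\<^sub>\<infinity>n. W n - W (n - 1))" unfolding W_def by (simp only: casoratian_diff[OF pJ v'(2)])
  also have "\<dots> = (\<Sum>\<^sub>\<infinity>n. W n) - (\<Sum>\<^sub>\<infinity>n. W (n - 1))" using infsum_add[OF sumW summable_on_uminus[THEN iffD2, OF sumW']] by (simp add: infsum_uminus)
  also have "\<dots> = 0" using infW' by simp
  finally show ?thesis using ne by simp
qed

lemma jacobi_solution_zero:
  assumes a: "\<And>n. a n \<noteq> 0" and d: "jacobi a \<beta> d = (\<lambda>n. z * d n)" and zero: "d k = 0" "d (k + 1) = 0"
  shows "d n = 0"
proof -
  have eq: "jac_of_real a \<beta> d n = z * d n" for n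
    using d by (auto simp: jacobi_def fun_eq_iff)
  have up: "d (k + int j) = 0 \<and> d (k + int j + 1) = 0" for j
  proof (induction j)
    case (Suc j)
    define n where "n = k + int j + 1"
    have n: "k + int j = n - 1" "k + int j + 1 = n" "k + int (Suc j) = n" by (auto simp: n_def)
    show ?case using Suc eq[of n] a[of n] unfolding n by simp
  qed (use zero in auto)
  have down: "d (k - int j) = 0 \<and> d (k - int j + 1) = 0" for j
  proof (induction j)
    case (Suc j)
    define n where "n = k - int j"
    have n: "k - int j = n" "k - int (Suc j) = n - 1" by (auto simp: n_def)
    show ?case using Suc eq[of n] a[of "n - 1"] unfolding n by simp
  qed (use zero in auto)
  show ?thesis
  proof (cases "n \<ge> k")
    case True thus ?thesis using up[of "nat (n - k)"] by simp
  next
    case False thus ?thesis using down[of "nat (k - n)"] by simp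
  qed
qed

text \<open>At equal energies the Casoratian is constant, and being summable it vanishes. Then
  \<open>v\<close> minus a multiple of \<open>u\<close> is a solution with two adjacent
  zeros.\<close>

lemma localized_eigenfunctions_simple:
  assumes a_le: "\<And>n. \<bar>a n\<bar> \<le> A" and a: "\<And>n. a n \<noteq> 0"
    and u: "localized_eigenfunction a \<beta> E u" and v: "localized_eigenfunction a \<beta> E v"
  shows "\<exists>c. v = (\<lambda>n. c * u n)"
proof -
  have u': "exp_decaying u" "jacobi a \<beta> u = (\<lambda>n. of_real E * u n)" "u \<noteq> (\<lambda>_. 0)" using u by (auto simp: localized_eigenfunction_def)
  have v': "exp_decaying v" "jacobi a \<beta> v = (\<lambda>n. of_real E * v n)" using v by (auto simp: localized_eigenfunction_def)
  define W where "W = casoratian a u v"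
  have step: "W n = W (n - 1)" for n using casoratian_diff[OF u'(2) v'(2), of n] by (simp add: W_def)
  have const: "W (n + int j) = W n" for n j
  proof (induction j)
    case (Suc j)
    thus ?case using step[of "n + int (Suc j)"] by (simp add: algebra_simps)
  qed simp
  have W0: "W n = 0" for n
  proof (rule ccontr)
    assume "W n \<noteq> 0"
    \<comment> \<open>\<open>k\<close> equal terms would exceed the total sum.\<close>
    then obtain k :: nat where k: "real k * norm (W n) > (\<Sum>\<^sub>\<infinity>n. norm (W n))"
      using reals_Archimedean3[of "norm (W n)"] by auto
    have "(\<Sum>i\<in>(\<lambda>j. n + int j) ` {..<k}. norm (W i)) \<le> (\<Sum>\<^sub>\<infinity>n. norm (W n))"
      unfolding W_def by (intro finite_sum_le_infsum casoratian_abs_summable[OF a_le] u' v') auto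
    also have "(\<Sum>i\<in>(\<lambda>j. n + int j) ` {..<k}. norm (W i)) = real k * norm (W n)"
      by (subst sum.reindex) (auto simp: inj_on_def const)
    finally show False using k by simp
  qed
  have proportional: "u n * v (n + 1) = u (n + 1) * v n" for n using W0[of n] a[of n] by (simp add: W_def casoratian_def)
  obtain k where k: "u k \<noteq> 0" using u'(3) by auto
  define c where "c = v k / u k"
  define d where "d n = v n - c * u n" for n
  have "jacobi a \<beta> d = (\<lambda>n. of_real E * d n)"
  proof
    fix n
    have "jacobi a \<beta> d n = jacobi a \<beta> v n - c * jacobi a \<beta> u n" by (simp add: jacobi_def d_def algebra_simps)
    thus "jacobi a \<beta> d n = of_real E * d n" using u'(2) v'(2) by (simp add: d_def algebra_simps)
  qed
  moreover have "d k = 0" using k by (simp add: d_def c_def)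
  moreover have "d (k + 1) = 0" using k proportional[of k] by (simp add: d_def c_def field_simps)
  ultimately have "d n = 0" for n using jacobi_solution_zero[of a \<beta> d "of_real E" k n] a by blast
  thus ?thesis by (intro exI[of _ c]) (auto simp: d_def fun_eq_iff)
qed

lemma localized_eigenfunction_normalize:
  assumes u: "localized_eigenfunction a \<beta> E u"
  shows "\<exists>u'. localized_eigenfunction a \<beta> E u' \<and> l2_inner u' u' = 1"
proof -
  have u': "exp_decaying u" "jacobi a \<beta> u = (\<lambda>n. of_real E * u n)" "u \<noteq> (\<lambda>_. 0)" using u by (auto simp: localized_eigenfunction_def)
  obtain k where k: "u k \<noteq> 0" using u'(3) by auto
  define S where "S = (\<Sum>\<^sub>\<infinity>n. (norm (u n))\<^sup>2)"
  have "(\<Sum>n\<in>{k}. (norm (u n))\<^sup>2) \<le> S"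
    unfolding S_def using exp_decaying_in_l2[OF u'(1)] by (intro finite_sum_le_infsum) (auto simp: in_l2_def)
  hence S: "S > 0" using k by (simp add: less_le_trans[of 0 "(norm (u k))\<^sup>2"])
  have inner: "l2_inner u u = of_real S"
  proof -
    have "l2_inner u u = (\<Sum>\<^sub>\<infinity>n. of_real ((norm (u n))\<^sup>2))"
      unfolding l2_inner_def complex_norm_square by (simp add: mult.commute)
    also have "\<dots> = of_real S" unfolding S_def
      using exp_decaying_in_l2[OF u'(1)] unfolding in_l2_def
      by (intro infsumI has_sum_of_real has_sum_infsum)
    finally show ?thesis .
  qed
  define r where "r = 1 / sqrt S"
  have r: "r > 0" "r\<^sup>2 * S = 1" using S by (auto simp: r_def power_divide)
  define u1 where "u1 n = of_real r * u n" for n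
  have "exp_decaying u1"
  proof -
    obtain C \<eta> where C: "C > 0" "\<eta> > 0" "\<And>n. norm (u n) \<le> C * exp (- \<eta> * of_int \<bar>n\<bar>)"
      using u'(1) unfolding exp_decaying_def by blast
    have "r * C > 0" "norm (u1 n) \<le> r * C * exp (- \<eta> * of_int \<bar>n\<bar>)" for n
      using C r by (auto simp: u1_def norm_mult mult.assoc intro!: mult_left_mono)
    thus ?thesis unfolding exp_decaying_def using C(2) by blast
  qed
  moreover have "u1 \<noteq> (\<lambda>_. 0)" using k r by (auto simp: u1_def fun_eq_iff)
  moreover have "jacobi a \<beta> u1 = (\<lambda>n. of_real E * u1 n)"
  proof
    fix n
    have "jacobi a \<beta> u1 n = of_real r * jacobi a \<beta> u n" by (simp add: jacobi_def u1_def algebra_simps)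
    thus "jacobi a \<beta> u1 n = of_real E * u1 n" using u'(2) by (simp add: u1_def)
  qed
  moreover have "l2_inner u1 u1 = 1"
  proof -
    have "l2_inner u1 u1 = (\<Sum>\<^sub>\<infinity>n. of_real (r\<^sup>2) * (cnj (u n) * u n))"
      unfolding l2_inner_def u1_def by (intro infsum_cong) (simp add: power2_eq_square)
    also have "\<dots> = of_real (r\<^sup>2) * l2_inner u u" unfolding l2_inner_def by (rule infsum_cmult_right')
    also have "\<dots> = of_real (r\<^sup>2 * S)" by (simp add: inner)
    finally show ?thesis using r(2) by simp
  qed
  ultimately show ?thesis unfolding localized_eigenfunction_def by blast
qed

text \<open>By simplicity one normalised eigenfunction per eigenvalue suffices: a vector orthogonal
  to it is orthogonal to every localized eigenfunction of that eigenvalue.\<close>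

theorem ex_localized_onb:
  assumes a_le: "\<And>n. \<bar>a n\<bar> \<le> A" and a: "\<And>n. a n \<noteq> 0"
    and complete: "\<And>v. in_l2 v \<Longrightarrow> (\<And>E u. localized_eigenfunction a \<beta> E u \<Longrightarrow> l2_inner u v = 0) \<Longrightarrow> v = (\<lambda>_. 0)"
  shows "\<exists>B. l2_onb B \<and> (\<forall>u\<in>B. is_eigenfunction a \<beta> u \<and> exp_decaying u)"
proof -
  define \<Sigma> where "\<Sigma> = {E. \<exists>u. localized_eigenfunction a \<beta> E u}"
  define rep where "rep E = (SOME u. localized_eigenfunction a \<beta> E u \<and> l2_inner u u = 1)" for E
  have rep: "localized_eigenfunction a \<beta> E (rep E) \<and> l2_inner (rep E) (rep E) = 1" if "E \<in> \<Sigma>" for E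
  proof -
    have "\<exists>u. localized_eigenfunction a \<beta> E u \<and> l2_inner u u = 1"
      using that localized_eigenfunction_normalize unfolding \<Sigma>_def by blast
    thus ?thesis unfolding rep_def by (rule someI_ex)
  qed
  have "l2_onb (rep ` \<Sigma>)"
    unfolding l2_onb_def
  proof (intro conjI ballI impI allI)
    fix u assume "u \<in> rep ` \<Sigma>"
    thus "in_l2 u" "l2_inner u u = 1" using rep by (auto simp: localized_eigenfunction_def exp_decaying_in_l2)
  next
    fix u v assume "u \<in> rep ` \<Sigma>" "v \<in> rep ` \<Sigma>" "u \<noteq> v"
    then obtain E E' where "E \<in> \<Sigma>" "E' \<in> \<Sigma>" "u = rep E" "v = rep E'" "E \<noteq> E'" by blast
    thus "l2_inner u v = 0"
      by (intro localized_eigenfunctions_orthogonal[of a A \<beta> E u E' v]) (use a_le rep in auto)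
  next
    fix v assume v: "in_l2 v \<and> (\<forall>u\<in>rep ` \<Sigma>. l2_inner u v = 0)"
    show "v = (\<lambda>_. 0)"
    proof (rule complete)
      show "in_l2 v" using v by simp
      fix E u assume u: "localized_eigenfunction a \<beta> E u"
      hence E: "E \<in> \<Sigma>" by (auto simp: \<Sigma>_def)
      obtain c where c: "u = (\<lambda>n. c * rep E n)"
        using localized_eigenfunctions_simple[of a A \<beta> E "rep E" u] a_le a u rep[OF E] by blast
      have "l2_inner u v = (\<Sum>\<^sub>\<infinity>n. cnj c * (cnj (rep E n) * v n))"
        unfolding l2_inner_def c by (simp add: mult.assoc)
      also have "\<dots> = cnj c * l2_inner (rep E) v" unfolding l2_inner_def by (rule infsum_cmult_right')
      finally show "l2_inner u v = 0" using v E by simp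
    qed
  qed
  moreover have "is_eigenfunction a \<beta> u \<and> exp_decaying u" if "u \<in> rep ` \<Sigma>" for u
  proof -
    have "exp_decaying u" "u \<noteq> (\<lambda>_. 0)" "\<exists>E. jacobi a \<beta> u = (\<lambda>n. of_real E * u n)"
      using that rep by (auto simp: localized_eigenfunction_def)
    thus ?thesis unfolding is_eigenfunction_def using exp_decaying_in_l2 by blast
  qed
  ultimately show ?thesis by blast
qed

theorem theorem2p1:
  fixes a b :: "int \<Rightarrow> real" and \<delta> \<epsilon> :: real
  assumes "\<delta> > 0"
    and "bounded_seq a" and "bounded_seq b"
    and "\<forall>n. a n \<ge> \<delta>"
    and "\<epsilon> > 0"
  shows "\<exists>a' b' :: int \<Rightarrow> real.
           (\<exists>c<\<epsilon>. \<forall>n. \<bar>a' n - a n\<bar> \<le> c) \<and>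
           (\<exists>c<\<epsilon>. \<forall>n. \<bar>b' n - b n\<bar> \<le> c) \<and>
           (\<exists>B. l2_onb B \<and> (\<forall>u\<in>B. is_eigenfunction a' b' u \<and> exp_decaying u))"
proof -
  obtain A where A: "\<And>n. \<bar>a n\<bar> \<le> A" using assms(2) unfolding bounded_seq_def by blast
  obtain B where B: "\<And>n. \<bar>b n\<bar> \<le> B" using assms(3) unfolding bounded_seq_def by blast
  have a_pos: "a n > 0" for n using assms(1,4) less_le_trans by blast
  have a_le: "a n \<le> A" for n using A[of n] by linarith
  \<comment> \<open>The random potentials lie in \<open>[0, 2 * t] = [0, \<epsilon> / 2]\<close>,
    which secures the strict inequality for the supremum.\<close>
  define t where "t = \<epsilon> / 4"
  have t: "t > 0" using assms(5) by (simp add: t_def)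
  obtain r :: nat where r0: "2 * A / t \<le> real r" using real_arch_simple by blast
  hence r: "2 * A \<le> real r * t" using t by (simp add: field_simps)
  have "A > 0" using a_pos[of 0] a_le[of 0] by linarith
  hence "0 < 2 * A / t" using t by simp
  hence r_pos: "real r > 0" using r0 by linarith
  define q where "q = gap r"
  have "1 / (1024 * (real r)\<^sup>2) > 0" using r_pos by simp
  hence "1 < 1 + 1 / (1024 * (real r)\<^sup>2)" by linarith
  hence q: "0 < q" "q < 1" unfolding q_def by (auto simp only: divide_less_eq_1_pos zero_less_divide_iff)
  \<comment> \<open>The eighth root turns \<open>gap r \<le> \<rho> ^ 8\<close> into an
    equality.\<close>
  define \<rho> where "\<rho> = root 8 q"
  have \<rho>: "0 < \<rho>" "\<rho> < 1" "\<rho> ^ 8 = q" using q by (auto simp: \<rho>_def)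
  interpret random_jacobi a b t A B \<rho> r
    using t a_pos a_le r B \<rho> by unfold_locales (auto simp: q_def)
  obtain w where w: "\<forall>n. w n \<in> {0..2 * t}" and small: "localizing w"
    using ex_localizing_potential by blast
  have "\<exists>B. l2_onb B \<and> (\<forall>u\<in>B. is_eigenfunction a (pot w) u \<and> exp_decaying u)"
  proof (rule ex_localized_onb[OF A])
    show "a n \<noteq> 0" for n using a_pos[of n] by simp
    fix v assume "in_l2 v" "\<And>E u. localized_eigenfunction a (pot w) E u \<Longrightarrow> l2_inner u v = 0"
    thus "v = (\<lambda>_. 0)" using localized_eigenfunctions_complete[OF w small] by blast
  qed
  moreover have "\<bar>pot w n - b n\<bar> \<le> \<epsilon> / 2" for n
  proof -
    have "w n \<in> {0..2 * t}" using w by blast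
    thus ?thesis by (auto simp: pot_def t_def)
  qed
  ultimately show ?thesis using assms(5)
    by (intro exI[of _ a] exI[of _ "pot w"] conjI exI[of _ 0] exI[of _ "\<epsilon> / 2"]) auto
qed

end
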